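(* Let $r>1$, $n\ge1$, let $p$ be a positive divisor of $r$, and let $\mathbb H$ be the rational Cherednik algebra of $G(r,p,n)$ with $\kappa=1$ and parameters $c_0$ and $c_l$ ($1\le l\le r-1$, $c_l=0$ unless $p\mid l$); put $d_j=\sum_{l=1}^{r-1}\zeta^{lj}c_l$ for $j\in\mathbb Z$. Let $k\in\mathbb Z_{>0}$ with $k\not\equiv0 \bmod r$. Suppose that (i) $d_0-d_{-k}+rc_0(n-1)=k$; (ii) for all $j\in\mathbb Z_{>0}$ with $j\not\equiv0\bmod r$ and all $1\le l\le n$ with $(j,l)\neq(k,1)$, one has $d_0-d_{-j}+rc_0(n-l)\neq j$; (iii) $c_0\notin\frac1n\mathbb Z_{>0}$. Then the unique proper non-zero $\mathbb H$-submodule of $M(\mathbf 1)=\mathbb C[x_1,\dots,x_n]$ is $$\mathbb C\{f_\lambda \mid \lambda\in\mathbb Z_{\ge0}^n \text{ has at least one part of size at least } k\}.$$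
   Context: Notation. $\zeta=e^{2\pi i/r}$; $G(r,1,n)$ is the group of $n\times n$ monomial matrices with nonzero entries $r$-th roots of $1$; $G(r,p,n)$ is the subgroup where the product of the nonzero entries is an $(r/p)$-th root of $1$. $\mathfrak h=\mathbb C^n$ has standard basis $y_1,\dots,y_n$, and $\mathfrak h^*$ has dual basis $x_1,\dots,x_n$. $\zeta_i$ is the diagonal matrix with $\zeta$ in position $i$ and $1$ elsewhere; $s_{ij}$ is the transposition matrix. The group acts on $\mathfrak h^*$ contragrediently, so $\zeta_i x_i=\zeta^{-1}x_i$. $\mathbb H$ is the $\mathbb C$-algebra generated by $\mathbb C[x_1,\dots,x_n]$, $\mathbb C[y_1,\dots,y_n]$ and $t_w$ ($w\in G(r,p,n)$) with relations $t_wt_v=t_{wv}$, $t_wx=(wx)t_w$, $t_wy=(wy)t_w$ for $x\in\mathfrak h^*,y\in\mathfrak h$, and $$y_ix_j=x_jy_i+c_0\sum_{l=0}^{r-1}\zeta^{-l}t_{\zeta_i^ls_{ij}\zeta_i^{-l}}\ (i\ne j),\qquad y_ix_i=x_iy_i+\kappa-\sum_{l=1}^{r-1}c_l(1-\zeta^{-l})t_{\zeta_i^l}-c_0\sum_{j\ne i}\sum_{l=0}^{r-1}t_{\zeta_i^ls_{ij}\zeta_i^{-l}}.$$ Here $c_l=0$ whenever $p\nmid l$; consequently $d_j$ depends only on $j$ mod $r/p$, $d_0+\cdots+d_{r/p-1}=0$, and the parameters are determined by $(\kappa,c_0,d_1,\dots,d_{r/p-1})$. $M(\mathbf 1)=\mathbb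 C[x_1,\dots,x_n]$ is the polynomial representation: $x_i$ acts by multiplication, $t_w$ by the natural action of $w$, and $y_i$ by $y_i.f=\kappa\,\partial f/\partial x_i-c_0\sum_{j\neq i}\sum_{l=0}^{r-1}\frac{f-\zeta_i^ls_{ij}\zeta_i^{-l}f}{x_i-\zeta^lx_j}-\sum_{l=1}^{r-1}c_l\frac{f-\zeta_i^lf}{x_i}$. For $1\le i\le n$ let $z_i=y_ix_i+c_0\sum_{1\le j<i}\sum_{l=0}^{r-1}t_{\zeta_i^ls_{ij}\zeta_i^{-l}}\in\mathbb H$, and let $\mathfrak t$ be the (commutative) subalgebra of $\mathbb H$ generated by $z_1,\dots,z_n$, $t_{\zeta_i\zeta_{i+1}^{-1}}$ ($1\le i\le n-1$) and $t_{\zeta_i^p}$ ($1\le i\le n$). For $\mu\in\mathbb Z_{\ge0}^n$ let $\mu_+$ and $\mu_-$ be its non-increasing and non-decreasing rearrangements and let $v_\mu\in S_n$ be the permutation of maximal length with $v_\mu.\mu=\mu_-$. Partial order: $\lambda<\mu$ iff $\lambda_+<_d\mu_+$, or $\lambda_+=\mu_+$ and $v_\lambda<v_\mu$ in Bruhat order; here $\lambda\le_d\mu$ means $\mu-\lambda\in\sum_{i=1}^{n-1}\mathbb Z_{\ge0}(\epsilon_i-\epsilon_{i+1})$, with $\epsilon_i$ the standard basis vectors of $\mathbb Z^n$. When the parameters are generic (indeterminates, i.e. over the field $\mathbb C(\kappa,c_0,d_1,\dots,d_{r/p-1})$), for each $\mu\in\mathbb Z_{\ge0}^n$ there is a unique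 $\mathfrak t$-eigenvector $f_\mu$ in $M(\mathbf 1)$ of the form $x^\mu+\sum_{\nu<\mu}a_\nu x^\nu$. In the claim, $f_\mu$ denotes this eigenvector at the given parameter values, where it is taken to be well-defined. *)

theory Defs
  imports
    Complex_Main
    "HOL-Library.Poly_Mapping"
    "HOL-Computational_Algebra.Fraction_Field"
    "HOL-Combinatorics.Permutations"
    "Jordan_Normal_Form.Matrix"
begin

text \<open>
  All indices are shifted to start at 0: the basis vectors, the variables and the matrix entries
  are numbered by \<open>{..<n}\<close>, and \<open>S\<^sub>n\<close> consists of the permutations of \<open>{..<n}\<close>.
  Everything is defined over an arbitrary field, because the eigenvectors \<open>f\<^sub>\<mu>\<close> live over a field
  of rational functions in the parameters and are then specialised to complex parameters.
\<close>


section \<open>Polynomials\<close>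

text \<open>
  Polynomials in the variables \<open>x\<^sub>0, x\<^sub>1, \<dots>\<close> are finitely supported functions on exponent vectors;
  the multiplication of \<^theory>\<open>HOL-Library.Poly_Mapping\<close> is the convolution product.
\<close>

type_synonym expo = "nat \<Rightarrow>\<^sub>0 nat"
type_synonym 'a mpol = "expo \<Rightarrow>\<^sub>0 'a"

definition mconst :: "'a::zero \<Rightarrow> 'a mpol" where
  "mconst a = Poly_Mapping.single 0 a"

definition mvar :: "nat \<Rightarrow> 'a::zero_neq_one mpol" where
  "mvar i = Poly_Mapping.single (Poly_Mapping.single i 1) 1"

definition mscale :: "'a::field \<Rightarrow> 'a mpol \<Rightarrow> 'a mpol" where
  "mscale a f = mconst a * f"

interpretation mpol: vector_space mscale
  by unfold_locales
    (simp_all add: mscale_def mconst_def algebra_simps single_add mult_single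
      flip: mult.assoc)

definition expos :: "nat \<Rightarrow> expo set" where
  "expos n = {\<mu>. Poly_Mapping.keys \<mu> \<subseteq> {..<n}}"

definition polys :: "nat \<Rightarrow> 'a::zero mpol set" where
  "polys n = {f. Poly_Mapping.keys f \<subseteq> expos n}"

definition msubst :: "(nat \<Rightarrow> 'a mpol) \<Rightarrow> 'a::field mpol \<Rightarrow> 'a mpol" where
  "msubst \<sigma> f = (\<Sum>m\<in>Poly_Mapping.keys f. mconst (Poly_Mapping.lookup f m) *
     (\<Prod>i\<in>Poly_Mapping.keys m. \<sigma> i ^ Poly_Mapping.lookup m i))"

definition meval :: "(nat \<Rightarrow> 'a) \<Rightarrow> 'a::comm_ring_1 mpol \<Rightarrow> 'a" where
  "meval v f = (\<Sum>m\<in>Poly_Mapping.keys f. Poly_Mapping.lookup f m *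
     (\<Prod>i\<in>Poly_Mapping.keys m. v i ^ Poly_Mapping.lookup m i))"

text \<open>Where \<open>x\<^sub>i\<close> does not occur the exponent subtraction truncates, but then the coefficient is 0.\<close>

definition mderiv :: "nat \<Rightarrow> 'a::field mpol \<Rightarrow> 'a mpol" where
  "mderiv i f = (\<Sum>m\<in>Poly_Mapping.keys f.
     Poly_Mapping.single (m - Poly_Mapping.single i 1)
       (of_nat (Poly_Mapping.lookup m i) * Poly_Mapping.lookup f m))"

text \<open>Exact division; unique for \<open>g \<noteq> 0\<close> since polynomials form an integral domain.\<close>

definition mquot :: "'a::field mpol \<Rightarrow> 'a mpol \<Rightarrow> 'a mpol" where
  "mquot f g = (THE q. q * g = f)"


section \<open>Parameters and the group \<open>G(r,p,n)\<close>\<close>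

text \<open>
  \<open>zeta\<close> is a primitive \<open>r\<close>-th root of unity in the ground field. \<open>c0par\<close> is \<open>c\<^sub>0\<close>, and \<open>cpar l\<close>
  is \<open>c\<^sub>l\<close> for \<open>1 \<le> l \<le> r - 1\<close>; other values of \<open>cpar\<close> are never used.
\<close>

record 'a cparams =
  dimn :: nat
  ordr :: nat
  divp :: nat
  zeta :: 'a
  kappa :: 'a
  c0par :: 'a
  cpar :: "nat \<Rightarrow> 'a"

definition dpar :: "'a::field cparams \<Rightarrow> int \<Rightarrow> 'a" where
  "dpar P j = (\<Sum>l = 1..ordr P - 1. zeta P powi (int l * j) * cpar P l)"

definition monomial_mat :: "nat \<Rightarrow> 'a::field mat \<Rightarrow> bool" where
  "monomial_mat n w \<longleftrightarrow> w \<in> carrier_mat n n \<and>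
     (\<exists>\<sigma>. \<sigma> permutes {..<n} \<and> (\<forall>a<n. \<forall>b<n. w $$ (a, b) \<noteq> 0 \<longleftrightarrow> a = \<sigma> b))"

definition Grpn :: "'a::field cparams \<Rightarrow> 'a mat set" where
  "Grpn P = {w. monomial_mat (dimn P) w \<and>
     (\<forall>a<dimn P. \<forall>b<dimn P. w $$ (a, b) \<noteq> 0 \<longrightarrow> (w $$ (a, b)) ^ ordr P = 1) \<and>
     (\<Prod>ab\<in>{ab \<in> {..<dimn P} \<times> {..<dimn P}. w $$ ab \<noteq> 0}. w $$ ab) ^ (ordr P div divp P) = 1}"

text \<open>\<open>dg n i u\<close> is the diagonal matrix with \<open>u\<close> in position \<open>i\<close> and 1 elsewhere,
  so that \<open>\<zeta>\<^sub>i\<^sup>l = dg n i (\<zeta>\<^sup>l)\<close>.\<close>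

definition dg :: "nat \<Rightarrow> nat \<Rightarrow> 'a::field \<Rightarrow> 'a mat" where
  "dg n i u = mat n n (\<lambda>(a, b). if a = b then (if a = i then u else 1) else 0)"

definition transp_mat :: "nat \<Rightarrow> nat \<Rightarrow> nat \<Rightarrow> 'a::field mat" where
  "transp_mat n i j = mat n n (\<lambda>(a, b). if a = Transposition.transpose i j b then 1 else 0)"

text \<open>\<open>\<zeta>\<^sub>i\<^sup>l s\<^sub>i\<^sub>j \<zeta>\<^sub>i\<^sup>-\<^sup>l\<close>\<close>

definition refl_mat :: "'a::field cparams \<Rightarrow> nat \<Rightarrow> nat \<Rightarrow> nat \<Rightarrow> 'a mat" where
  "refl_mat P i j l = dg (dimn P) i (zeta P ^ l) * transp_mat (dimn P) i j *
     dg (dimn P) i (inverse (zeta P) ^ l)"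

text \<open>The inverse of a monomial matrix: transpose and invert the nonzero entries
  (recall \<open>inverse 0 = 0\<close>).\<close>

definition monomial_inv :: "'a::field mat \<Rightarrow> 'a mat" where
  "monomial_inv w = mat (dim_col w) (dim_row w) (\<lambda>(a, b). inverse (w $$ (b, a)))"

lemma monomial_inv_right:
  assumes "monomial_mat n w"
  shows "w * monomial_inv w = 1\<^sub>m n"
proof -
  from assms obtain \<sigma> where w: "w \<in> carrier_mat n n" and s: "\<sigma> permutes {..<n}"
    and nz: "\<And>a b. a < n \<Longrightarrow> b < n \<Longrightarrow> w $$ (a, b) \<noteq> 0 \<longleftrightarrow> a = \<sigma> b"
    unfolding monomial_mat_def by blast
  show ?thesis
  proof (rule eq_matI)
    fix a b assume "a < dim_row (1\<^sub>m n :: 'a mat)" "b < dim_col (1\<^sub>m n :: 'a mat)"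
    then have a: "a < n" and b: "b < n" by auto
    have eq: "(w * monomial_inv w) $$ (a, b) = (\<Sum>k<n. w $$ (a, k) * inverse (w $$ (b, k)))"
      using w a b by (simp add: monomial_inv_def scalar_prod_def lessThan_atLeast0)
    define k0 where "k0 = Hilbert_Choice.inv \<sigma> a"
    have k0: "k0 < n" "\<sigma> k0 = a"
      using s a permutes_inv[OF s] permutes_in_image[of "Hilbert_Choice.inv \<sigma>" "{..<n}" a]
      by (auto simp: k0_def permutes_inverses(1))
    have z: "w $$ (a, k) = 0" if "k < n" "k \<noteq> k0" for k
      using nz[OF a that(1)] k0 that(2) permutes_inj[OF s] by (metis injD)
    have "(\<Sum>k<n. w $$ (a, k) * inverse (w $$ (b, k))) =
      (\<Sum>k\<in>{k0}. w $$ (a, k) * inverse (w $$ (b, k)))"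
      using k0 z by (intro sum.mono_neutral_right) auto
    also have "\<dots> = (if a = b then 1 else 0)"
      using nz[OF a k0(1)] nz[OF b k0(1)] k0(2) by auto
    finally show "(w * monomial_inv w) $$ (a, b) = 1\<^sub>m n $$ (a, b)"
      using eq a b by simp
  qed (use w in \<open>auto simp: monomial_inv_def\<close>)
qed

text \<open>\<open>w x\<^sub>i = x\<^sub>i \<circ> w\<^sup>-\<^sup>1 = \<Sum>\<^sub>j (w\<^sup>-\<^sup>1)\<^sub>i\<^sub>j x\<^sub>j\<close>, extended to polynomials as an algebra map.\<close>

definition mat_act :: "'a::field mat \<Rightarrow> 'a mpol \<Rightarrow> 'a mpol" where
  "mat_act w = msubst (\<lambda>i. \<Sum>j<dim_row w. mconst (monomial_inv w $$ (i, j)) * mvar j)"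


section \<open>The rational Cherednik algebra and its polynomial representation\<close>

datatype 'a cgen = GX nat | GY nat | GT "'a mat"

text \<open>
  Words in the generators form a free monoid, written additively so that the convolution product
  on finitely supported functions makes \<open>'a cgen gword \<Rightarrow>\<^sub>0 'a\<close> the free associative unital algebra.
\<close>

datatype 'g gword = Word (letters: "'g list")

instantiation gword :: (type) monoid_add
begin
definition zero_gword :: "'a gword" where "0 = Word []"
definition plus_gword :: "'a gword \<Rightarrow> 'a gword \<Rightarrow> 'a gword" where
  "u + v = Word (letters u @ letters v)"
instance by standard (simp_all add: zero_gword_def plus_gword_def)
end

type_synonym 'a freealg = "'a cgen gword \<Rightarrow>\<^sub>0 'a"

definition fgen :: "'a cgen \<Rightarrow> 'a::field freealg" where
  "fgen g = Poly_Mapping.single (Word [g]) 1"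

definition fscal :: "'a \<Rightarrow> 'a::field freealg" where
  "fscal a = Poly_Mapping.single 0 a"

abbreviation FX :: "nat \<Rightarrow> 'a::field freealg" where "FX i \<equiv> fgen (GX i)"
abbreviation FY :: "nat \<Rightarrow> 'a::field freealg" where "FY i \<equiv> fgen (GY i)"
abbreviation FT :: "'a mat \<Rightarrow> 'a::field freealg" where "FT w \<equiv> fgen (GT w)"

definition cgens :: "'a::field cparams \<Rightarrow> 'a cgen set" where
  "cgens P = GX ` {..<dimn P} \<union> GY ` {..<dimn P} \<union> GT ` Grpn P"

definition free_carrier :: "'a::field cparams \<Rightarrow> 'a freealg set" where
  "free_carrier P = {a. \<forall>u\<in>Poly_Mapping.keys a. set (letters u) \<subseteq> cgens P}"

text \<open>
  The sum over \<open>l\<close> in the last relator is restricted to \<open>p dvd l\<close>: for the other \<open>l\<close> one has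
  \<open>c\<^sub>l = 0\<close>, and \<open>\<zeta>\<^sub>i\<^sup>l\<close> does not lie in \<open>G(r,p,n)\<close>. The relator \<open>t\<^sub>1 - 1\<close> expresses that the
  \<open>t\<^sub>w\<close> span a unital image of the group algebra.
\<close>

inductive_set relators :: "'a::field cparams \<Rightarrow> 'a freealg set" for P :: "'a cparams" where
  xx: "i < dimn P \<Longrightarrow> j < dimn P \<Longrightarrow> FX i * FX j - FX j * FX i \<in> relators P"
| yy: "i < dimn P \<Longrightarrow> j < dimn P \<Longrightarrow> FY i * FY j - FY j * FY i \<in> relators P"
| t1: "FT (1\<^sub>m (dimn P)) - 1 \<in> relators P"
| tt: "w \<in> Grpn P \<Longrightarrow> v \<in> Grpn P \<Longrightarrow> FT w * FT v - FT (w * v) \<in> relators P"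
| tx: "w \<in> Grpn P \<Longrightarrow> i < dimn P \<Longrightarrow>
    FT w * FX i - (\<Sum>j<dimn P. fscal (monomial_inv w $$ (i, j)) * FX j) * FT w \<in> relators P"
| ty: "w \<in> Grpn P \<Longrightarrow> i < dimn P \<Longrightarrow>
    FT w * FY i - (\<Sum>j<dimn P. fscal (w $$ (j, i)) * FY j) * FT w \<in> relators P"
| yx: "i < dimn P \<Longrightarrow> j < dimn P \<Longrightarrow> i \<noteq> j \<Longrightarrow>
    FY i * FX j - (FX j * FY i + fscal (c0par P) *
      (\<Sum>l<ordr P. fscal (inverse (zeta P) ^ l) * FT (refl_mat P i j l))) \<in> relators P"
| yxi: "i < dimn P \<Longrightarrow>
    FY i * FX i - (FX i * FY i + fscal (kappa P)
      - (\<Sum>l\<in>{l \<in> {1..ordr P - 1}. divp P dvd l}.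
           fscal (cpar P l * (1 - inverse (zeta P) ^ l)) * FT (dg (dimn P) i (zeta P ^ l)))
      - fscal (c0par P) * (\<Sum>j\<in>{..<dimn P} - {i}. \<Sum>l<ordr P. FT (refl_mat P i j l)))
    \<in> relators P"

inductive_set cherednik_ideal :: "'a::field cparams \<Rightarrow> 'a freealg set" for P :: "'a cparams" where
  zero: "0 \<in> cherednik_ideal P"
| add: "a \<in> cherednik_ideal P \<Longrightarrow> b \<in> cherednik_ideal P \<Longrightarrow> a + b \<in> cherednik_ideal P"
| rel: "a \<in> free_carrier P \<Longrightarrow> b \<in> free_carrier P \<Longrightarrow> \<rho> \<in> relators P \<Longrightarrow>
    a * \<rho> * b \<in> cherednik_ideal P"

definition cherednik_algebra :: "'a::field cparams \<Rightarrow> 'a freealg set set" where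
  "cherednik_algebra P = free_carrier P //
     {(a, b). a \<in> free_carrier P \<and> b \<in> free_carrier P \<and> a - b \<in> cherednik_ideal P}"

definition y_act :: "'a::field cparams \<Rightarrow> nat \<Rightarrow> 'a mpol \<Rightarrow> 'a mpol" where
  "y_act P i f = mscale (kappa P) (mderiv i f)
     - mscale (c0par P) (\<Sum>j\<in>{..<dimn P} - {i}. \<Sum>l<ordr P.
         mquot (f - mat_act (refl_mat P i j l) f) (mvar i - mconst (zeta P ^ l) * mvar j))
     - (\<Sum>l = 1..ordr P - 1. mscale (cpar P l)
         (mquot (f - mat_act (dg (dimn P) i (zeta P ^ l)) f) (mvar i)))"

fun gen_act :: "'a::field cparams \<Rightarrow> 'a cgen \<Rightarrow> 'a mpol \<Rightarrow> 'a mpol" where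
  "gen_act P (GX i) f = mvar i * f"
| "gen_act P (GY i) f = y_act P i f"
| "gen_act P (GT w) f = mat_act w f"

definition free_act :: "'a::field cparams \<Rightarrow> 'a freealg \<Rightarrow> 'a mpol \<Rightarrow> 'a mpol" where
  "free_act P a f = (\<Sum>u\<in>Poly_Mapping.keys a.
     mscale (Poly_Mapping.lookup a u) (foldr (gen_act P) (letters u) f))"

text \<open>
  An element \<open>h\<close> of the algebra acts on \<open>M(1) = polys (dimn P)\<close> through any of its
  representatives \<open>a \<in> h\<close> in the free algebra.
\<close>

definition cherednik_submodule :: "'a::field cparams \<Rightarrow> 'a mpol set \<Rightarrow> bool" where
  "cherednik_submodule P N \<longleftrightarrow> mpol.subspace N \<and> N \<subseteq> polys (dimn P) \<and>
     (\<forall>h\<in>cherednik_algebra P. \<forall>a\<in>h. \<forall>f\<in>N. free_act P a f \<in> N)"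


section \<open>The commutative subalgebra and its eigenvectors\<close>

definition z_elt :: "'a::field cparams \<Rightarrow> nat \<Rightarrow> 'a freealg" where
  "z_elt P i = FY i * FX i + fscal (c0par P) * (\<Sum>j<i. \<Sum>l<ordr P. FT (refl_mat P i j l))"

text \<open>
  The subalgebra of the free algebra generated by the given lifts of the generators of
  \<open>\<tt>\<close>; its image in the Cherednik algebra is \<open>\<tt>\<close>.
\<close>

inductive_set t_alg :: "'a::field cparams \<Rightarrow> 'a freealg set" for P :: "'a cparams" where
  scal: "fscal a \<in> t_alg P"
| z: "i < dimn P \<Longrightarrow> z_elt P i \<in> t_alg P"
| zz: "Suc i < dimn P \<Longrightarrow>
    FT (dg (dimn P) i (zeta P) * dg (dimn P) (Suc i) (inverse (zeta P))) \<in> t_alg P"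
| zp: "i < dimn P \<Longrightarrow> FT (dg (dimn P) i (zeta P ^ divp P)) \<in> t_alg P"
| add: "a \<in> t_alg P \<Longrightarrow> b \<in> t_alg P \<Longrightarrow> a + b \<in> t_alg P"
| mult: "a \<in> t_alg P \<Longrightarrow> b \<in> t_alg P \<Longrightarrow> a * b \<in> t_alg P"

definition t_eigenvector :: "'a::field cparams \<Rightarrow> 'a mpol \<Rightarrow> bool" where
  "t_eigenvector P f \<longleftrightarrow> f \<in> polys (dimn P) \<and> f \<noteq> 0 \<and>
     (\<forall>a\<in>t_alg P. \<exists>e. free_act P a f = mscale e f)"


subsection \<open>The partial order on exponents\<close>

definition inc_rearr :: "nat \<Rightarrow> expo \<Rightarrow> nat list" where
  "inc_rearr n \<mu> = sort (map (Poly_Mapping.lookup \<mu>) [0..<n])"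

definition dec_rearr :: "nat \<Rightarrow> expo \<Rightarrow> nat list" where
  "dec_rearr n \<mu> = rev (inc_rearr n \<mu>)"

text \<open>\<open>y - x = \<Sum>\<^sub>i a\<^sub>i (\<epsilon>\<^sub>i - \<epsilon>\<^sub>i\<^sub>+\<^sub>1)\<close> with \<open>a\<^sub>i \<in> \<nat>\<close> for \<open>0 \<le> i < n - 1\<close>, written in coordinates\<close>

definition dom_le :: "nat \<Rightarrow> nat list \<Rightarrow> nat list \<Rightarrow> bool" where
  "dom_le n x y \<longleftrightarrow> (\<exists>a :: nat \<Rightarrow> nat. \<forall>m<n. int (y ! m) - int (x ! m) =
     (if Suc m < n then int (a m) else 0) - (if 0 < m then int (a (m - 1)) else 0))"

definition perm_length :: "nat \<Rightarrow> (nat \<Rightarrow> nat) \<Rightarrow> nat" where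
  "perm_length n v = card {(a, b). a < b \<and> b < n \<and> v b < v a}"

text \<open>Permutations act by \<open>(v.\<mu>)\<^sub>v\<^sub>(\<^sub>i\<^sub>) = \<mu>\<^sub>i\<close>.\<close>

definition v_perm :: "nat \<Rightarrow> expo \<Rightarrow> nat \<Rightarrow> nat" where
  "v_perm n \<mu> = (ARG_MAX (perm_length n) v. v permutes {..<n} \<and>
     (\<forall>i<n. inc_rearr n \<mu> ! v i = Poly_Mapping.lookup \<mu> i))"

definition bruhat_step :: "nat \<Rightarrow> (nat \<Rightarrow> nat) \<Rightarrow> (nat \<Rightarrow> nat) \<Rightarrow> bool" where
  "bruhat_step n u v \<longleftrightarrow> (\<exists>a<n. \<exists>b<n. a \<noteq> b \<and> v = u \<circ> Transposition.transpose a b) \<and>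
     perm_length n u < perm_length n v"

definition bruhat_less :: "nat \<Rightarrow> (nat \<Rightarrow> nat) \<Rightarrow> (nat \<Rightarrow> nat) \<Rightarrow> bool" where
  "bruhat_less n = (bruhat_step n)\<^sup>+\<^sup>+"

definition expo_less :: "nat \<Rightarrow> expo \<Rightarrow> expo \<Rightarrow> bool" where
  "expo_less n \<nu> \<mu> \<longleftrightarrow>
     (dom_le n (dec_rearr n \<nu>) (dec_rearr n \<mu>) \<and> dec_rearr n \<nu> \<noteq> dec_rearr n \<mu>) \<or>
     (dec_rearr n \<nu> = dec_rearr n \<mu> \<and> bruhat_less n (v_perm n \<nu>) (v_perm n \<mu>))"


subsection \<open>The eigenvectors \<open>f\<^sub>\<mu>\<close>: generic parameters and specialisation\<close>

text \<open>
  The generic parameters are the indeterminates \<open>\<kappa> = X\<^sub>0\<close>, \<open>c\<^sub>0 = X\<^sub>1\<close> and \<open>d\<^sub>j = X\<^sub>j\<^sub>+\<^sub>1\<close> for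
  \<open>1 \<le> j < r/p\<close>. The ambient field has infinitely many indeterminates; the others do not occur.
\<close>

type_synonym genfield = "complex mpol fract"

definition gconst :: "complex \<Rightarrow> genfield" where
  "gconst z = Fraction_Field.Fract (mconst z) 1"

definition gvar :: "nat \<Rightarrow> genfield" where
  "gvar i = Fraction_Field.Fract (mvar i) 1"

text \<open>
  The \<open>c\<^sub>l\<close> are recovered from \<open>d\<^sub>1, \<dots>, d\<^sub>r\<^sub>/\<^sub>p\<^sub>-\<^sub>1\<close> by \<open>d\<^sub>0 = - (d\<^sub>1 + \<dots> + d\<^sub>r\<^sub>/\<^sub>p\<^sub>-\<^sub>1)\<close> and
  Fourier inversion on the integers modulo \<open>r/p\<close>.
\<close>

definition c_from_d :: "nat \<Rightarrow> nat \<Rightarrow> 'a::field \<Rightarrow> (nat \<Rightarrow> 'a) \<Rightarrow> nat \<Rightarrow> 'a" where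
  "c_from_d r p \<zeta> d l = (if p dvd l then of_nat p / of_nat r *
     (- (\<Sum>j = 1..r div p - 1. d j) + (\<Sum>j = 1..r div p - 1. inverse \<zeta> ^ (l * j) * d j)) else 0)"

definition root_r :: "nat \<Rightarrow> complex" where
  "root_r r = exp (2 * of_real pi * \<i> / of_nat r)"

definition generic_params :: "nat \<Rightarrow> nat \<Rightarrow> nat \<Rightarrow> genfield cparams" where
  "generic_params n r p = \<lparr>dimn = n, ordr = r, divp = p, zeta = gconst (root_r r),
     kappa = gvar 0, c0par = gvar 1,
     cpar = c_from_d r p (gconst (root_r r)) (\<lambda>j. gvar (Suc j))\<rparr>"

definition complex_params ::
    "nat \<Rightarrow> nat \<Rightarrow> nat \<Rightarrow> complex \<Rightarrow> complex \<Rightarrow> (nat \<Rightarrow> complex) \<Rightarrow> complex cparams" where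
  "complex_params n r p \<kappa> c0 c = \<lparr>dimn = n, ordr = r, divp = p, zeta = root_r r,
     kappa = \<kappa>, c0par = c0, cpar = c\<rparr>"

definition f_generic :: "nat \<Rightarrow> nat \<Rightarrow> nat \<Rightarrow> expo \<Rightarrow> genfield mpol" where
  "f_generic n r p \<mu> = (THE f. t_eigenvector (generic_params n r p) f \<and>
     Poly_Mapping.lookup f \<mu> = 1 \<and> (\<forall>\<nu>\<in>Poly_Mapping.keys f. \<nu> = \<mu> \<or> expo_less n \<nu> \<mu>))"

definition param_point :: "complex cparams \<Rightarrow> nat \<Rightarrow> complex" where
  "param_point P i =
     (if i = 0 then kappa P else if i = 1 then c0par P else dpar P (int i - 1))"

text \<open>\<open>specializes v q z\<close>: the rational function \<open>q\<close> is regular at \<open>v\<close>, with value \<open>z\<close>.\<close>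

definition specializes :: "(nat \<Rightarrow> complex) \<Rightarrow> genfield \<Rightarrow> complex \<Rightarrow> bool" where
  "specializes v q z \<longleftrightarrow>
     (\<exists>a b. q = Fraction_Field.Fract a b \<and> meval v b \<noteq> 0 \<and> z = meval v a / meval v b)"

definition f_well_defined :: "complex cparams \<Rightarrow> expo \<Rightarrow> bool" where
  "f_well_defined P \<mu> \<longleftrightarrow> (\<forall>\<nu>. \<exists>z. specializes (param_point P)
     (Poly_Mapping.lookup (f_generic (dimn P) (ordr P) (divp P) \<mu>) \<nu>) z)"

definition f_at :: "complex cparams \<Rightarrow> expo \<Rightarrow> complex mpol" where
  "f_at P \<mu> = (THE g. \<forall>\<nu>. specializes (param_point P)
     (Poly_Mapping.lookup (f_generic (dimn P) (ordr P) (divp P) \<mu>) \<nu>)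
     (Poly_Mapping.lookup g \<nu>))"

end

theory Submission
  imports Defs
begin

text \<open>
  On the polynomial representation the elements \<open>z\<^sub>i\<close> are triangular with respect to the order on
  exponents, with eigenvalues \<open>wt \<mu> i\<close>. The operator \<open>\<Phi> f = x\<^sub>n \<cdot> w f\<close>, for a cyclic shift \<open>w\<close> of the
  variables, permutes the \<open>z\<^sub>i\<close> cyclically up to a scalar, and the adjacent transpositions \<open>s\<close> intertwine
  them up to a constant; hence \<open>\<Phi> f\<^sub>\<mu>\<close> is the eigenvector of the exponent \<open>\<Phi> \<mu>\<close>, and \<open>s f\<^sub>\<mu> + t f\<^sub>\<mu>\<close>
  that of \<open>s \<mu>\<close>, where \<open>t\<close> has the denominator \<open>wt \<mu> i - wt \<mu> (i + 1)\<close>. Starting from 1 this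
  recursion produces every \<open>f\<^sub>\<mu>\<close>.

  Regularity of the \<open>f\<^sub>\<mu>\<close> with a part of size at least \<open>k\<close> excludes all values \<open>c\<^sub>0 = a / m\<close> with
  \<open>a > 0\<close> and \<open>1 \<le> m < n\<close>, since there two of them would require a vanishing denominator. Together with
  (iii) it follows that the recursion specialises, that its swaps are invertible and that the joint
  spectrum is simple, so that a submodule is spanned by the \<open>f\<^sub>\<mu>\<close> that it contains.

  Finally \<open>y\<^sub>n f\<^bsub>\<Phi>\<nu>\<^esub>\<close> is the multiple \<open>wt \<nu> 1\<close> of \<open>w f\<^sub>\<nu>\<close>. By (i) and (ii) this scalar vanishes exactly
  when \<open>\<nu>\<^sub>1 = k - 1\<close> and all parts of \<open>\<nu>\<close> are less than \<open>k\<close>, that is, when the step from \<open>\<nu>\<close> to \<open>\<Phi> \<nu>\<close>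
  creates the first part of size \<open>k\<close>; every other step can be undone inside a submodule.
\<close>

section \<open>The order on exponents\<close>

text \<open>Since the eigenvectors are defined generically and then evaluated, the same recursion is
  run over the field of rational functions and over the complex numbers. What survives evaluation
  (leading coefficient, support, symmetry at equal parts) is inherited from the generic side, where
  a single weight already determines its part; simplicity of the spectrum is not inherited and is
  proved at the given point.

  The scalars in the intertwining relations depend on the exponents modulo r only, so each
  eigenvector carries the fact that all its exponents agree modulo r with its label. This also makes
  it an eigenvector of the diagonal group elements.

  For parts congruent modulo r the terms d_j cancel, and two weights differ up to sign by r(c_0 m -
  a), where m is a difference of ranks and r a a difference of parts. Hence the dangerous values are
  c_0 = a/m with a > 0. Poles involve m < n only; invertibility of a swap involves m - 1 and m + 1,
  and comparing two exponents involves a sum of two displacements of ranks, so the denominator n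
  occurs as well.\<close>

abbreviation elt :: "expo \<Rightarrow> nat \<Rightarrow> nat" where "elt \<equiv> Poly_Mapping.lookup"

abbreviation pinv :: "('a \<Rightarrow> 'b) \<Rightarrow> 'b \<Rightarrow> 'a" where "pinv \<equiv> Hilbert_Choice.inv"

section \<open>Ranks of the parts and the longest sorting permutation\<close>

definition expo_before :: "expo \<Rightarrow> nat \<Rightarrow> nat \<Rightarrow> bool" where
  "expo_before \<mu> j i \<longleftrightarrow> elt \<mu> j < elt \<mu> i \<or> (elt \<mu> j = elt \<mu> i \<and> i < j)"

text \<open>Ties are broken from right to left: of two equal parts the one further right has the
  smaller rank. This choice makes the sorting permutation longest, and it is also the count that
  appears in the diagonal entries of the z operators.\<close>

definition rk :: "nat \<Rightarrow> expo \<Rightarrow> nat \<Rightarrow> nat" where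
  "rk n \<mu> i = card {j. j < n \<and> expo_before \<mu> j i}"

definition rkf :: "nat \<Rightarrow> expo \<Rightarrow> nat \<Rightarrow> nat" where
  "rkf n \<mu> i = (if i < n then rk n \<mu> i else i)"

lemma expo_before_linear: "i \<noteq> j \<Longrightarrow> expo_before \<mu> i j \<or> expo_before \<mu> j i"
  and expo_before_irrefl: "\<not> expo_before \<mu> i i"
  and expo_before_trans: "expo_before \<mu> i j \<Longrightarrow> expo_before \<mu> j k \<Longrightarrow> expo_before \<mu> i k"
  by (auto simp: expo_before_def)

lemma rk_strict_mono:
  assumes "i < n" "expo_before \<mu> i j"
  shows "rk n \<mu> i < rk n \<mu> j"
  unfolding rk_def
proof (rule psubset_card_mono)
  show "{k. k < n \<and> expo_before \<mu> k i} \<subset> {k. k < n \<and> expo_before \<mu> k j}"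
    using assms expo_before_trans expo_before_irrefl by blast
qed auto

lemma rk_less_iff:
  assumes "i < n" "j < n"
  shows "rk n \<mu> i < rk n \<mu> j \<longleftrightarrow> expo_before \<mu> i j"
  using rk_strict_mono[of i n \<mu> j] rk_strict_mono[of j n \<mu> i] expo_before_linear[of i j \<mu>] assms
  by (metis less_asym less_irrefl)

lemma rk_less_n:
  assumes "i < n"
  shows "rk n \<mu> i < n"
proof -
  have "rk n \<mu> i < card {..<n}"
    unfolding rk_def
    using assms expo_before_irrefl by (intro psubset_card_mono) auto
  then show ?thesis by simp
qed

lemma rkf_permutes: "rkf n \<mu> permutes {..<n}"
proof (rule bij_imp_permutes)
  have inj: "inj_on (rkf n \<mu>) {..<n}"
  proof (rule inj_onI)
    fix i j assume "i \<in> {..<n}" "j \<in> {..<n}" "rkf n \<mu> i = rkf n \<mu> j"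
    then show "i = j"
      using rk_less_iff[of i n j \<mu>] rk_less_iff[of j n i \<mu>] expo_before_linear[of i j \<mu>]
      by (auto simp: rkf_def)
  qed
  have sub: "rkf n \<mu> ` {..<n} \<subseteq> {..<n}"
    by (auto simp: rkf_def rk_less_n)
  show "bij_betw (rkf n \<mu>) {..<n} {..<n}"
    using inj sub by (simp add: bij_betw_def endo_inj_surj)
qed (simp add: rkf_def)

lemma inc_rearr_eq: "inc_rearr n \<mu> = map (\<lambda>q. elt \<mu> (pinv (rkf n \<mu>) q)) [0..<n]"
proof -
  let ?w = "pinv (rkf n \<mu>)"
  have w: "?w permutes {..<n}" by (rule permutes_inv[OF rkf_permutes])
  have "mset (map (\<lambda>q. elt \<mu> (?w q)) [0..<n]) = image_mset (elt \<mu>) (image_mset ?w (mset [0..<n]))"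
    by (simp add: image_mset.compositionality comp_def)
  also have "image_mset ?w (mset [0..<n]) = mset [0..<n]"
  proof -
    have "image_mset ?w (mset_set {..<n}) = mset_set (?w ` {..<n})"
      by (rule image_mset_mset_set) (rule permutes_inj_on[OF w])
    then show ?thesis
      using permutes_image[OF w] by (simp add: atLeast0LessThan mset_upt)
  qed
  finally have ms: "mset (map (\<lambda>q. elt \<mu> (?w q)) [0..<n]) = mset (map (elt \<mu>) [0..<n])"
    by simp
  have "sorted (map (\<lambda>q. elt \<mu> (?w q)) [0..<n])"
  proof (subst sorted_iff_nth_mono_less, intro allI impI)
    fix i j assume "i < j" "j < length (map (\<lambda>q. elt \<mu> (?w q)) [0..<n])"
    then have ij: "i < j" "j < n" by auto
    have "rkf n \<mu> (?w i) < rkf n \<mu> (?w j)"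
      using ij by (simp add: permutes_inverses[OF rkf_permutes])
    moreover have "?w i < n" "?w j < n"
      using ij permutes_in_image[OF w] by auto
    ultimately have "expo_before \<mu> (?w i) (?w j)"
      by (simp add: rkf_def rk_less_iff)
    then show "map (\<lambda>q. elt \<mu> (?w q)) [0..<n] ! i \<le> map (\<lambda>q. elt \<mu> (?w q)) [0..<n] ! j"
      using ij by (auto simp: expo_before_def)
  qed
  then show ?thesis
    unfolding inc_rearr_def using ms by (intro properties_for_sort)
qed

lemma inc_rearr_rkf: "i < n \<Longrightarrow> inc_rearr n \<mu> ! rkf n \<mu> i = elt \<mu> i"
  using permutes_in_image[OF rkf_permutes, of n \<mu> i]
  by (simp add: inc_rearr_eq permutes_inverses[OF rkf_permutes])

section \<open>Inversion sets and length\<close>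

definition invs :: "nat \<Rightarrow> (nat \<Rightarrow> nat) \<Rightarrow> (nat \<times> nat) set" where
  "invs n v = {(a, b). a < b \<and> b < n \<and> v b < v a}"

lemma finite_invs [simp]: "finite (invs n v)"
  by (rule finite_subset[of _ "{..<n} \<times> {..<n}"]) (auto simp: invs_def)

lemma card_invs: "card (invs n v) = perm_length n v"
  by (simp add: invs_def perm_length_def)

lemma permutes_eq_card_less:
  assumes "v permutes {..<n}" "i < n"
  shows "v i = card {j. j < n \<and> v j < v i}"
proof -
  have vi: "v i < n" using permutes_in_image[OF assms(1)] assms(2) by auto
  have "v ` {j. j < n \<and> v j < v i} = {..<v i}"
  proof (intro Set.set_eqI iffI)
    fix x assume "x \<in> {..<v i}"
    then have "x \<in> v ` {..<n}" using vi permutes_image[OF assms(1)] by auto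
    then show "x \<in> v ` {j. j < n \<and> v j < v i}" using \<open>x \<in> {..<v i}\<close> by auto
  qed auto
  moreover have "inj_on v {j. j < n \<and> v j < v i}"
    by (rule permutes_inj_on[OF assms(1)])
  ultimately show ?thesis by (metis card_image card_lessThan)
qed

text \<open>A permutation is recovered from its inversions: v i is the number of j with v j < v i,
  and each of these comparisons is decided by whether the pair is inverted.\<close>

lemma permutes_eq_if_invs_eq:
  assumes u: "u permutes {..<n}" and v: "v permutes {..<n}" and eq: "invs n u = invs n v"
  shows "u = v"
proof
  fix i
  show "u i = v i"
  proof (cases "i < n")
    case True
    have "u j < u i \<longleftrightarrow> v j < v i" if "j < n" for j
    proof -
      have "(i, j) \<in> invs n u \<longleftrightarrow> (i, j) \<in> invs n v" "(j, i) \<in> invs n u \<longleftrightarrow> (j, i) \<in> invs n v"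
        using eq by auto
      then show ?thesis
        using that True inj_eq[OF permutes_inj[OF u], of i j] inj_eq[OF permutes_inj[OF v], of i j]
        unfolding invs_def mem_Collect_eq prod.case by linarith
    qed
    then have "{j. j < n \<and> u j < u i} = {j. j < n \<and> v j < v i}" by auto
    then show ?thesis
      using permutes_eq_card_less[OF u True] permutes_eq_card_less[OF v True] by simp
  next
    case False
    then show ?thesis using u v by (simp add: permutes_def)
  qed
qed

text \<open>Every permutation sorting \<mu> has its inversions among those of
  \<open>rkf n \<mu>\<close>: an inverted pair a < b must satisfy \<mu>_b \<le> \<mu>_a, and then b
  precedes a in the tie-breaking order. Maximal length forces equality, which replaces the
  \<open>ARG_MAX\<close> by an explicit count.\<close>

lemma v_perm_eq: "v_perm n \<mu> = rkf n \<mu>"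
proof -
  define Q where "Q v \<longleftrightarrow> v permutes {..<n} \<and> (\<forall>i<n. inc_rearr n \<mu> ! v i = elt \<mu> i)" for v
  have Qr: "Q (rkf n \<mu>)" by (simp add: Q_def rkf_permutes inc_rearr_rkf)
  have sub: "invs n v \<subseteq> invs n (rkf n \<mu>)" if "Q v" for v
  proof
    fix x assume "x \<in> invs n v"
    then obtain a b where x: "x = (a, b)" "a < b" "b < n" "v b < v a" by (auto simp: invs_def)
    have "v a < n" using that x permutes_in_image[of v "{..<n}" a] by (auto simp: Q_def)
    then have "inc_rearr n \<mu> ! v b \<le> inc_rearr n \<mu> ! v a"
      using x by (intro sorted_nth_mono) (auto simp: inc_rearr_def)
    then have "elt \<mu> b \<le> elt \<mu> a" using that x by (simp add: Q_def)
    then have "expo_before \<mu> b a" using x by (auto simp: expo_before_def)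
    then show "x \<in> invs n (rkf n \<mu>)" using x by (auto simp: invs_def rkf_def rk_less_iff)
  qed
  have le: "perm_length n v \<le> perm_length n (rkf n \<mu>)" if "Q v" for v
    unfolding card_invs[symmetric] using sub[OF that] by (intro card_mono) auto
  have *: "Q (v_perm n \<mu>) \<and> (\<forall>v. Q v \<longrightarrow> perm_length n v \<le> perm_length n (v_perm n \<mu>))"
    unfolding v_perm_def Q_def[symmetric]
    by (rule arg_max_nat_lemma[of Q "rkf n \<mu>" _ "Suc (perm_length n (rkf n \<mu>))"])
      (use Qr le in \<open>auto simp: less_Suc_eq_le\<close>)
  have "invs n (v_perm n \<mu>) = invs n (rkf n \<mu>)"
    by (rule card_subset_eq) (use * sub le Qr in \<open>auto simp: card_invs intro: antisym\<close>)
  then show ?thesis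
    using * by (intro permutes_eq_if_invs_eq) (auto simp: Q_def rkf_permutes)
qed

lemma perm_length_transpose_less:
  assumes v: "v permutes {..<n}" and ij: "i < j" "j < n" "v j < v i"
  shows "perm_length n (v \<circ> Transposition.transpose i j) < perm_length n v"
proof -
  let ?t = "Transposition.transpose i j"
  \<comment> \<open>This map moves a pair along with the transposition as long as it stays
    increasing and keeps it otherwise. It injects the inversions of the product into those of v and
    never hits the inversion (i, j).\<close>
  let ?\<phi> = "\<lambda>(a, b). if ?t a < ?t b then (?t a, ?t b) else (a, b)"
  have "?\<phi> ` invs n (v \<circ> ?t) \<subseteq> invs n v - {(i, j)}"
  proof
    fix x assume "x \<in> ?\<phi> ` invs n (v \<circ> ?t)"
    then obtain a b where x: "x = ?\<phi> (a, b)" and ab: "a < b" "b < n" "v (?t b) < v (?t a)"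
      by (auto simp: invs_def)
    consider "a \<notin> {i, j}" "b \<notin> {i, j}" | "a = i" "b = j" | "a = i" "b \<noteq> j" | "a = j" | "b = i"
      | "a \<noteq> i" "b = j"
      using ab by blast
    then show "x \<in> invs n v - {(i, j)}"
      using x ab ij by cases (auto simp: invs_def transpose_apply_other split: if_splits)
  qed
  note sub = this
  have inj: "inj_on ?\<phi> (invs n (v \<circ> ?t))"
  proof (rule inj_onI)
    fix x y assume "x \<in> invs n (v \<circ> ?t)" "y \<in> invs n (v \<circ> ?t)" and eq: "?\<phi> x = ?\<phi> y"
    then obtain a b c d where xy: "x = (a, b)" "y = (c, d)" "a < b" "c < d"
      by (auto simp: invs_def)
    have "a = c \<and> b = d"
    proof (cases "?t a < ?t b"; cases "?t c < ?t d")
      assume *: "?t a < ?t b" "?t c < ?t d"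
      then have "?t a = ?t c" "?t b = ?t d" using eq xy by auto
      then show ?thesis by (simp add: inj_eq[OF inj_transpose])
    next
      assume *: "?t a < ?t b" "\<not> ?t c < ?t d"
      then have "?t a = c" "?t b = d" using eq xy by auto
      then have "?t c = a" "?t d = b" by auto
      then show ?thesis using * xy by simp
    next
      assume *: "\<not> ?t a < ?t b" "?t c < ?t d"
      then have "?t c = a" "?t d = b" using eq xy by auto
      then have "?t a = c" "?t b = d" by auto
      then show ?thesis using * xy by simp
    next
      assume *: "\<not> ?t a < ?t b" "\<not> ?t c < ?t d"
      then show ?thesis using eq xy by auto
    qed
    then show "x = y" using xy by simp
  qed
  have "card (invs n (v \<circ> ?t)) \<le> card (invs n v - {(i, j)})"
    by (rule card_inj_on_le[OF inj sub]) simp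
  also have "\<dots> < card (invs n v)"
    using ij by (intro psubset_card_mono[OF finite_invs]) (auto simp: invs_def)
  finally show ?thesis by (simp add: card_invs)
qed

text \<open>The inverse appears because \<open>map_key\<close> pulls exponents back; in this form
  the part at position k moves to position \<sigma> k.\<close>

definition pexp :: "(nat \<Rightarrow> nat) \<Rightarrow> expo \<Rightarrow> expo" where
  "pexp \<sigma> m = Poly_Mapping.map_key (pinv \<sigma>) m"

lemma lookup_pexp:
  assumes "\<sigma> permutes S"
  shows "elt (pexp \<sigma> m) k = elt m (pinv \<sigma> k)"
  using permutes_inj[OF permutes_inv[OF assms]]
  by (simp add: pexp_def Poly_Mapping.map_key.rep_eq)

lemma lookup_pexp_image:
  assumes "\<sigma> permutes S"
  shows "elt (pexp \<sigma> m) (\<sigma> k) = elt m k"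
  by (simp add: lookup_pexp[OF assms] permutes_inverses[OF assms])

abbreviation tra :: "nat \<Rightarrow> nat \<Rightarrow> nat \<Rightarrow> nat" where "tra \<equiv> Transposition.transpose"

lemma lookup_pexp_transpose: "elt (pexp (tra i j) m) k = elt m (tra i j k)"
  using lookup_pexp[OF permutes_swap_id[of i UNIV j]] by simp

text \<open>Exchanging two distinct parts can disturb ties only with equal parts strictly between
  the two positions. If there are none, the exchange carries the whole order
  \<open>expo_before\<close>, and hence all ranks, along with it.\<close>

lemma expo_before_pexp_transpose:
  assumes ij: "i < j" and "elt \<mu> i \<noteq> elt \<mu> j"
    and "\<And>l. i < l \<Longrightarrow> l < j \<Longrightarrow> elt \<mu> l \<noteq> elt \<mu> i \<and> elt \<mu> l \<noteq> elt \<mu> j"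
  shows "expo_before (pexp (tra i j) \<mu>) (tra i j a) (tra i j b) \<longleftrightarrow> expo_before \<mu> a b"
proof -
  have "tra i j b < tra i j a \<longleftrightarrow> b < a" if eq: "elt \<mu> a = elt \<mu> b"
  proof -
    consider "a \<notin> {i, j}" "b \<notin> {i, j}" | "a = b" | "a \<in> {i, j}" "b \<notin> {i, j}"
      | "a \<notin> {i, j}" "b \<in> {i, j}"
      using assms(1,2) eq by (metis insert_iff singletonD)
    then show ?thesis
    proof cases
      case 3
      then have "elt \<mu> b = elt \<mu> i \<or> elt \<mu> b = elt \<mu> j" using eq by auto
      then have "\<not> (i < b \<and> b < j)" using assms(3) by blast
      then have "b < i \<or> j < b" using 3 by auto
      then show ?thesis using 3 ij by (auto simp: Transposition.transpose_def)
    next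
      case 4
      then have "elt \<mu> a = elt \<mu> i \<or> elt \<mu> a = elt \<mu> j" using eq by auto
      then have "\<not> (i < a \<and> a < j)" using assms(3) by blast
      then have "a < i \<or> j < a" using 4 by auto
      then show ?thesis using 4 ij by (auto simp: Transposition.transpose_def)
    qed (auto simp: Transposition.transpose_def)
  qed
  then show ?thesis
    by (auto simp: expo_before_def lookup_pexp_transpose)
qed

lemma rk_eq_if_before_iff:
  assumes \<sigma>: "\<sigma> permutes {..<n}"
    and "\<And>a. a < n \<Longrightarrow> expo_before \<nu> (\<sigma> a) (\<sigma> b) \<longleftrightarrow> expo_before \<mu> a b"
  shows "rk n \<nu> (\<sigma> b) = rk n \<mu> b"
proof -
  have "{j. j < n \<and> expo_before \<nu> j (\<sigma> b)} = \<sigma> ` {j. j < n \<and> expo_before \<mu> j b}" (is "?A = ?B")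
  proof (intro Set.set_eqI iffI)
    fix x assume x: "x \<in> ?A"
    then have "pinv \<sigma> x < n" using permutes_in_image[OF permutes_inv[OF \<sigma>], of x] by auto
    then show "x \<in> ?B"
      using x assms(2)[of "pinv \<sigma> x"] by (auto simp: permutes_inverses[OF \<sigma>] image_iff intro!: exI[of _ "pinv \<sigma> x"])
  next
    fix x assume "x \<in> ?B"
    then show "x \<in> ?A" using assms permutes_in_image[OF \<sigma>] by auto
  qed
  then show ?thesis
    by (simp add: rk_def card_image permutes_inj_on[OF \<sigma>])
qed

lemma rk_pexp_transpose:
  assumes ij: "i < j" "j < n" and "elt \<mu> i \<noteq> elt \<mu> j"
    and "\<And>l. i < l \<Longrightarrow> l < j \<Longrightarrow> elt \<mu> l \<noteq> elt \<mu> i \<and> elt \<mu> l \<noteq> elt \<mu> j"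
  shows "rk n (pexp (tra i j) \<mu>) (tra i j b) = rk n \<mu> b"
  using assms by (intro rk_eq_if_before_iff permutes_swap_id expo_before_pexp_transpose) auto

section \<open>Dominance of decreasing rearrangements\<close>

lemma sum_list_dec_rearr: "(\<Sum>l<n. f (dec_rearr n \<mu> ! l)) = (\<Sum>i<n. f (elt \<mu> i))"
proof -
  have "(\<Sum>l<n. f (dec_rearr n \<mu> ! l)) = sum_list (map f (dec_rearr n \<mu>))"
    by (simp add: sum_list_sum_nth dec_rearr_def inc_rearr_def atLeast0LessThan)
  also have "\<dots> = sum_mset (image_mset f (mset (map (elt \<mu>) [0..<n])))"
    by (simp add: dec_rearr_def inc_rearr_def flip: sum_mset_sum_list)
  also have "\<dots> = sum_list (map (\<lambda>i. f (elt \<mu> i)) [0..<n])"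
    by (simp add: comp_def image_mset.compositionality flip: sum_mset_sum_list)
  also have "\<dots> = (\<Sum>i<n. f (elt \<mu> i))"
    by (simp add: interv_sum_list_conv_sum_set_nat atLeast0LessThan)
  finally show ?thesis .
qed

lemma length_dec_rearr [simp]: "length (dec_rearr n \<mu>) = n"
  by (simp add: dec_rearr_def inc_rearr_def)

lemma dec_rearr_antimono: "i \<le> j \<Longrightarrow> j < n \<Longrightarrow> dec_rearr n \<mu> ! j \<le> dec_rearr n \<mu> ! i"
  unfolding dec_rearr_def
  by (subst (1 2) rev_nth) (auto simp: inc_rearr_def intro!: sorted_nth_mono)

text \<open>The coefficients of the simple roots are the differences of partial sums; equal totals
  make the one after the last root vanish.\<close>

lemma dom_leI:
  assumes tot: "(\<Sum>l<n. x ! l) = (\<Sum>l<n. y ! l)"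
    and le: "\<And>k. k \<le> n \<Longrightarrow> (\<Sum>l<k. x ! l) \<le> (\<Sum>l<k. y ! l)"
  shows "dom_le n x y"
  unfolding dom_le_def
proof (intro exI[of _ "\<lambda>m. (\<Sum>l<Suc m. y ! l) - (\<Sum>l<Suc m. x ! l)"] allI impI)
  fix m assume m: "m < n"
  have 1: "(if Suc m < n then int ((\<Sum>l<Suc m. y ! l) - (\<Sum>l<Suc m. x ! l)) else 0) =
    int (\<Sum>l<Suc m. y ! l) - int (\<Sum>l<Suc m. x ! l)"
  proof (cases "Suc m < n")
    case True
    then show ?thesis using le[of "Suc m"] by (simp add: of_nat_diff)
  next
    case False
    then have "Suc m = n" using m by simp
    then show ?thesis using tot by simp
  qed
  have 2: "(if 0 < m then int ((\<Sum>l<Suc (m - 1). y ! l) - (\<Sum>l<Suc (m - 1). x ! l)) else 0) =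
    int (\<Sum>l<m. y ! l) - int (\<Sum>l<m. x ! l)"
    using le[of m] m by (cases m) (simp_all add: of_nat_diff)
  show "int (y ! m) - int (x ! m) =
    (if Suc m < n then int ((\<Sum>l<Suc m. y ! l) - (\<Sum>l<Suc m. x ! l)) else 0) -
    (if 0 < m then int ((\<Sum>l<Suc (m - 1). y ! l) - (\<Sum>l<Suc (m - 1). x ! l)) else 0)"
    unfolding 1 2 by simp
qed

text \<open>The truncated sums \<open>\<Sum>\<^sub>i (\<mu>\<^sub>i - t)\<^sup>+\<close> detect dominance and do not depend on the order of the parts.\<close>

lemma dom_le_dec_rearrI:
  assumes tot: "(\<Sum>i<n. elt \<nu> i) = (\<Sum>i<n. elt \<mu> i)"
    and le: "\<And>t. (\<Sum>i<n. elt \<nu> i - t) \<le> (\<Sum>i<n. elt \<mu> i - t)"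
  shows "dom_le n (dec_rearr n \<nu>) (dec_rearr n \<mu>)"
proof (rule dom_leI)
  show "(\<Sum>l<n. dec_rearr n \<nu> ! l) = (\<Sum>l<n. dec_rearr n \<mu> ! l)"
    using tot sum_list_dec_rearr[of "\<lambda>x. x"] by simp
next
  fix k assume k: "k \<le> n"
  let ?x = "dec_rearr n \<nu>" and ?y = "dec_rearr n \<mu>"
  show "(\<Sum>l<k. ?x ! l) \<le> (\<Sum>l<k. ?y ! l)"
  proof (cases "k = n")
    case True
    then show ?thesis using tot sum_list_dec_rearr[of "\<lambda>x. x"] by simp
  next
    case False
    \<comment> \<open>With the threshold at part k of the larger sequence, its parts before k are at
      least t and the others at most t, so truncation loses nothing on that side.\<close>
    define t where "t = ?y ! k"
    have kn: "k < n" using k False by simp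
    have "(\<Sum>l<k. ?x ! l) \<le> (\<Sum>l<k. t + (?x ! l - t))" by (rule sum_mono) simp
    also have "\<dots> = k * t + (\<Sum>l<k. ?x ! l - t)" by (simp add: sum.distrib)
    also have "\<dots> \<le> k * t + (\<Sum>l<n. ?x ! l - t)"
      using kn by (intro add_left_mono sum_mono2) auto
    also have "\<dots> \<le> k * t + (\<Sum>l<n. ?y ! l - t)"
      using le[of t] sum_list_dec_rearr[of "\<lambda>x. x - t"] by simp
    also have "(\<Sum>l<n. ?y ! l - t) = (\<Sum>l<k. ?y ! l - t)"
      using kn dec_rearr_antimono[of k _ n \<mu>]
      by (intro sum.mono_neutral_right) (auto simp: t_def not_less)
    also have "k * t + (\<Sum>l<k. ?y ! l - t) = (\<Sum>l<k. t + (?y ! l - t))"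
      by (simp add: sum.distrib)
    also have "\<dots> = (\<Sum>l<k. ?y ! l)"
      using kn dec_rearr_antimono[of _ k n \<mu>] by (intro sum.cong) (auto simp: t_def)
    finally show ?thesis .
  qed
qed

text \<open>Redistributes the parts at i and j with their sum preserved. The monomials occurring in
  the z operators are all of this form.\<close>

definition xfer :: "nat \<Rightarrow> nat \<Rightarrow> nat \<Rightarrow> expo \<Rightarrow> expo" where
  "xfer i j A m = Poly_Mapping.update i A (Poly_Mapping.update j (elt m i + elt m j - A) m)"

lemma lookup_xfer:
  "elt (xfer i j A m) k = (if k = i then A else if k = j then elt m i + elt m j - A else elt m k)"
  by (simp add: xfer_def lookup_update)

lemma sum_two:
  fixes f :: "nat \<Rightarrow> nat"
  assumes "i \<noteq> j" "i < n" "j < n"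
  shows "(\<Sum>k<n. f k) = f i + f j + (\<Sum>k\<in>{..<n} - {i, j}. f k)"
proof -
  have "{..<n} = insert i (insert j ({..<n} - {i, j}))" using assms by auto
  then have "(\<Sum>k<n. f k) = sum f (insert i (insert j ({..<n} - {i, j})))" by simp
  then show ?thesis using assms by (simp add: add.assoc)
qed

lemma expo_less_xfer:
  assumes ij: "i \<noteq> j" "i < n" "j < n"
    and A: "min (elt m i) (elt m j) < A" "A < max (elt m i) (elt m j)"
  shows "expo_less n (xfer i j A m) m"
proof -
  define a b where "a = elt m i" and "b = elt m j"
  note AB = A[folded a_def b_def]
  have rest: "(\<Sum>k\<in>{..<n} - {i, j}. f (elt (xfer i j A m) k)) = (\<Sum>k\<in>{..<n} - {i, j}. f (elt m k))"
    for f :: "nat \<Rightarrow> nat"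
    by (intro sum.cong) (auto simp: lookup_xfer)
  have s: "(\<Sum>k<n. f (elt (xfer i j A m) k)) =
      f A + f (a + b - A) + (\<Sum>k\<in>{..<n} - {i, j}. f (elt m k))"
    "(\<Sum>k<n. f (elt m k)) = f a + f b + (\<Sum>k\<in>{..<n} - {i, j}. f (elt m k))" for f :: "nat \<Rightarrow> nat"
    using ij by (subst sum_two[OF ij]; simp add: rest lookup_xfer a_def b_def)+
  have "dom_le n (dec_rearr n (xfer i j A m)) (dec_rearr n m)"
  proof (rule dom_le_dec_rearrI)
    show "(\<Sum>k<n. elt (xfer i j A m) k) = (\<Sum>k<n. elt m k)"
      using s[of "\<lambda>x. x"] AB by simp
    fix t show "(\<Sum>k<n. elt (xfer i j A m) k - t) \<le> (\<Sum>k<n. elt m k - t)"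
    proof -
      have "A - t + (a + b - A - t) \<le> a - t + (b - t)"
        using AB by (cases "a \<le> b"; cases "t \<le> A"; cases "t \<le> a + b - A") (auto simp: min_def max_def)
      then show ?thesis using s[of "\<lambda>x. x - t"] by simp
    qed
  qed
  moreover have "dec_rearr n (xfer i j A m) \<noteq> dec_rearr n m"
  proof
    assume eq: "dec_rearr n (xfer i j A m) = dec_rearr n m"
    \<comment> \<open>The sum of squares depends only on the multiset of parts. With A + B = a + b
      it agrees on both sides only if A is a or b, which the strict inequalities exclude.\<close>
    let ?f = "\<lambda>x::nat. x * x"
    have "(\<Sum>k<n. ?f (elt (xfer i j A m) k)) = (\<Sum>k<n. ?f (elt m k))"
      using sum_list_dec_rearr[of ?f n "xfer i j A m"] sum_list_dec_rearr[of ?f n m] eq by simp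
    then have e: "?f A + ?f (a + b - A) = ?f a + ?f b" using s[of ?f] by simp
    define B where "B = a + b - A"
    have B: "a + b = A + B" using AB by (auto simp: B_def)
    have "int A * int A + int B * int B = int a * int a + int b * int b"
      using e unfolding B_def[symmetric] by (metis of_nat_add of_nat_mult)
    moreover have "int B = int a + int b - int A" using B by simp
    ultimately have "(int A - int a) * (int A - int b) = 0" by (simp add: algebra_simps)
    then show False using AB by auto
  qed
  ultimately show ?thesis by (simp add: expo_less_def)
qed

lemma dec_rearr_pexp:
  assumes "\<sigma> permutes {..<n}"
  shows "dec_rearr n (pexp \<sigma> m) = dec_rearr n m"
proof -
  have w: "pinv \<sigma> permutes {..<n}" by (rule permutes_inv[OF assms])
  have "image_mset (pinv \<sigma>) (mset_set {..<n}) = mset_set {..<n}"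
    using image_mset_mset_set[OF permutes_inj_on[OF w, of "{..<n}"]] permutes_image[OF w] by simp
  then have "image_mset (elt m) (image_mset (pinv \<sigma>) (mset [0..<n])) = image_mset (elt m) (mset [0..<n])"
    by (simp add: mset_upt atLeast0LessThan)
  then have "mset (map (elt (pexp \<sigma> m)) [0..<n]) = mset (map (elt m) [0..<n])"
    by (simp add: lookup_pexp[OF assms] image_mset.compositionality comp_def cong: image_mset_cong)
  then have "sort (map (elt (pexp \<sigma> m)) [0..<n]) = sort (map (elt m) [0..<n])"
    by (intro properties_for_sort) auto
  then show ?thesis by (simp add: dec_rearr_def inc_rearr_def)
qed

text \<open>If a part between positions \<open>i\<close> and \<open>j\<close> agrees with one of the two exchanged parts, the
  exchange factors through shorter ones; otherwise it multiplies the rank function by one transposition.\<close>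

lemma bruhat_less_swap:
  assumes "i < j" "j < n" "elt m j < elt m i"
  shows "bruhat_less n (rkf n (pexp (tra i j) m)) (rkf n m)"
  using assms
proof (induction "j - i" arbitrary: i j m rule: less_induct)
  case less
  have conj: "pexp (tra a b) (pexp (tra c d) m) = pexp (tra i j) m"
    if "\<And>k. elt m (tra c d (tra a b k)) = elt m (tra i j k)" for a b c d
    by (rule poly_mapping_eqI) (simp add: lookup_pexp_transpose that)
  consider l where "i < l" "l < j" "elt m l = elt m j" | l where "i < l" "l < j" "elt m l = elt m i"
    | "\<And>l. i < l \<Longrightarrow> l < j \<Longrightarrow> elt m l \<noteq> elt m i \<and> elt m l \<noteq> elt m j" by blast
  then show ?case
  proof cases
    case 1
    let ?m = "pexp (tra i l) m"
    have eq: "pexp (tra l j) ?m = pexp (tra i j) m"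
      using 1 less.prems by (intro conj) (auto simp: Transposition.transpose_def)
    have "bruhat_less n (rkf n (pexp (tra l j) ?m)) (rkf n ?m)"
      using 1 less.prems by (intro less.hyps) (auto simp: lookup_pexp_transpose Transposition.transpose_def)
    moreover have "bruhat_less n (rkf n ?m) (rkf n m)"
      using 1 less.prems by (intro less.hyps) auto
    ultimately show ?thesis unfolding eq bruhat_less_def by (rule tranclp_trans)
  next
    case 2
    let ?m = "pexp (tra l j) m"
    have eq: "pexp (tra i l) ?m = pexp (tra i j) m"
      using 2 less.prems by (intro conj) (auto simp: Transposition.transpose_def)
    have "bruhat_less n (rkf n (pexp (tra i l) ?m)) (rkf n ?m)"
      using 2 less.prems by (intro less.hyps) (auto simp: lookup_pexp_transpose Transposition.transpose_def)
    moreover have "bruhat_less n (rkf n ?m) (rkf n m)"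
      using 2 less.prems by (intro less.hyps) auto
    ultimately show ?thesis unfolding eq bruhat_less_def by (rule tranclp_trans)
  next
    case 3
    let ?m = "pexp (tra i j) m"
    have r: "rk n ?m (tra i j b) = rk n m b" for b
      using 3 less.prems by (intro rk_pexp_transpose) auto
    have lt: "tra i j k < n \<longleftrightarrow> k < n" for k
      using less.prems by (auto simp: Transposition.transpose_def)
    have u: "rkf n ?m k = (rkf n m \<circ> tra i j) k" for k
      using r[of "tra i j k"] less.prems
      by (cases "k < n") (auto simp: rkf_def lt transpose_apply_other)
    then have u': "rkf n ?m = rkf n m \<circ> tra i j" by blast
    have dec: "rkf n m j < rkf n m i"
      using less.prems by (simp add: rkf_def rk_less_iff expo_before_def)
    have "perm_length n (rkf n ?m) < perm_length n (rkf n m)"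
      unfolding u' by (rule perm_length_transpose_less[OF rkf_permutes less.prems(1,2) dec])
    moreover have "rkf n m = rkf n ?m \<circ> tra i j"
      unfolding u' by (simp add: comp_assoc)
    ultimately have "bruhat_step n (rkf n ?m) (rkf n m)"
      unfolding bruhat_step_def using less.prems by (intro conjI exI[of _ i] exI[of _ j]) auto
    then show ?thesis unfolding bruhat_less_def by auto
  qed
qed

lemma expo_less_swap:
  assumes "i < j" "j < n" "elt m j < elt m i"
  shows "expo_less n (pexp (tra i j) m) m"
proof -
  have "tra i j permutes {..<n}" using assms by (intro permutes_swap_id) auto
  then show ?thesis
    using bruhat_less_swap[OF assms] by (simp add: expo_less_def v_perm_eq dec_rearr_pexp)
qed

section \<open>A height function for the order, and transitivity\<close>

definition expo_weight :: "nat \<Rightarrow> expo \<Rightarrow> nat" where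
  "expo_weight n \<mu> = (\<Sum>l<n. (n - l) * dec_rearr n \<mu> ! l)"

text \<open>The weights n - l turn the sum into the sum of all partial sums. The difference of the
  two sides is therefore the sum of the coefficients of the simple roots, which are nonnegative and
  not all zero.\<close>

lemma dom_le_weight:
  assumes "dom_le n x y" "length x = n" "length y = n" "x \<noteq> y"
  shows "(\<Sum>l<n. (n - l) * x ! l) < (\<Sum>l<n. (n - l) * y ! l)"
proof -
  obtain a :: "nat \<Rightarrow> nat" where a: "\<And>m. m < n \<Longrightarrow> int (y ! m) - int (x ! m) =
     (if Suc m < n then int (a m) else 0) - (if 0 < m then int (a (m - 1)) else 0)"
    using assms(1) by (auto simp: dom_le_def)
  define a' where "a' m = (if Suc m < n then int (a m) else 0)" for m
  have partial: "(\<Sum>l<k. int (y ! l) - int (x ! l)) = (if 0 < k then a' (k - 1) else 0)" if "k \<le> n" for k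
    using that
  proof (induction k)
    case (Suc k)
    then show ?case using a[of k] by (auto simp: a'_def)
  qed simp
  have weights: "(\<Sum>l<n. int (n - l) * f l) = (\<Sum>k<n. \<Sum>l<Suc k. f l)" for f :: "nat \<Rightarrow> int"
  proof (induction n)
    case (Suc n)
    have "(\<Sum>l<Suc n. int (Suc n - l) * f l) = (\<Sum>l<Suc n. int (n - l) * f l + f l)"
      by (intro sum.cong) (auto simp: Suc_diff_le algebra_simps)
    then show ?case using Suc by (simp add: sum.distrib)
  qed simp
  have eq: "int (\<Sum>l<n. (n - l) * y ! l) - int (\<Sum>l<n. (n - l) * x ! l) = (\<Sum>k<n. a' k)"
  proof -
    have "int (\<Sum>l<n. (n - l) * y ! l) - int (\<Sum>l<n. (n - l) * x ! l) =
      (\<Sum>l<n. int (n - l) * (int (y ! l) - int (x ! l)))"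
      by (simp add: sum_subtractf right_diff_distrib)
    also have "\<dots> = (\<Sum>k<n. \<Sum>l<Suc k. int (y ! l) - int (x ! l))" by (rule weights)
    also have "\<dots> = (\<Sum>k<n. a' k)" by (intro sum.cong refl) (subst partial, auto)
    finally show ?thesis .
  qed
  have nonneg: "a' k \<ge> 0" for k by (simp add: a'_def)
  have "(\<Sum>k<n. a' k) \<noteq> 0"
  proof
    assume "(\<Sum>k<n. a' k) = 0"
    then have z: "\<And>k. k < n \<Longrightarrow> a' k = 0" using nonneg by (simp add: sum_nonneg_eq_0_iff)
    have "x ! m = y ! m" if "m < n" for m
    proof -
      have "a' m = 0" "0 < m \<longrightarrow> a' (m - 1) = 0" using z that by auto
      then show ?thesis using a[OF that] that by (auto simp: a'_def split: if_splits)
    qed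
    then show False using assms by (auto intro: nth_equalityI)
  qed
  moreover have "(\<Sum>k<n. a' k) \<ge> 0" by (rule sum_nonneg) (use nonneg in auto)
  ultimately show ?thesis using eq by linarith
qed

lemma bruhat_less_length: "bruhat_less n u v \<Longrightarrow> perm_length n u < perm_length n v"
  unfolding bruhat_less_def
  by (induction rule: tranclp_induct) (auto simp: bruhat_step_def)

text \<open>A lexicographic pair packed into one number: lengths are at most n * n, so the factor
  \<open>Suc (n * n)\<close> lets a gain in weight outweigh any change of length. It yields
  irreflexivity, maximal keys and inductions along the order.\<close>

definition expo_height :: "nat \<Rightarrow> expo \<Rightarrow> nat" where
  "expo_height n \<mu> = expo_weight n \<mu> * Suc (n * n) + perm_length n (v_perm n \<mu>)"

lemma perm_length_le: "perm_length n v \<le> n * n"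
proof -
  have "card (invs n v) \<le> card ({..<n} \<times> {..<n})"
    by (intro card_mono) (auto simp: invs_def)
  then show ?thesis by (simp add: card_invs)
qed

lemma expo_less_height:
  assumes "expo_less n \<nu> \<mu>"
  shows "expo_height n \<nu> < expo_height n \<mu>"
proof (cases "dec_rearr n \<nu> = dec_rearr n \<mu>")
  case True
  then show ?thesis
    using assms bruhat_less_length by (auto simp: expo_less_def expo_height_def expo_weight_def)
next
  case False
  then have "expo_weight n \<nu> < expo_weight n \<mu>"
    using assms unfolding expo_less_def expo_weight_def by (intro dom_le_weight) auto
  then have "Suc (expo_weight n \<nu>) * Suc (n * n) \<le> expo_weight n \<mu> * Suc (n * n)"
    by (intro mult_le_mono1) simp
  then show ?thesis
    using perm_length_le[of n "v_perm n \<nu>"] unfolding expo_height_def by simp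
qed

lemma dom_le_trans:
  assumes "dom_le n x y" "dom_le n y z"
  shows "dom_le n x z"
proof -
  obtain a b :: "nat \<Rightarrow> nat" where
    a: "\<forall>m<n. int (y ! m) - int (x ! m) =
     (if Suc m < n then int (a m) else 0) - (if 0 < m then int (a (m - 1)) else 0)" and
    b: "\<forall>m<n. int (z ! m) - int (y ! m) =
     (if Suc m < n then int (b m) else 0) - (if 0 < m then int (b (m - 1)) else 0)"
    using assms unfolding dom_le_def by blast
  show ?thesis
    unfolding dom_le_def
  proof (intro exI[of _ "\<lambda>m. a m + b m"] allI impI)
    fix m assume "m < n"
    then show "int (z ! m) - int (x ! m) =
     (if Suc m < n then int (a m + b m) else 0) - (if 0 < m then int (a (m - 1) + b (m - 1)) else 0)"
      using spec[OF a, of m] spec[OF b, of m] by (simp split: if_splits)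
  qed
qed

lemma expo_less_trans:
  assumes "expo_less n \<rho> \<nu>" "expo_less n \<nu> \<mu>"
  shows "expo_less n \<rho> \<mu>"
proof -
  show ?thesis
  proof (cases "dec_rearr n \<rho> = dec_rearr n \<nu> \<or> dec_rearr n \<nu> = dec_rearr n \<mu>")
    case True
    then show ?thesis
      using assms unfolding expo_less_def bruhat_less_def by (metis tranclp_trans)
  next
    case False
    then have *: "dom_le n (dec_rearr n \<rho>) (dec_rearr n \<nu>)" "dom_le n (dec_rearr n \<nu>) (dec_rearr n \<mu>)"
      using assms by (auto simp: expo_less_def)
    have "dec_rearr n \<rho> \<noteq> dec_rearr n \<mu>"
    proof
      assume "dec_rearr n \<rho> = dec_rearr n \<mu>"
      then have "expo_weight n \<rho> = expo_weight n \<mu>" by (simp add: expo_weight_def)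
      moreover have "expo_weight n \<rho> < expo_weight n \<nu>" "expo_weight n \<nu> < expo_weight n \<mu>"
        using * False unfolding expo_weight_def by (auto intro!: dom_le_weight)
      ultimately show False by simp
    qed
    then show ?thesis using dom_le_trans[OF *] by (simp add: expo_less_def)
  qed
qed

lemma expo_less_irrefl: "\<not> expo_less n \<mu> \<mu>"
  using expo_less_height by blast

section \<open>Linear operators on polynomials\<close>

abbreviation mon :: "expo \<Rightarrow> 'a::field mpol" where "mon m \<equiv> Poly_Mapping.single m 1"

abbreviation co :: "'a::zero mpol \<Rightarrow> expo \<Rightarrow> 'a" where "co \<equiv> Poly_Mapping.lookup"

lemma lookup_mscale [simp]: "co (mscale a f) m = a * co f m"
  unfolding mscale_def mconst_def mult_map_scale_conv_mult[symmetric]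
  by (simp add: Poly_Mapping.map.rep_eq when_def)

lemma mscale_single: "mscale a (Poly_Mapping.single m b) = Poly_Mapping.single m (a * b)"
  by (rule poly_mapping_eqI) (simp add: lookup_single when_def)

lemma mscale_mult_right: "f * mscale a g = mscale a (f * g)"
  and mscale_mult_left: "mscale a f * g = mscale a (f * g)"
  by (simp_all add: mscale_def mult_ac)

lemma mpol_expand: "f = (\<Sum>m\<in>Poly_Mapping.keys f. mscale (co f m) (mon m))"
  by (rule poly_mapping_eqI)
    (simp add: lookup_sum mscale_single lookup_single when_def sum.delta' in_keys_iff)

definition mlin :: "('a::field mpol \<Rightarrow> 'a mpol) \<Rightarrow> bool" where
  "mlin L \<longleftrightarrow> (\<forall>f g. L (f + g) = L f + L g) \<and> (\<forall>a f. L (mscale a f) = mscale a (L f))"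

lemma mlin_add: "mlin L \<Longrightarrow> L (f + g) = L f + L g"
  and mlin_scale: "mlin L \<Longrightarrow> L (mscale a f) = mscale a (L f)"
  by (simp_all add: mlin_def)

lemma mlin_zero: "mlin L \<Longrightarrow> L 0 = 0"
  using mlin_scale[of L 0 0] by simp

lemma mlin_diff: "mlin L \<Longrightarrow> L (f - g) = L f - L g"
  using mlin_add[of L "f - g" g] by (simp add: algebra_simps)

lemma mlin_sum: "mlin L \<Longrightarrow> L (\<Sum>i\<in>A. f i) = (\<Sum>i\<in>A. L (f i))"
  by (induction A rule: infinite_finite_induct) (auto simp: mlin_zero mlin_add)

lemma mlin_expand: "mlin L \<Longrightarrow> L f = (\<Sum>m\<in>Poly_Mapping.keys f. mscale (co f m) (L (mon m)))"
  using arg_cong[OF mpol_expand[of f], of L] by (simp only: mlin_sum mlin_scale)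

text \<open>Agreement is demanded only on the monomials that occur in f. Several operator identities
  below need the exponents to lie in one residue class modulo r, and f is then supported
  there.\<close>

lemma mlin_eqI:
  assumes "mlin L" "mlin M" "\<And>m. m \<in> Poly_Mapping.keys f \<Longrightarrow> L (mon m) = M (mon m)"
  shows "L f = M f"
proof -
  have "L f = (\<Sum>m\<in>Poly_Mapping.keys f. mscale (co f m) (L (mon m)))" by (rule mlin_expand[OF assms(1)])
  also have "\<dots> = (\<Sum>m\<in>Poly_Mapping.keys f. mscale (co f m) (M (mon m)))"
    by (intro sum.cong refl) (simp add: assms(3))
  also have "\<dots> = M f" by (rule mlin_expand[OF assms(2), symmetric])
  finally show ?thesis .
qed

lemma mlin_ident [intro]: "mlin (\<lambda>f. f)"
  and mlin_mult [intro]: "mlin L \<Longrightarrow> mlin (\<lambda>f. g * L f)"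
  and mlin_mult' [intro]: "mlin L \<Longrightarrow> mlin (\<lambda>f. L f * g)"
  and mlin_plus [intro]: "mlin L \<Longrightarrow> mlin M \<Longrightarrow> mlin (\<lambda>f. L f + M f)"
  and mlin_minus [intro]: "mlin L \<Longrightarrow> mlin M \<Longrightarrow> mlin (\<lambda>f. L f - M f)"
  and mlin_mscale [intro]: "mlin L \<Longrightarrow> mlin (\<lambda>f. mscale a (L f))"
  by (auto simp: mlin_def algebra_simps mscale_mult_right mscale_mult_left
      mpol.scale_right_distrib mpol.scale_right_diff_distrib)

lemma mlin_compose [intro]: "mlin L \<Longrightarrow> mlin M \<Longrightarrow> mlin (\<lambda>f. L (M f))"
  by (simp add: mlin_def)

lemma mlin_summation [intro]:
  assumes "\<And>i. i \<in> A \<Longrightarrow> mlin (L i)"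
  shows "mlin (\<lambda>f. \<Sum>i\<in>A. L i f)"
  using assms by (auto simp: mlin_def sum.distrib mpol.scale_sum_right)

text \<open>The linear map with prescribed values on monomials. Operators given by quotients are
  replaced by such maps, so that identities between them reduce to monomials.\<close>

definition lin :: "(expo \<Rightarrow> 'a::field mpol) \<Rightarrow> 'a mpol \<Rightarrow> 'a mpol" where
  "lin A f = (\<Sum>m\<in>Poly_Mapping.keys f. mscale (co f m) (A m))"

lemma lin_superset:
  assumes "finite K" "Poly_Mapping.keys f \<subseteq> K"
  shows "lin A f = (\<Sum>m\<in>K. mscale (co f m) (A m))"
  unfolding lin_def using assms by (intro sum.mono_neutral_left) (auto simp: in_keys_iff)

lemma mlin_lin [intro]: "mlin (lin A)"
  unfolding mlin_def
proof (intro conjI allI)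
  fix f g :: "'a mpol"
  let ?K = "Poly_Mapping.keys f \<union> Poly_Mapping.keys g"
  show "lin A (f + g) = lin A f + lin A g"
    using keys_add[of f g]
    by (simp add: lin_superset[of ?K] lookup_add mpol.scale_left_distrib sum.distrib)
next
  fix a and f :: "'a mpol"
  have "Poly_Mapping.keys (mscale a f) \<subseteq> Poly_Mapping.keys f"
    by (auto simp: in_keys_iff)
  then show "lin A (mscale a f) = mscale a (lin A f)"
    by (simp add: lin_superset[of "Poly_Mapping.keys f"] mpol.scale_sum_right)
qed

lemma lin_mon [simp]: "lin A (mon m) = A m"
  by (simp add: lin_def)

lemma mon_mult: "mon m * mon m' = mon (m + m')"
  by (simp add: mult_single)

lemma mvar_mon: "mvar i * mon m = mon (Poly_Mapping.single i 1 + m)"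
  unfolding mvar_def by (simp add: mon_mult)

lemma polys_mon [simp]: "mon m \<in> polys n \<longleftrightarrow> m \<in> expos n"
  by (simp add: polys_def)

lemma subspace_polys: "mpol.subspace (polys n)"
proof (rule mpol.subspaceI)
  fix f g :: "'a mpol" and a
  assume f: "f \<in> polys n" and g: "g \<in> polys n"
  show "f + g \<in> polys n" using f g keys_add[of f g] by (auto simp: polys_def)
next
  fix f :: "'a mpol" and a
  assume "f \<in> polys n"
  then show "mscale a f \<in> polys n" by (auto simp: polys_def in_keys_iff)
qed (simp add: polys_def)

lemmas polys_add = mpol.subspace_add[OF subspace_polys]
  and polys_diff = mpol.subspace_diff[OF subspace_polys]
  and polys_scale = mpol.subspace_scale[OF subspace_polys]
  and polys_sum = mpol.subspace_sum[OF subspace_polys]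

lemma mlin_polys:
  assumes "mlin L" "\<And>m. m \<in> expos n \<Longrightarrow> L (mon m) \<in> polys n" "f \<in> polys n"
  shows "L f \<in> polys n"
  unfolding mlin_expand[OF assms(1), of f]
  using assms(2,3) by (intro polys_sum polys_scale) (auto simp: polys_def)

lemma polys_eqI:
  assumes "mlin L" "mlin M" "\<And>m. m \<in> expos n \<Longrightarrow> L (mon m) = M (mon m)" "f \<in> polys n"
  shows "L f = M f"
proof (rule mlin_eqI[OF assms(1,2)])
  fix m assume "m \<in> Poly_Mapping.keys f"
  then show "L (mon m) = M (mon m)" using assms(3,4) by (auto simp: polys_def)
qed

lemma mlin_msubst: "mlin (msubst \<sigma>)"
proof -
  have "msubst \<sigma> = lin (\<lambda>m. \<Prod>i\<in>Poly_Mapping.keys m. \<sigma> i ^ elt m i)"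
    by (rule ext) (simp add: msubst_def lin_def mscale_def)
  then show ?thesis by auto
qed

lemma mlin_mat_act [intro]: "mlin (mat_act w)"
  unfolding mat_act_def by (rule mlin_msubst)

lemma mderiv_eq_lin:
  "mderiv i = lin (\<lambda>m. mscale (of_nat (elt m i)) (mon (m - Poly_Mapping.single i 1)))"
  by (rule ext) (simp add: mderiv_def lin_def mscale_single mult.commute)

section \<open>Monomial matrices\<close>

lemma pexp_id: "pexp (\<lambda>x. x) m = m"
  unfolding pexp_def inv_id[unfolded id_def] by (rule Poly_Mapping.map_key_id)

lemma pexp_comp:
  assumes "\<sigma> permutes S" "\<tau> permutes S"
  shows "pexp (\<sigma> \<circ> \<tau>) m = pexp \<sigma> (pexp \<tau> m)"
  by (rule poly_mapping_eqI)
    (simp add: lookup_pexp[OF permutes_compose[OF assms(2,1)]] lookup_pexp[OF assms(1)]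
      lookup_pexp[OF assms(2)] permutes_inv_o(1) o_inv_distrib permutes_bij[OF assms(1)] permutes_bij[OF assms(2)])

lemma pexp_inv:
  assumes "\<sigma> permutes S"
  shows "pexp (pinv \<sigma>) (pexp \<sigma> m) = m" "pexp \<sigma> (pexp (pinv \<sigma>) m) = m"
  by (rule poly_mapping_eqI,
      simp add: lookup_pexp[OF assms] lookup_pexp[OF permutes_inv[OF assms]]
        permutes_inverses[OF assms] permutes_inv_inv[OF assms])+

lemma pexp_add: "\<sigma> permutes S \<Longrightarrow> pexp \<sigma> (m + m') = pexp \<sigma> m + pexp \<sigma> m'"
  by (rule poly_mapping_eqI) (simp add: lookup_pexp lookup_add)

lemma pexp_single: "\<sigma> permutes S \<Longrightarrow> pexp \<sigma> (Poly_Mapping.single i a) = Poly_Mapping.single (\<sigma> i) a"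
  by (rule poly_mapping_eqI) (auto simp: lookup_pexp lookup_single when_def permutes_inverses)

lemma expos_iff: "m \<in> expos n \<longleftrightarrow> (\<forall>i\<ge>n. elt m i = 0)"
  by (auto simp: expos_def subset_iff in_keys_iff) (metis not_less less_irrefl)

lemma pexp_expos:
  assumes "\<sigma> permutes {..<n}"
  shows "pexp \<sigma> m \<in> expos n \<longleftrightarrow> m \<in> expos n"
proof -
  have "elt (pexp \<sigma> m) i = elt m i" if "i \<ge> n" for i
    using that permutes_not_in[OF permutes_inv[OF assms], of i] by (simp add: lookup_pexp[OF assms])
  then show ?thesis by (simp add: expos_iff)
qed

lemma pexp_xfer:
  assumes "\<sigma> permutes S"
  shows "pexp \<sigma> (xfer i j A m) = xfer (\<sigma> i) (\<sigma> j) A (pexp \<sigma> m)"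
  by (rule poly_mapping_eqI)
    (auto simp: lookup_pexp[OF assms] lookup_xfer permutes_inverses[OF assms])

definition pact :: "(nat \<Rightarrow> nat) \<Rightarrow> 'a::field mpol \<Rightarrow> 'a mpol" where
  "pact \<sigma> = lin (\<lambda>m. mon (pexp \<sigma> m))"

lemma mlin_pact [intro]: "mlin (pact \<sigma>)"
  and pact_mon [simp]: "pact \<sigma> (mon m) = mon (pexp \<sigma> m)"
  by (auto simp: pact_def)

lemma pact_comp: "\<sigma> permutes S \<Longrightarrow> \<tau> permutes S \<Longrightarrow> pact (\<sigma> \<circ> \<tau>) f = pact \<sigma> (pact \<tau> f)"
  by (rule mlin_eqI[where L = "pact (\<sigma> \<circ> \<tau>)"]) (auto simp: pexp_comp)

lemma pact_id: "pact (\<lambda>x. x) f = f"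
  by (rule mlin_eqI[where L = "pact (\<lambda>x. x)" and M = "\<lambda>f. f"]) (auto simp: pexp_id)

lemma pact_inv:
  assumes "\<sigma> permutes S"
  shows "pact (pinv \<sigma>) (pact \<sigma> f) = f" "pact \<sigma> (pact (pinv \<sigma>) f) = f"
  by (rule mlin_eqI[where M = "\<lambda>f. f"]; auto simp: pexp_inv[OF assms])+

lemma pact_mvar: "\<sigma> permutes S \<Longrightarrow> pact \<sigma> (mvar i * f) = mvar (\<sigma> i) * pact \<sigma> f"
  by (rule mlin_eqI[OF mlin_compose[OF mlin_pact mlin_mult[OF mlin_ident]] mlin_mult[OF mlin_pact]])
    (simp add: mvar_mon pexp_add pexp_single)

lemma lookup_pact:
  assumes "\<sigma> permutes S"
  shows "co (pact \<sigma> f) m = co f (pexp (pinv \<sigma>) m)"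
proof -
  have "pexp \<sigma> k = m \<longleftrightarrow> k = pexp (pinv \<sigma>) m" for k
    using pexp_inv[OF assms] by metis
  then show ?thesis
    by (simp add: pact_def lin_def lookup_sum lookup_single when_def in_keys_iff if_distrib sum.delta
        cong: if_cong)
qed

lemma keys_pact:
  assumes "\<sigma> permutes S"
  shows "Poly_Mapping.keys (pact \<sigma> f) = pexp \<sigma> ` Poly_Mapping.keys f"
proof (intro Set.set_eqI iffI)
  fix m assume "m \<in> Poly_Mapping.keys (pact \<sigma> f)"
  then have "pexp (pinv \<sigma>) m \<in> Poly_Mapping.keys f" by (simp add: in_keys_iff lookup_pact[OF assms])
  then show "m \<in> pexp \<sigma> ` Poly_Mapping.keys f" by (metis imageI pexp_inv(2)[OF assms])
qed (auto simp: in_keys_iff lookup_pact[OF assms] pexp_inv[OF assms])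

lemma pact_polys: "\<sigma> permutes {..<n} \<Longrightarrow> f \<in> polys n \<Longrightarrow> pact \<sigma> f \<in> polys n"
  by (auto simp: polys_def keys_pact pexp_expos)

lemma mconst_one: "mconst 1 = 1"
  and mconst_mult: "mconst (a * b) = mconst a * mconst (b :: 'a::field)"
  by (simp_all add: mconst_def mult_single)

lemma mconst_power: "mconst (a ^ k) = mconst (a :: 'a::field) ^ k"
  by (induction k) (simp_all add: mconst_one mconst_mult)

lemma mconst_prod: "mconst (\<Prod>i\<in>A. f i :: 'a::field) = (\<Prod>i\<in>A. mconst (f i))"
  by (induction A rule: infinite_finite_induct) (simp_all add: mconst_one mconst_mult)

lemma mvar_power: "mvar i ^ k = (mon (Poly_Mapping.single i k) :: 'a::field mpol)"
  by (induction k) (simp_all add: mvar_mon single_add[symmetric])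

lemma mon_prod: "finite A \<Longrightarrow> (\<Prod>i\<in>A. mon (f i)) = (mon (\<Sum>i\<in>A. f i) :: 'a::field mpol)"
  by (induction A rule: finite_induct) (simp_all add: mult_single)

text \<open>The action on coordinates is contragredient, so x_b goes to the inverse of the entry u b
  times the variable with index \<sigma> b.\<close>

lemma mat_act_mon:
  assumes \<sigma>: "\<sigma> permutes {..<n}" and w: "w \<in> carrier_mat n n"
    and entries: "\<And>a b. a < n \<Longrightarrow> b < n \<Longrightarrow> w $$ (a, b) = (if a = \<sigma> b then u b else 0)"
    and m: "m \<in> expos n"
  shows "mat_act w (mon m) = mscale (\<Prod>i<n. inverse (u i) ^ elt m i) (mon (pexp \<sigma> m))"
proof -
  let ?K = "Poly_Mapping.keys m"
  have K: "?K \<subseteq> {..<n}" using m by (simp add: expos_def)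
  have x: "(\<Sum>j<dim_row w. mconst (monomial_inv w $$ (i, j)) * mvar j) = mconst (inverse (u i)) * mvar (\<sigma> i)"
    if "i \<in> ?K" for i
  proof -
    have i: "i < n" using that K by auto
    have "(\<Sum>j<dim_row w. mconst (monomial_inv w $$ (i, j)) * mvar j) =
      (\<Sum>j<n. if j = \<sigma> i then mconst (inverse (u i)) * mvar j else 0)"
      using w i entries by (intro sum.cong) (auto simp: monomial_inv_def mconst_def)
    then show ?thesis using permutes_in_image[OF \<sigma>, of i] i by (simp add: sum.delta)
  qed
  have "mat_act w (mon m) = (\<Prod>i\<in>?K. (\<Sum>j<dim_row w. mconst (monomial_inv w $$ (i, j)) * mvar j) ^ elt m i)"
    by (simp add: mat_act_def msubst_def mconst_one)
  also have "\<dots> = (\<Prod>i\<in>?K. mconst (inverse (u i)) ^ elt m i) * (\<Prod>i\<in>?K. mvar (\<sigma> i) ^ elt m i)"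
    by (simp add: x power_mult_distrib prod.distrib)
  also have "\<dots> = mconst (\<Prod>i\<in>?K. inverse (u i) ^ elt m i) * mon (\<Sum>i\<in>?K. Poly_Mapping.single (\<sigma> i) (elt m i))"
    by (simp only: mconst_prod mconst_power mvar_power mon_prod[OF finite_keys])
  also have "(\<Prod>i\<in>?K. inverse (u i) ^ elt m i) = (\<Prod>i<n. inverse (u i) ^ elt m i)"
    using K by (intro prod.mono_neutral_left) (auto simp: in_keys_iff)
  also have "(\<Sum>i\<in>?K. Poly_Mapping.single (\<sigma> i) (elt m i)) = pexp \<sigma> m"
  proof (rule poly_mapping_eqI)
    fix k
    have "\<sigma> i = k \<longleftrightarrow> i = pinv \<sigma> k" for i
      using permutes_inverses[OF \<sigma>] by metis
    then show "elt (\<Sum>i\<in>?K. Poly_Mapping.single (\<sigma> i) (elt m i)) k = elt (pexp \<sigma> m) k"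
      by (simp add: lookup_sum lookup_single when_def lookup_pexp[OF \<sigma>] in_keys_iff sum.delta)
  qed
  finally show ?thesis by (simp add: mscale_def)
qed

lemma dg_mult_left:
  assumes "A \<in> carrier_mat n n" "a < n" "b < n"
  shows "(dg n i u * A) $$ (a, b) = (if a = i then u else 1) * A $$ (a, b)"
  using assms by (simp add: dg_def scalar_prod_def if_distrib[of "\<lambda>x. x * _"] sum.delta cong: if_cong)

lemma dg_mult_right:
  assumes "A \<in> carrier_mat n n" "a < n" "b < n"
  shows "(A * dg n i u) $$ (a, b) = A $$ (a, b) * (if b = i then u else 1)"
  using assms by (simp add: dg_def scalar_prod_def if_distrib[of "\<lambda>x. _ * x"] sum.delta' cong: if_cong)

lemma dg_carrier [simp]: "dg n i u \<in> carrier_mat n n"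
  and transp_carrier [simp]: "transp_mat n i j \<in> carrier_mat n n"
  by (simp_all add: dg_def transp_mat_def)

lemma refl_mat_carrier [simp]: "refl_mat P i j l \<in> carrier_mat (dimn P) (dimn P)"
  unfolding refl_mat_def by (metis dg_carrier mult_carrier_mat transp_carrier)

lemma refl_mat_entry:
  assumes "a < dimn P" "b < dimn P"
  shows "refl_mat P i j l $$ (a, b) = (if a = tra i j b then
    (if a = i then zeta P ^ l else 1) * (if b = i then inverse (zeta P) ^ l else 1) else 0)"
  using assms unfolding refl_mat_def
  by (subst dg_mult_right[where n = "dimn P"], simp_all add: dg_mult_left mult_carrier_mat[of _ "dimn P" "dimn P"])
    (simp add: transp_mat_def)

lemma mat_act_dg_mon:
  assumes "m \<in> expos n" "i < n"
  shows "mat_act (dg n i u) (mon m) = mscale (inverse u ^ elt m i) (mon m)"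
proof -
  have "mat_act (dg n i u) (mon m) =
    mscale (\<Prod>k<n. inverse (if k = i then u else 1) ^ elt m k) (mon (pexp (\<lambda>x. x) m))"
    by (rule mat_act_mon) (use assms in \<open>auto simp: dg_def permutes_id[unfolded id_def]\<close>)
  also have "(\<Prod>k<n. inverse (if k = i then u else 1) ^ elt m k) =
    (\<Prod>k<n. if k = i then inverse u ^ elt m k else 1)"
    by (intro prod.cong) auto
  finally show ?thesis using assms by (simp add: pexp_id prod.delta)
qed

lemma mat_act_refl_mon:
  assumes m: "m \<in> expos (dimn P)" and ij: "i < dimn P" "j < dimn P" "i \<noteq> j" and z: "zeta P \<noteq> 0"
  shows "mat_act (refl_mat P i j l) (mon m) =
    mscale ((zeta P ^ l) powi (int (elt m i) - int (elt m j))) (mon (pexp (tra i j) m))"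
proof -
  let ?u = "\<lambda>b. if b = j then zeta P ^ l else if b = i then inverse (zeta P) ^ l else 1"
  let ?g = "\<lambda>k. inverse (?u k) ^ elt m k"
  have "mat_act (refl_mat P i j l) (mon m) = mscale (\<Prod>k<dimn P. ?g k) (mon (pexp (tra i j) m))"
    by (rule mat_act_mon[where n = "dimn P"])
      (use m ij in \<open>auto simp: refl_mat_entry permutes_swap_id Transposition.transpose_def split: if_splits\<close>)
  also have "(\<Prod>k<dimn P. ?g k) = (\<Prod>k\<in>{i, j}. ?g k)"
    using ij by (intro prod.mono_neutral_right) auto
  also have "\<dots> = (zeta P ^ l) ^ elt m i * inverse (zeta P ^ l) ^ elt m j"
    using ij by (simp add: power_inverse)
  also have "\<dots> = (zeta P ^ l) powi (int (elt m i) - int (elt m j))"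
    using z by (simp add: power_int_diff power_inverse divide_inverse)
  finally show ?thesis .
qed

section \<open>The Dunkl operators on monomials\<close>

lemma mquot_mult: "g \<noteq> 0 \<Longrightarrow> mquot (q * g) g = (q :: 'a::field mpol)"
  unfolding mquot_def by (rule the_equality) auto

text \<open>\<open>mquot\<close> is a description without visible linearity. A quotient found for
  each monomial extends linearly, and cancellation of g identifies it with the described
  one.\<close>

lemma mquot_diff_eq_lin:
  assumes g: "g \<noteq> 0" and L: "mlin L" and f: "f \<in> polys n"
    and eq: "\<And>m. m \<in> expos n \<Longrightarrow> Q m * g = mon m - L (mon m)"
  shows "mquot (f - L f) g = lin Q f"
proof -
  have "lin Q f * g = f - L f"
    by (rule polys_eqI[OF mlin_mult'[OF mlin_lin] mlin_minus[OF mlin_ident L] _ f]) (simp add: eq)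
  then show ?thesis using mquot_mult[OF g, of "lin Q f"] by simp
qed

lemma mvar_nonzero: "(mvar i :: 'a::field mpol) \<noteq> 0"
  by (metis lookup_single_eq lookup_zero mvar_def zero_neq_one)

lemma mvar_diff_nonzero:
  assumes "i \<noteq> j"
  shows "mvar i - mconst y * mvar j \<noteq> (0 :: 'a::field mpol)"
proof
  assume "mvar i - mconst y * mvar j = (0 :: 'a mpol)"
  then have "co (mvar i - mscale y (mvar j)) (Poly_Mapping.single i 1) = (0::'a)"
    by (simp add: mscale_def)
  moreover have "Poly_Mapping.single j (1::nat) \<noteq> Poly_Mapping.single i 1"
    using assms by (metis lookup_single_eq lookup_single_not_eq zero_neq_one)
  ultimately show False by (simp add: lookup_minus mvar_def lookup_single when_def)
qed

text \<open>Like \<open>xfer\<close>, but with the total of the two parts lowered by one: the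
  exponents in the quotient of a difference of monomials by a linear form in x_i and x_j.\<close>

definition yexp :: "nat \<Rightarrow> nat \<Rightarrow> nat \<Rightarrow> expo \<Rightarrow> expo" where
  "yexp i j A m = Poly_Mapping.update i A (Poly_Mapping.update j (elt m i + elt m j - 1 - A) m)"

abbreviation ex :: "nat \<Rightarrow> expo" where "ex i \<equiv> Poly_Mapping.single i 1"

lemma lookup_ex: "elt (ex i) k = (if k = i then 1 else 0)"
  and lookup_ex_Suc [simp]: "elt (Poly_Mapping.single i (Suc 0)) k = (if k = i then 1 else 0)"
  by (simp_all add: lookup_single when_def)

lemma ex_yexp:
  assumes "i \<noteq> j"
  shows "ex i + yexp i j A m = xfer i j (Suc A) m"
    and "A < elt m i + elt m j \<Longrightarrow> ex j + yexp i j A m = xfer i j A m"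
    and "yexp i j A (ex i + m) = xfer i j A m"
  by (rule poly_mapping_eqI;
      use assms in \<open>auto simp: lookup_add lookup_ex yexp_def lookup_update lookup_xfer\<close>)+

lemma xfer_same: "xfer i j (elt m i) m = m"
  and xfer_swap: "xfer i j (elt m j) m = pexp (tra i j) m"
  by (rule poly_mapping_eqI; auto simp: lookup_xfer lookup_pexp_transpose Transposition.transpose_def)+

text \<open>The geometric sum for the quotient of x^m minus its reflection by x_i - y x_j. The
  difference of the two indicators selects the A between the two parts and supplies the sign, so one
  formula covers both orders of the parts and equality.\<close>

definition divdiff :: "'a::field \<Rightarrow> nat \<Rightarrow> nat \<Rightarrow> expo \<Rightarrow> 'a mpol" where
  "divdiff y i j m = (\<Sum>A<elt m i + elt m j.
     mscale ((of_bool (A < elt m i) - of_bool (A < elt m j)) * y powi (int (elt m i) - 1 - int A))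
       (mon (yexp i j A m)))"

lemma divdiff_mult:
  assumes ij: "i \<noteq> j" and y: "y \<noteq> 0"
  shows "divdiff y i j m * (mvar i - mconst y * mvar j) =
    mon m - mscale (y powi (int (elt m i) - int (elt m j))) (mon (pexp (tra i j) m))"
proof -
  define a b where "a = elt m i" and "b = elt m j"
  define N where "N = a + b"
  define X where "X A = (mon (xfer i j A m) :: 'a mpol)" for A
  \<comment> \<open>Multiplication by x_i gives T shifted by one, multiplication by y x_j gives U.
    The indicators in T and U differ only at A = a and A = b, which leaves the two monomials on the
    right-hand side.\<close>
  define T where "T A = mscale ((of_bool (A \<le> a) - of_bool (A \<le> b)) * y powi (int a - int A)) (X A)" for A
  define U where "U A = mscale ((of_bool (A < a) - of_bool (A < b)) * y powi (int a - int A)) (X A)" for A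
  have 1: "divdiff y i j m * mvar i = (\<Sum>A<N. T (Suc A))"
    unfolding divdiff_def sum_distrib_right N_def a_def[symmetric] b_def[symmetric]
  proof (intro sum.cong refl)
    fix A
    show "mscale ((of_bool (A < a) - of_bool (A < b)) * y powi (int a - 1 - int A)) (mon (yexp i j A m)) * mvar i = T (Suc A)"
    proof -
      have "int a - 1 - int A = int a - int (Suc A)" by simp
      then show ?thesis
        unfolding T_def X_def
        by (simp only: mult.commute[of _ "mvar i"] mscale_mult_right mvar_mon ex_yexp(1)[OF ij] less_eq_Suc_le)
    qed
  qed
  have 2: "divdiff y i j m * (mconst y * mvar j) = (\<Sum>A<N. U A)"
    unfolding divdiff_def sum_distrib_right N_def a_def[symmetric] b_def[symmetric]
  proof (intro sum.cong refl)
    fix A assume "A \<in> {..<a + b}"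
    then have e: "ex j + yexp i j A m = xfer i j A m"
      using ex_yexp(2)[OF ij] by (simp add: a_def b_def)
    have p: "y powi (int a - 1 - int A) * y = y powi (int a - int A)"
      using y power_int_add_1[of y "int a - 1 - int A"] by (simp add: algebra_simps)
    have "mscale ((of_bool (A < a) - of_bool (A < b)) * y powi (int a - 1 - int A)) (mon (yexp i j A m)) * (mconst y * mvar j)
      = mscale ((of_bool (A < a) - of_bool (A < b)) * (y powi (int a - 1 - int A) * y)) (mvar j * mon (yexp i j A m))"
      by (simp add: mscale_def mconst_mult mult_ac)
    then show "mscale ((of_bool (A < a) - of_bool (A < b)) * y powi (int a - 1 - int A)) (mon (yexp i j A m)) * (mconst y * mvar j) = U A"
      by (simp only: p mvar_mon e U_def X_def)
  qed
  have "T 0 = 0" "U N = 0" by (auto simp: T_def U_def N_def)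
  then have "(\<Sum>A<N. T (Suc A)) = (\<Sum>A\<le>N. T A)" "(\<Sum>A<N. U A) = (\<Sum>A\<le>N. U A)"
    using sum.atMost_shift[of T N] by (simp_all add: lessThan_Suc_atMost[symmetric])
  then have "divdiff y i j m * (mvar i - mconst y * mvar j) = (\<Sum>A\<le>N. T A - U A)"
    by (simp add: right_diff_distrib 1 2 sum_subtractf)
  also have "\<dots> = (\<Sum>A\<le>N. (if A = a then X a else 0) - (if A = b then mscale (y powi (int a - int b)) (X b) else 0))"
    by (intro sum.cong) (auto simp: T_def U_def mpol.scale_left_diff_distrib[symmetric] le_less)
  also have "\<dots> = X a - mscale (y powi (int a - int b)) (X b)"
    by (simp add: sum_subtractf N_def)
  finally show ?thesis
    by (simp add: X_def a_def b_def xfer_same xfer_swap)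
qed

locale chered =
  fixes P :: "'a::field cparams" and n r p :: nat
  assumes dimn [simp]: "dimn P = n" and ordr [simp]: "ordr P = r" and divp [simp]: "divp P = p"
    and n_pos: "n \<ge> 1" and r_gt_1: "r > 1" and p_pos: "p > 0" and p_dvd: "p dvd r"
    and zeta_r: "zeta P ^ r = 1" and zeta_prim: "\<And>l. 0 < l \<Longrightarrow> l < r \<Longrightarrow> zeta P ^ l \<noteq> 1"
    and cpar_0: "\<And>l. 1 \<le> l \<Longrightarrow> l \<le> r - 1 \<Longrightarrow> \<not> p dvd l \<Longrightarrow> cpar P l = 0"
begin

lemma zeta_nonzero [simp]: "zeta P \<noteq> 0"
  using zeta_r r_gt_1 by (metis not_one_less_zero power_0_left zero_neq_one)

lemma zeta_powi_mod: "zeta P powi k = zeta P ^ nat (k mod int r)"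
proof -
  have "zeta P powi k = zeta P powi (int r * (k div int r) + k mod int r)" by simp
  also have "\<dots> = (zeta P powi (int r)) powi (k div int r) * zeta P powi (k mod int r)"
    by (simp only: power_int_add[OF disjI1[OF zeta_nonzero]] power_int_mult)
  also have "\<dots> = zeta P powi (k mod int r)" by (simp add: zeta_r)
  also have "\<dots> = zeta P ^ nat (k mod int r)"
    using r_gt_1 by (simp add: power_int_def)
  finally show ?thesis .
qed

lemma zeta_powi_eq_1: "zeta P powi k = 1 \<longleftrightarrow> int r dvd k"
proof -
  define q where "q = nat (k mod int r)"
  have q: "int q = k mod int r" using r_gt_1 by (simp add: q_def)
  moreover have "k mod int r < int r" using r_gt_1 by simp
  ultimately have "q < r" by linarith
  then have "zeta P ^ q = 1 \<longleftrightarrow> q = 0"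
    using zeta_prim[of q] by (cases "q = 0") simp_all
  moreover have "q = 0 \<longleftrightarrow> int r dvd k"
    unfolding dvd_eq_mod_eq_0 q[symmetric] by simp
  ultimately show ?thesis by (simp only: zeta_powi_mod q_def[symmetric])
qed

definition ind :: "int \<Rightarrow> 'a" where
  "ind k = (if int r dvd k then of_nat r else 0)"

lemma sum_zeta_powers: "(\<Sum>l<r. (zeta P ^ l) powi k) = ind k"
proof -
  have eq: "(zeta P ^ l) powi k = (zeta P powi k) ^ l" for l
  proof -
    have "(zeta P ^ l) powi k = zeta P powi (int l * k)"
      unfolding power_int_mult power_int_of_nat ..
    also have "int l * k = k * int l" by (rule mult.commute)
    also have "zeta P powi (k * int l) = (zeta P powi k) ^ l"
      unfolding power_int_mult power_int_of_nat ..
    finally show ?thesis .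
  qed
  show ?thesis
  proof (cases "int r dvd k")
    case True
    then show ?thesis using zeta_powi_eq_1[of k] by (simp add: eq ind_def)
  next
    case False
    have "(zeta P powi k) ^ r = 1"
    proof -
      have "(zeta P powi k) ^ r = zeta P powi (k * int r)" by (simp add: power_int_mult)
      then show ?thesis using zeta_powi_eq_1[of "k * int r"] by simp
    qed
    then show ?thesis
      using False zeta_powi_eq_1[of k] by (simp add: eq geometric_sum ind_def)
  qed
qed

text \<open>The factor by which y_i lowers a pure power of x_i with exponent a, leaving aside the
  reflections that mix variables: the first term is the derivative, the others come from the
  diagonal reflections.\<close>

definition ee :: "nat \<Rightarrow> 'a" where
  "ee a = kappa P * of_nat a - (dpar P 0 - dpar P (- int a))"

lemma ee_0 [simp]: "ee 0 = 0" by (simp add: ee_def)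

definition qop :: "nat \<Rightarrow> nat \<Rightarrow> expo \<Rightarrow> 'a mpol" where
  "qop i j m = (\<Sum>A<elt m i + elt m j.
     mscale ((of_bool (A < elt m i) - of_bool (A < elt m j)) * ind (int (elt m i) - 1 - int A))
       (mon (yexp i j A m)))"

text \<open>\<open>bop\<close> is the summed quotient \<open>qop\<close> after the monomial has been
  multiplied by x_i, and \<open>cop\<close> is x_i times the quotient. They belong to y_i x_i and
  x_i y_i, and their difference is the sum of reflections applied to the monomial; see
  \<open>bop_minus_cop\<close>.\<close>

definition bop :: "nat \<Rightarrow> nat \<Rightarrow> expo \<Rightarrow> 'a mpol" where
  "bop i j m = (\<Sum>A\<le>elt m i + elt m j.
     mscale ((of_bool (A \<le> elt m i) - of_bool (A < elt m j)) * ind (int (elt m i) - int A))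
       (mon (xfer i j A m)))"

definition cop :: "nat \<Rightarrow> nat \<Rightarrow> expo \<Rightarrow> 'a mpol" where
  "cop i j m = (\<Sum>A\<le>elt m i + elt m j.
     mscale ((of_bool (A \<le> elt m i) - of_bool (A \<le> elt m j)) * ind (int (elt m i) - int A))
       (mon (xfer i j A m)))"

definition ymon :: "nat \<Rightarrow> expo \<Rightarrow> 'a mpol" where
  "ymon i m = mscale (ee (elt m i)) (mon (m - ex i)) - mscale (c0par P) (\<Sum>j\<in>{..<n} - {i}. qop i j m)"

lemma sum_divdiff: "(\<Sum>l<r. divdiff (zeta P ^ l) i j m) = qop i j m"
  unfolding divdiff_def qop_def
  by (subst sum.swap) (simp only: sum_zeta_powers sum_distrib_left[symmetric] mpol.scale_sum_left[symmetric])

lemma y_act_eq: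
  assumes i: "i < n" and f: "f \<in> polys n"
  shows "y_act P i f = lin (ymon i) f"
proof -
  have 1: "mquot (f - mat_act (refl_mat P i j l) f) (mvar i - mconst (zeta P ^ l) * mvar j) =
      lin (divdiff (zeta P ^ l) i j) f" if "j \<in> {..<n} - {i}" for j l
    using that i by (intro mquot_diff_eq_lin[OF mvar_diff_nonzero mlin_mat_act f])
      (auto simp: divdiff_mult mat_act_refl_mon)
  have 2: "mquot (f - mat_act (dg n i (zeta P ^ l)) f) (mvar i) =
      lin (\<lambda>m. mscale (1 - inverse (zeta P ^ l) ^ elt m i) (mon (m - ex i))) f" for l
  proof (intro mquot_diff_eq_lin[OF mvar_nonzero mlin_mat_act f])
    fix m assume m: "m \<in> expos n"
    have "mscale (1 - inverse (zeta P ^ l) ^ elt m i) (mvar i * mon (m - ex i)) =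
      mscale (1 - inverse (zeta P ^ l) ^ elt m i) (mon m)"
    proof (cases "elt m i = 0")
      case False
      then have "ex i + (m - ex i) = m"
        by (intro poly_mapping_eqI) (auto simp: lookup_add lookup_minus)
      then show ?thesis by (simp only: mvar_mon)
    qed simp
    then show "mscale (1 - inverse (zeta P ^ l) ^ elt m i) (mon (m - ex i)) * mvar i =
      mon m - mat_act (dg n i (zeta P ^ l)) (mon m)"
      using m i by (simp add: mat_act_dg_mon mult.commute[of _ "mvar i"] mscale_mult_right
          mpol.scale_left_diff_distrib right_diff_distrib)
  qed
  have "y_act P i f = mscale (kappa P) (mderiv i f)
     - mscale (c0par P) (\<Sum>j\<in>{..<n} - {i}. \<Sum>l<r. lin (divdiff (zeta P ^ l) i j) f)
     - (\<Sum>l = 1..r - 1. mscale (cpar P l)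
         (lin (\<lambda>m. mscale (1 - inverse (zeta P ^ l) ^ elt m i) (mon (m - ex i))) f))"
  proof -
    have s: "(\<Sum>j\<in>{..<n} - {i}. \<Sum>l<r.
        mquot (f - mat_act (refl_mat P i j l) f) (mvar i - mconst (zeta P ^ l) * mvar j)) =
      (\<Sum>j\<in>{..<n} - {i}. \<Sum>l<r. lin (divdiff (zeta P ^ l) i j) f)"
      by (intro sum.cong refl 1)
    show ?thesis unfolding y_act_def dimn ordr s 2 ..
  qed
  also have "\<dots> = lin (ymon i) f"
  proof (rule polys_eqI[OF _ mlin_lin _ f])
    show "mlin (\<lambda>f. mscale (kappa P) (mderiv i f)
     - mscale (c0par P) (\<Sum>j\<in>{..<n} - {i}. \<Sum>l<r. lin (divdiff (zeta P ^ l) i j) f)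
     - (\<Sum>l = 1..r - 1. mscale (cpar P l)
         (lin (\<lambda>m. mscale (1 - inverse (zeta P ^ l) ^ elt m i) (mon (m - ex i))) f)))"
      unfolding mderiv_eq_lin by (intro mlin_minus mlin_mscale mlin_summation mlin_lin)
  next
    fix m assume "m \<in> expos n"
    have pw: "inverse (zeta P ^ l) ^ elt m i = zeta P powi (int l * (- int (elt m i)))" for l
      by (simp add: power_int_minus power_int_mult power_inverse)
    \<comment> \<open>A diagonal reflection multiplies the monomial by a power of zeta, so the sum
      over l is a difference of two values of the Fourier transform of the c_l.\<close>
    have d: "(\<Sum>l = 1..r - 1. cpar P l * (1 - inverse (zeta P ^ l) ^ elt m i)) = dpar P 0 - dpar P (- int (elt m i))"
      unfolding pw dpar_def ordr
      by (simp add: sum_subtractf[symmetric] algebra_simps)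
    show "mscale (kappa P) (mderiv i (mon m))
     - mscale (c0par P) (\<Sum>j\<in>{..<n} - {i}. \<Sum>l<r. lin (divdiff (zeta P ^ l) i j) (mon m))
     - (\<Sum>l = 1..r - 1. mscale (cpar P l)
         (lin (\<lambda>m. mscale (1 - inverse (zeta P ^ l) ^ elt m i) (mon (m - ex i))) (mon m))) = lin (ymon i) (mon m)"
      unfolding mderiv_eq_lin lin_mon sum_divdiff mpol.scale_scale mpol.scale_sum_left[symmetric] d
      by (simp add: ymon_def ee_def mpol.scale_left_diff_distrib algebra_simps)
  qed
  finally show ?thesis .
qed

lemma qop_ex: "i \<noteq> j \<Longrightarrow> qop i j (ex i + m) = bop i j m"
  by (simp add: qop_def bop_def lookup_add lookup_ex ex_yexp(3)[simplified] lessThan_Suc_atMost less_Suc_eq_le)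

lemma mvar_qop:
  assumes "i \<noteq> j"
  shows "mvar i * qop i j m = cop i j m"
proof -
  have "mvar i * qop i j m = (\<Sum>A<elt m i + elt m j.
     mscale ((of_bool (Suc A \<le> elt m i) - of_bool (Suc A \<le> elt m j)) * ind (int (elt m i) - int (Suc A)))
       (mon (xfer i j (Suc A) m)))"
    unfolding qop_def sum_distrib_left mscale_mult_right mvar_mon ex_yexp(1)[OF assms]
    by (intro sum.cong) (auto simp: less_eq_Suc_le algebra_simps)
  then show ?thesis unfolding cop_def by (simp add: sum.atMost_shift)
qed

lemma bop_minus_cop: "bop i j m - cop i j m =
    mscale (ind (int (elt m i) - int (elt m j))) (mon (pexp (tra i j) m))"
proof -
  have "bop i j m - cop i j m = (\<Sum>A\<le>elt m i + elt m j. if A = elt m j then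
      mscale (ind (int (elt m i) - int (elt m j))) (mon (xfer i j (elt m j) m)) else 0)"
    unfolding bop_def cop_def sum_subtractf[symmetric] mpol.scale_left_diff_distrib[symmetric]
    by (intro sum.cong) (auto simp: algebra_simps)
  then show ?thesis by (simp add: xfer_swap)
qed

end

section \<open>The operators z and their intertwiners\<close>

definition cyc :: "nat \<Rightarrow> nat \<Rightarrow> nat" where
  "cyc n i = (if i < n then (if i = 0 then n - 1 else i - 1) else i)"

lemma cyc_permutes: "cyc n permutes {..<n}"
proof (rule bij_imp_permutes)
  show "bij_betw (cyc n) {..<n} {..<n}"
    by (rule bij_betw_byWitness[where f' = "\<lambda>i. if i = n - 1 then 0 else Suc i"])
      (auto simp: cyc_def)
qed (simp add: cyc_def)

text \<open>Explicitly (m_0, ..., m_(n-1)) becomes (m_1, ..., m_(n-1), m_0 + 1): the length-zero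
  generator of the extended affine symmetric group, acting on exponents.\<close>

definition phi :: "nat \<Rightarrow> expo \<Rightarrow> expo" where
  "phi n m = ex (n - 1) + pexp (cyc n) m"

definition Phi :: "nat \<Rightarrow> 'a::field mpol \<Rightarrow> 'a mpol" where
  "Phi n f = mvar (n - 1) * pact (cyc n) f"

lemma mlin_Phi [intro]: "mlin (Phi n)"
  unfolding Phi_def[abs_def] by (intro mlin_mult mlin_pact)

lemma Phi_mon: "Phi n (mon m) = mon (phi n m)"
  by (simp add: Phi_def phi_def mvar_mon)

lemma lookup_phi_cyc: "i < n \<Longrightarrow> elt (phi n m) (cyc n i) = elt m i + (if i = 0 then 1 else 0)"
  using lookup_pexp_image[OF cyc_permutes, of n m i] by (auto simp: phi_def lookup_add cyc_def)

context chered
begin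

lemma pact_bop: "\<sigma> permutes S \<Longrightarrow> pact \<sigma> (bop i j m) = bop (\<sigma> i) (\<sigma> j) (pexp \<sigma> m)"
  and pact_cop: "\<sigma> permutes S \<Longrightarrow> pact \<sigma> (cop i j m) = cop (\<sigma> i) (\<sigma> j) (pexp \<sigma> m)"
  by (simp_all add: bop_def cop_def mlin_sum[OF mlin_pact] mlin_scale[OF mlin_pact]
      pexp_xfer lookup_pexp_image)

lemma pexp_yexp:
  assumes "\<sigma> permutes S"
  shows "pexp \<sigma> (yexp i j A m) = yexp (\<sigma> i) (\<sigma> j) A (pexp \<sigma> m)"
  by (rule poly_mapping_eqI)
    (auto simp: lookup_pexp[OF assms] yexp_def lookup_update permutes_inverses[OF assms])

lemma pact_qop: "\<sigma> permutes S \<Longrightarrow> pact \<sigma> (qop i j m) = qop (\<sigma> i) (\<sigma> j) (pexp \<sigma> m)"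
  by (simp add: qop_def mlin_sum[OF mlin_pact] mlin_scale[OF mlin_pact] pexp_yexp lookup_pexp_image)

lemma xfer_ex: "k \<noteq> i \<Longrightarrow> k \<noteq> j \<Longrightarrow> xfer i j A (ex k + m) = ex k + xfer i j A m"
  by (rule poly_mapping_eqI) (auto simp: lookup_xfer lookup_add)

lemma bop_ex: "k \<noteq> i \<Longrightarrow> k \<noteq> j \<Longrightarrow> bop i j (ex k + m) = mvar k * bop i j m"
  and cop_ex: "k \<noteq> i \<Longrightarrow> k \<noteq> j \<Longrightarrow> cop i j (ex k + m) = mvar k * cop i j m"
  by (simp_all add: bop_def cop_def sum_distrib_left mscale_mult_right mvar_mon lookup_add
      xfer_ex[simplified])

text \<open>Raising the exponent of x_j exchanges the roles of \<open>bop\<close> and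
  \<open>cop\<close>; \<open>cop_ex_left\<close> is the counterpart for x_i. The cyclic shift moves
  position 0 across all others, and these two identities preserve the form of the z operators under
  it.\<close>

lemma bop_ex_right:
  assumes "i \<noteq> j"
  shows "bop i j (ex j + m) = mvar j * cop i j m"
proof -
  have x: "ex j + xfer i j A m = xfer i j A (ex j + m)" if "A \<le> elt m i + elt m j" for A
    using assms that by (intro poly_mapping_eqI) (auto simp: lookup_xfer lookup_add)
  have "bop i j (ex j + m) = (\<Sum>A\<le>Suc (elt m i + elt m j).
     mscale ((of_bool (A \<le> elt m i) - of_bool (A \<le> elt m j)) * ind (int (elt m i) - int A))
       (mon (xfer i j A (ex j + m))))"
    using assms by (simp add: bop_def lookup_add less_Suc_eq_le)
  also have "\<dots> = (\<Sum>A\<le>elt m i + elt m j.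
     mscale ((of_bool (A \<le> elt m i) - of_bool (A \<le> elt m j)) * ind (int (elt m i) - int A))
       (mon (xfer i j A (ex j + m))))"
    by simp
  also have "\<dots> = mvar j * cop i j m"
    unfolding cop_def sum_distrib_left
    by (intro sum.cong refl) (simp add: mscale_mult_right mvar_mon x[simplified])
  finally show ?thesis .
qed

lemma cop_ex_left:
  assumes "i \<noteq> j"
  shows "cop i j (ex i + m) = mvar i * bop i j m"
proof -
  have x: "ex i + xfer i j A m = xfer i j (Suc A) (ex i + m)" for A
    using assms by (intro poly_mapping_eqI) (auto simp: lookup_xfer lookup_add)
  have "cop i j (ex i + m) = (\<Sum>A\<le>Suc (elt m i + elt m j).
     mscale ((of_bool (A \<le> Suc (elt m i)) - of_bool (A \<le> elt m j)) * ind (int (Suc (elt m i)) - int A))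
       (mon (xfer i j A (ex i + m))))"
    using assms by (simp add: cop_def lookup_add)
  also have "\<dots> = (\<Sum>A\<le>elt m i + elt m j.
     mscale ((of_bool (Suc A \<le> Suc (elt m i)) - of_bool (Suc A \<le> elt m j)) * ind (int (Suc (elt m i)) - int (Suc A)))
       (mon (xfer i j (Suc A) (ex i + m))))"
    by (subst sum.atMost_Suc_shift) simp
  also have "\<dots> = mvar i * bop i j m"
    unfolding bop_def sum_distrib_left
    by (intro sum.cong refl) (simp add: mscale_mult_right mvar_mon x[simplified] less_eq_Suc_le)
  finally show ?thesis .
qed

text \<open>For j < i the reflections added in \<open>z_elt\<close> turn the \<open>bop\<close> of
  y_i x_i into a \<open>cop\<close>; for j > i the \<open>bop\<close> stays. This asymmetry is what
  makes the operators triangular.\<close>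

definition zmon :: "nat \<Rightarrow> expo \<Rightarrow> 'a mpol" where
  "zmon i m = mscale (ee (Suc (elt m i))) (mon m)
     - mscale (c0par P) ((\<Sum>j<i. cop i j m) + (\<Sum>j\<in>{i<..<n}. bop i j m))"

definition zop :: "nat \<Rightarrow> 'a mpol \<Rightarrow> 'a mpol" where
  "zop i = lin (zmon i)"

lemma mlin_zop [intro]: "mlin (zop i)"
  and zop_mon [simp]: "zop i (mon m) = zmon i m"
  by (auto simp: zop_def)

lemma ymon_ex: "ymon i (ex i + m) = mscale (ee (Suc (elt m i))) (mon m)
    - mscale (c0par P) (\<Sum>j\<in>{..<n} - {i}. bop i j m)"
proof -
  have "(\<Sum>j\<in>{..<n} - {i}. qop i j (ex i + m)) = (\<Sum>j\<in>{..<n} - {i}. bop i j m)"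
    by (intro sum.cong refl qop_ex) auto
  then show ?thesis by (simp add: ymon_def lookup_add)
qed

lemma sum_split_at:
  fixes f :: "nat \<Rightarrow> 'b::comm_monoid_add"
  assumes "i < n"
  shows "(\<Sum>j\<in>{..<n} - {i}. f j) = (\<Sum>j<i. f j) + (\<Sum>j\<in>{i<..<n}. f j)"
proof -
  have "{..<n} - {i} = {..<i} \<union> {i<..<n}" using assms by auto
  then show ?thesis by (metis sum.union_disjoint finite_lessThan finite_greaterThanLessThan
      disjoint_iff greaterThanLessThan_iff lessThan_iff less_asym)
qed

lemma expos_ex: "i < n \<Longrightarrow> m \<in> expos n \<Longrightarrow> ex i + m \<in> expos n"
  by (auto simp: expos_iff lookup_add)

lemma mvar_polys:
  fixes f :: "'b::field mpol"
  shows "i < n \<Longrightarrow> f \<in> polys n \<Longrightarrow> mvar i * f \<in> polys n"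
  by (rule mlin_polys[OF mlin_mult[OF mlin_ident], where n = n and f = f])
    (auto simp: mvar_mon expos_ex[simplified])

lemma z_elt_act:
  assumes i: "i < n" and f: "f \<in> polys n"
  shows "y_act P i (mvar i * f) + mscale (c0par P) (\<Sum>j<i. \<Sum>l<r. mat_act (refl_mat P i j l) f) = zop i f"
proof -
  have "lin (ymon i) (mvar i * f) + mscale (c0par P) (\<Sum>j<i. \<Sum>l<r. mat_act (refl_mat P i j l) f) = zop i f"
  proof (rule polys_eqI[OF _ mlin_zop _ f])
    show "mlin (\<lambda>f. lin (ymon i) (mvar i * f) + mscale (c0par P) (\<Sum>j<i. \<Sum>l<r. mat_act (refl_mat P i j l) f))"
      by (intro mlin_plus mlin_mscale mlin_summation mlin_mat_act mlin_compose[OF mlin_lin] mlin_mult mlin_ident)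
  next
    fix m assume m: "m \<in> expos n"
    have t: "(\<Sum>l<r. mat_act (refl_mat P i j l) (mon m)) = bop i j m - cop i j m" if "j < i" for j
    proof -
      have "(\<Sum>l<r. mat_act (refl_mat P i j l) (mon m)) =
        (\<Sum>l<r. mscale ((zeta P ^ l) powi (int (elt m i) - int (elt m j))) (mon (pexp (tra i j) m)))"
        using that i m by (intro sum.cong refl mat_act_refl_mon) auto
      then show ?thesis
        by (simp only: bop_minus_cop mpol.scale_sum_left[symmetric] sum_zeta_powers)
    qed
    have t': "(\<Sum>j<i. \<Sum>l<r. mat_act (refl_mat P i j l) (mon m)) = (\<Sum>j<i. bop i j m) - (\<Sum>j<i. cop i j m)"
      unfolding sum_subtractf[symmetric] by (intro sum.cong refl) (simp add: t)
    show "lin (ymon i) (mvar i * mon m) + mscale (c0par P) (\<Sum>j<i. \<Sum>l<r. mat_act (refl_mat P i j l) (mon m)) = zop i (mon m)"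
      unfolding mvar_mon lin_mon ymon_ex t' sum_split_at[OF i] zop_mon zmon_def
      by (simp add: mpol.scale_right_distrib mpol.scale_right_diff_distrib)
  qed
  then show ?thesis by (simp add: y_act_eq[OF i mvar_polys[OF i f]])
qed

lemma pact_zmon_diff: "pact \<sigma> (mscale a (mon m) - mscale c (x + y)) =
    mscale a (mon (pexp \<sigma> m)) - mscale c (pact \<sigma> x + pact \<sigma> y)"
  by (simp add: mlin_diff[OF mlin_pact] mlin_scale[OF mlin_pact] mlin_add[OF mlin_pact])

text \<open>Every j other than 0 stays on its side of i under the cyclic shift. Only j = 0 passes
  from the left of i to the right end, where \<open>bop_ex_right\<close> absorbs the new factor
  x_(n-1).\<close>

lemma zmon_phi:
  assumes i: "0 < i" "i < n"
  shows "zmon (i - 1) (phi n m) = Phi n (zmon i m)"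
proof -
  let ?c = "cyc n" and ?m = "pexp (cyc n) m"
  have ci: "?c i = i - 1" using i by (simp add: cyc_def)
  have e: "elt (phi n m) (i - 1) = elt m i"
    using lookup_pexp_image[OF cyc_permutes, of n m i] i by (simp add: phi_def lookup_add ci)
  have low: "(\<Sum>j<i - 1. cop (i - 1) j (phi n m)) = mvar (n - 1) * pact ?c (\<Sum>j\<in>{0<..<i}. cop i j m)"
  proof -
    have "(\<Sum>j<i - 1. cop (i - 1) j (phi n m)) = (\<Sum>j\<in>{0<..<i}. cop (i - 1) (j - 1) (phi n m))"
      by (rule sum.reindex_bij_witness[where i = "\<lambda>j. j - 1" and j = Suc]) auto
    also have "\<dots> = (\<Sum>j\<in>{0<..<i}. mvar (n - 1) * pact ?c (cop i j m))"
    proof (intro sum.cong refl)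
      fix j assume j: "j \<in> {0<..<i}"
      then have cj: "?c j = j - 1" using i by (simp add: cyc_def)
      have "cop (i - 1) (j - 1) (phi n m) = mvar (n - 1) * cop (i - 1) (j - 1) ?m"
        unfolding phi_def using i j by (intro cop_ex) auto
      then show "cop (i - 1) (j - 1) (phi n m) = mvar (n - 1) * pact ?c (cop i j m)"
        by (simp only: pact_cop[OF cyc_permutes] ci cj)
    qed
    finally show ?thesis by (simp only: mlin_sum[OF mlin_pact] sum_distrib_left)
  qed
  have high: "(\<Sum>j\<in>{i - 1<..<n}. bop (i - 1) j (phi n m)) =
      mvar (n - 1) * pact ?c (cop i 0 m + (\<Sum>j\<in>{i<..<n}. bop i j m))"
  proof -
    have "{i - 1<..<n} = insert (n - 1) {i - 1<..<n - 1}" using i by auto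
    then have "(\<Sum>j\<in>{i - 1<..<n}. bop (i - 1) j (phi n m)) =
        bop (i - 1) (n - 1) (phi n m) + (\<Sum>j\<in>{i - 1<..<n - 1}. bop (i - 1) j (phi n m))"
      by simp
    also have "bop (i - 1) (n - 1) (phi n m) = mvar (n - 1) * cop (i - 1) (n - 1) ?m"
      unfolding phi_def using i by (intro bop_ex_right) auto
    also have "cop (i - 1) (n - 1) ?m = pact ?c (cop i 0 m)"
    proof -
      have "?c 0 = n - 1" using i by (simp add: cyc_def)
      then show ?thesis by (simp only: pact_cop[OF cyc_permutes] ci)
    qed
    also have "(\<Sum>j\<in>{i - 1<..<n - 1}. bop (i - 1) j (phi n m)) = (\<Sum>j\<in>{i<..<n}. bop (i - 1) (j - 1) (phi n m))"
      using i by (intro sum.reindex_bij_witness[where i = "\<lambda>j. j - 1" and j = Suc]) auto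
    also have "\<dots> = (\<Sum>j\<in>{i<..<n}. mvar (n - 1) * pact ?c (bop i j m))"
    proof (intro sum.cong refl)
      fix j assume j: "j \<in> {i<..<n}"
      then have cj: "?c j = j - 1" using i by (simp add: cyc_def)
      have "bop (i - 1) (j - 1) (phi n m) = mvar (n - 1) * bop (i - 1) (j - 1) ?m"
        unfolding phi_def using i j by (intro bop_ex) auto
      then show "bop (i - 1) (j - 1) (phi n m) = mvar (n - 1) * pact ?c (bop i j m)"
        by (simp only: pact_bop[OF cyc_permutes] ci cj)
    qed
    finally show ?thesis
      by (simp only: mlin_sum[OF mlin_pact] mlin_add[OF mlin_pact] sum_distrib_left distrib_left)
  qed
  have sp: "(\<Sum>j<i. cop i j m) = cop i 0 m + (\<Sum>j\<in>{0<..<i}. cop i j m)"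
  proof -
    have "{..<i} = insert 0 {0<..<i}" using i by auto
    then show ?thesis by simp
  qed
  have "Phi n (zmon i m) = mscale (ee (Suc (elt m i))) (mon (phi n m)) -
    mscale (c0par P) (mvar (n - 1) * pact ?c (\<Sum>j<i. cop i j m) + mvar (n - 1) * pact ?c (\<Sum>j\<in>{i<..<n}. bop i j m))"
    unfolding Phi_def zmon_def pact_zmon_diff phi_def
    by (simp add: right_diff_distrib mscale_mult_right mvar_mon distrib_left)
  then show ?thesis
    unfolding zmon_def[of "i - 1"] low high e sp
    by (simp add: mlin_add[OF mlin_pact] distrib_left algebra_simps)
qed

text \<open>All other indices pass from the right of position 0 to the left of position n - 1, so
  each \<open>bop\<close> becomes a \<open>cop\<close> by \<open>cop_ex_left\<close>. The extra
  scalar comes from the exponent being raised by one; it depends on that exponent only modulo r, by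
  \<open>ee_diff_cong\<close>.\<close>

lemma zmon_phi_last:
  "zmon (n - 1) (phi n m) = Phi n (zmon 0 m) + mscale (ee (elt m 0 + 2) - ee (elt m 0 + 1)) (mon (phi n m))"
proof -
  let ?c = "cyc n" and ?m = "pexp (cyc n) m"
  have c0: "?c 0 = n - 1" using n_pos by (simp add: cyc_def)
  have e: "elt (phi n m) (n - 1) = Suc (elt m 0)"
    using lookup_pexp_image[OF cyc_permutes, of n m 0] by (simp add: phi_def lookup_add c0)
  have low: "(\<Sum>j<n - 1. cop (n - 1) j (phi n m)) = mvar (n - 1) * pact ?c (\<Sum>j\<in>{0<..<n}. bop 0 j m)"
  proof -
    have "(\<Sum>j<n - 1. cop (n - 1) j (phi n m)) = (\<Sum>j\<in>{0<..<n}. cop (n - 1) (j - 1) (phi n m))"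
      by (rule sum.reindex_bij_witness[where i = "\<lambda>j. j - 1" and j = Suc]) auto
    also have "\<dots> = (\<Sum>j\<in>{0<..<n}. mvar (n - 1) * pact ?c (bop 0 j m))"
    proof (intro sum.cong refl)
      fix j assume j: "j \<in> {0<..<n}"
      then have cj: "?c j = j - 1" by (simp add: cyc_def)
      have "cop (n - 1) (j - 1) (phi n m) = mvar (n - 1) * bop (n - 1) (j - 1) ?m"
        unfolding phi_def using j by (intro cop_ex_left) auto
      then show "cop (n - 1) (j - 1) (phi n m) = mvar (n - 1) * pact ?c (bop 0 j m)"
        by (simp only: pact_bop[OF cyc_permutes] c0 cj)
    qed
    finally show ?thesis by (simp only: mlin_sum[OF mlin_pact] sum_distrib_left)
  qed
  have emp: "{n - 1<..<n} = {}" by auto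
  have "Phi n (zmon 0 m) = mscale (ee (Suc (elt m 0))) (mon (phi n m)) -
    mscale (c0par P) (mvar (n - 1) * pact ?c (\<Sum>j\<in>{0<..<n}. bop 0 j m))"
    unfolding Phi_def zmon_def pact_zmon_diff phi_def
    by (simp add: right_diff_distrib mscale_mult_right mvar_mon distrib_left mlin_zero[OF mlin_pact])
  then show ?thesis
    unfolding zmon_def[of "n - 1"] low e emp
    by (simp add: mpol.scale_left_diff_distrib)
qed

text \<open>For the last index every other j lies to the left, so z consists of \<open>cop\<close>
  terms, which are x_(n-1) times quotients. Hence xy and z differ by a scalar on each monomial, and
  y can be computed on eigenvectors by cancelling x.\<close>

lemma mvar_ymon_last: "mvar (n - 1) * ymon (n - 1) m =
    zmon (n - 1) m + mscale (ee (elt m (n - 1)) - ee (Suc (elt m (n - 1)))) (mon m)"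
proof -
  have 1: "mscale (ee (elt m (n - 1))) (mvar (n - 1) * mon (m - ex (n - 1))) = mscale (ee (elt m (n - 1))) (mon m)"
  proof (cases "elt m (n - 1) = 0")
    case False
    then have "ex (n - 1) + (m - ex (n - 1)) = m"
      by (intro poly_mapping_eqI) (auto simp: lookup_add lookup_minus)
    then show ?thesis by (simp only: mvar_mon)
  qed simp
  have 2: "mvar (n - 1) * (\<Sum>j\<in>{..<n} - {n - 1}. qop (n - 1) j m) = (\<Sum>j<n - 1. cop (n - 1) j m)"
  proof -
    have "{..<n} - {n - 1} = {..<n - 1}" using n_pos by auto
    then show ?thesis
      unfolding sum_distrib_left by (intro sum.cong mvar_qop) auto
  qed
  have emp: "{n - 1<..<n} = {}" by auto
  show ?thesis
    unfolding ymon_def zmon_def emp right_diff_distrib mscale_mult_right 1 2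
    by (simp add: mpol.scale_left_diff_distrib)
qed

lemma pact_ymon:
  assumes \<sigma>: "\<sigma> permutes {..<n}"
  shows "pact \<sigma> (ymon i m) = ymon (\<sigma> i) (pexp \<sigma> m)"
proof -
  have "(\<Sum>j\<in>{..<n} - {i}. pact \<sigma> (qop i j m)) = (\<Sum>j\<in>{..<n} - {\<sigma> i}. qop (\<sigma> i) j (pexp \<sigma> m))"
    unfolding pact_qop[OF \<sigma>]
    by (rule sum.reindex_bij_witness[where i = "pinv \<sigma>" and j = \<sigma>])
      (auto simp: permutes_inverses[OF \<sigma>] permutes_in_image[OF \<sigma>, unfolded lessThan_iff]
        permutes_in_image[OF permutes_inv[OF \<sigma>], unfolded lessThan_iff] dest: permutes_inj[OF \<sigma>, THEN injD])
  moreover have "pexp \<sigma> (m - ex i) = pexp \<sigma> m - ex (\<sigma> i)"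
    by (rule poly_mapping_eqI) (auto simp: lookup_pexp[OF \<sigma>] lookup_minus permutes_inverses[OF \<sigma>])
  ultimately show ?thesis
    by (simp add: ymon_def mlin_diff[OF mlin_pact] mlin_scale[OF mlin_pact] mlin_sum[OF mlin_pact]
        lookup_pexp_image[OF \<sigma>])
qed

lemma pact_y_act:
  assumes \<sigma>: "\<sigma> permutes {..<n}" and i: "i < n" and f: "f \<in> polys n"
  shows "pact \<sigma> (y_act P i f) = y_act P (\<sigma> i) (pact \<sigma> f)"
proof -
  have "\<sigma> i < n" using permutes_in_image[OF \<sigma>] i by auto
  moreover have "pact \<sigma> (lin (ymon i) f) = lin (ymon (\<sigma> i)) (pact \<sigma> f)"
    by (rule mlin_eqI[OF mlin_compose[OF mlin_pact mlin_lin] mlin_compose[OF mlin_lin mlin_pact]])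
      (simp add: pact_ymon[OF \<sigma>])
  ultimately show ?thesis
    using i f by (simp add: y_act_eq pact_polys[OF \<sigma>])
qed

lemma tra_permutes: "Suc i < n \<Longrightarrow> tra i (Suc i) permutes {..<n}"
  by (rule permutes_swap_id) auto

lemma zmon_transpose_other:
  assumes i: "Suc i < n" and k: "k \<noteq> i" "k \<noteq> Suc i" "k < n"
  shows "zmon k (pexp (tra i (Suc i)) m) = pact (tra i (Suc i)) (zmon k m)"
proof -
  let ?t = "tra i (Suc i)"
  note t = tra_permutes[OF i]
  have tk: "?t k = k" using k by (simp add: transpose_apply_other)
  have 1: "(\<Sum>j<k. cop k j (pexp ?t m)) = (\<Sum>j<k. pact ?t (cop k j m))"
    unfolding pact_cop[OF t] tk
    by (rule sum.reindex_bij_witness[where i = ?t and j = ?t])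
      (use k in \<open>auto simp: Transposition.transpose_def\<close>)
  have 2: "(\<Sum>j\<in>{k<..<n}. bop k j (pexp ?t m)) = (\<Sum>j\<in>{k<..<n}. pact ?t (bop k j m))"
    unfolding pact_bop[OF t] tk
    by (rule sum.reindex_bij_witness[where i = ?t and j = ?t])
      (use k i in \<open>auto simp: Transposition.transpose_def\<close>)
  have e: "elt (pexp ?t m) k = elt m k" using tk by (simp add: lookup_pexp_transpose)
  show ?thesis
    unfolding zmon_def pact_zmon_diff mlin_sum[OF mlin_pact] 1 2 e ..
qed

lemma pexp_tra_tra: "pexp (tra i j) (pexp (tra i j) m) = m"
  by (rule poly_mapping_eqI) (simp add: lookup_pexp_transpose)

text \<open>Only the term joining i and i + 1 changes its type: it is a \<open>bop\<close> in z_i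
  and a \<open>cop\<close> in z_(i+1). The correction is \<open>bop_minus_cop\<close>.\<close>

lemma zmon_transpose_Suc:
  assumes i: "Suc i < n"
  shows "zmon (Suc i) (pexp (tra i (Suc i)) m) = pact (tra i (Suc i)) (zmon i m) +
    mscale (c0par P * ind (int (elt m i) - int (elt m (Suc i)))) (mon m)"
proof -
  let ?t = "tra i (Suc i)"
  note t = tra_permutes[OF i]
  have c: "cop (Suc i) j (pexp ?t m) = pact ?t (cop i j m)" if "j < i" for j
    using pact_cop[OF t, of i j m] that by (simp add: transpose_apply_other)
  have c': "cop (Suc i) i (pexp ?t m) = pact ?t (cop i (Suc i) m)"
    using pact_cop[OF t, of i "Suc i" m] by simp
  have b: "bop (Suc i) j (pexp ?t m) = pact ?t (bop i j m)" if "j \<in> {Suc i<..<n}" for j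
    using pact_bop[OF t, of i j m] that by (simp add: transpose_apply_other)
  have e: "elt (pexp ?t m) (Suc i) = elt m i" by (simp add: lookup_pexp_transpose)
  have d: "{i<..<n} = insert (Suc i) {Suc i<..<n}" using i by auto
  have bc: "pact ?t (bop i (Suc i) m) = pact ?t (cop i (Suc i) m) +
      mscale (ind (int (elt m i) - int (elt m (Suc i)))) (mon m)"
    using arg_cong[OF bop_minus_cop[of i "Suc i" m], of "pact ?t"]
    by (simp add: mlin_diff[OF mlin_pact] mlin_scale[OF mlin_pact] pexp_tra_tra algebra_simps)
  show ?thesis
    unfolding zmon_def pact_zmon_diff mlin_sum[OF mlin_pact] d
    by (simp add: c c' b e bc lessThan_Suc mpol.scale_right_distrib algebra_simps)
qed

lemma zmon_transpose:
  assumes i: "Suc i < n"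
  shows "zmon i (pexp (tra i (Suc i)) m) = pact (tra i (Suc i)) (zmon (Suc i) m) -
    mscale (c0par P * ind (int (elt m (Suc i)) - int (elt m i))) (mon m)"
proof -
  let ?t = "tra i (Suc i)"
  note t = tra_permutes[OF i]
  have c: "cop i j (pexp ?t m) = pact ?t (cop (Suc i) j m)" if "j < i" for j
    using pact_cop[OF t, of "Suc i" j m] that by (simp add: transpose_apply_other)
  have b': "bop i (Suc i) (pexp ?t m) = pact ?t (bop (Suc i) i m)"
    using pact_bop[OF t, of "Suc i" i m] by simp
  have b: "bop i j (pexp ?t m) = pact ?t (bop (Suc i) j m)" if "j \<in> {Suc i<..<n}" for j
    using pact_bop[OF t, of "Suc i" j m] that by (simp add: transpose_apply_other)
  have e: "elt (pexp ?t m) i = elt m (Suc i)" by (simp add: lookup_pexp_transpose)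
  have d: "{i<..<n} = insert (Suc i) {Suc i<..<n}" using i by auto
  have bc: "pact ?t (bop (Suc i) i m) = pact ?t (cop (Suc i) i m) +
      mscale (ind (int (elt m (Suc i)) - int (elt m i))) (mon m)"
    using arg_cong[OF bop_minus_cop[of "Suc i" i m], of "pact ?t"]
    by (simp add: mlin_diff[OF mlin_pact] mlin_scale[OF mlin_pact] pexp_tra_tra
        transpose_commute[of "Suc i" i] algebra_simps)
  show ?thesis
    unfolding zmon_def pact_zmon_diff mlin_sum[OF mlin_pact] d
    by (simp add: c b' b e bc lessThan_Suc mpol.scale_right_distrib algebra_simps)
qed

end

section \<open>Triangularity and eigenvectors\<close>

text \<open>Parts equal to the moved one ranked below it because they stood further right; after it
  has gained one they rank below it because they are smaller. So all ranks are preserved.\<close>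

lemma rk_phi:
  assumes "i < n"
  shows "rk n (phi n \<mu>) (cyc n i) = rk n \<mu> i"
proof (rule rk_eq_if_before_iff[OF cyc_permutes])
  fix a assume "a < n"
  then show "expo_before (phi n \<mu>) (cyc n a) (cyc n i) \<longleftrightarrow> expo_before \<mu> a i"
    using assms unfolding expo_before_def lookup_phi_cyc[OF \<open>a < n\<close>] lookup_phi_cyc[OF assms]
    by (auto simp: cyc_def)
qed

lemma expos_phi: "n \<ge> 1 \<Longrightarrow> phi n \<mu> \<in> expos n \<longleftrightarrow> \<mu> \<in> expos n"
proof -
  assume "n \<ge> 1"
  then have "elt (phi n \<mu>) i = elt (pexp (cyc n) \<mu>) i" if "i \<ge> n" for i
    using that by (simp add: phi_def lookup_add)
  then have "phi n \<mu> \<in> expos n \<longleftrightarrow> pexp (cyc n) \<mu> \<in> expos n" by (simp add: expos_iff)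
  then show ?thesis by (simp add: pexp_expos[OF cyc_permutes])
qed

lemma keys_Phi: "Poly_Mapping.keys (Phi n f) \<subseteq> phi n ` Poly_Mapping.keys (f :: 'b::field mpol)"
proof
  fix m assume m: "m \<in> Poly_Mapping.keys (Phi n f)"
  have "Phi n f = lin (\<lambda>m. mon (phi n m)) f"
    by (rule mlin_eqI[OF mlin_Phi mlin_lin]) (simp add: Phi_mon)
  then have "co (Phi n f) m = (\<Sum>k\<in>Poly_Mapping.keys f. co f k * co (mon (phi n k)) m)"
    by (simp add: lin_def lookup_sum)
  moreover have "co (Phi n f) m \<noteq> 0" using m by (simp add: in_keys_iff)
  ultimately obtain k where "k \<in> Poly_Mapping.keys f" "co (mon (phi n k) :: 'b mpol) m \<noteq> 0"
    by (metis (no_types, lifting) mult_zero_right sum.neutral)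
  then show "m \<in> phi n ` Poly_Mapping.keys f"
    by (auto simp: lookup_single when_def split: if_splits)
qed

definition edeg :: "nat \<Rightarrow> expo \<Rightarrow> nat" where
  "edeg n m = (\<Sum>i<n. elt m i)"

lemma edeg_pexp:
  assumes \<sigma>: "\<sigma> permutes {..<n}"
  shows "edeg n (pexp \<sigma> m) = edeg n m"
proof -
  have "edeg n (pexp \<sigma> m) = (\<Sum>i<n. elt (pexp \<sigma> m) (\<sigma> i))"
    unfolding edeg_def using sum.permute[OF \<sigma>, of "elt (pexp \<sigma> m)"] by (simp add: comp_def)
  then show ?thesis by (simp add: lookup_pexp_image[OF \<sigma>] edeg_def)
qed

lemma edeg_phi:
  assumes "n \<ge> 1"
  shows "edeg n (phi n m) = Suc (edeg n m)"
proof -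
  have "edeg n (phi n m) = (\<Sum>i<n. elt (ex (n - 1)) i) + edeg n (pexp (cyc n) m)"
    unfolding edeg_def phi_def by (simp add: lookup_add sum.distrib)
  also have "(\<Sum>i<n. elt (ex (n - 1)) i) = 1" using assms by (simp add: sum.delta)
  finally show ?thesis by (simp add: edeg_pexp[OF cyc_permutes])
qed

lemma phi_surj:
  assumes "n \<ge> 1" "elt \<mu> (n - 1) > 0" "\<mu> \<in> expos n"
  obtains \<nu> where "\<nu> \<in> expos n" "phi n \<nu> = \<mu>"
proof
  let ?\<nu> = "pexp (pinv (cyc n)) (\<mu> - ex (n - 1))"
  show *: "phi n ?\<nu> = \<mu>"
    unfolding phi_def pexp_inv(2)[OF cyc_permutes]
    using assms by (intro poly_mapping_eqI) (auto simp: lookup_add lookup_minus)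
  have "phi n ?\<nu> \<in> expos n" unfolding * by (rule assms)
  then show "?\<nu> \<in> expos n" by (simp only: expos_phi[OF assms(1)])
qed

text \<open>If the last part is positive, \<open>phi\<close> can be undone and the degree drops;
  otherwise the last nonzero part is exchanged with the 0 to its right, which lowers the second
  measure. Hence \<open>swap\<close> is only needed from an increasing to a decreasing pair, the
  direction in which eigenvectors are produced.\<close>

lemma expo_induct [consumes 2, case_names zero phi swap]:
  assumes "\<mu> \<in> expos n" and n: "n \<ge> 1"
    and zero: "Q 0" and phi: "\<And>\<mu>. \<mu> \<in> expos n \<Longrightarrow> Q \<mu> \<Longrightarrow> Q (phi n \<mu>)"
    and swap: "\<And>\<mu> i. \<mu> \<in> expos n \<Longrightarrow> Suc i < n \<Longrightarrow> elt \<mu> i < elt \<mu> (Suc i) \<Longrightarrow> Q \<mu> \<Longrightarrow>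
      Q (pexp (tra i (Suc i)) \<mu>)"
  shows "Q \<mu>"
  using assms(1)
proof (induction \<mu> rule: wf_induct_rule[OF wf_measures[of "[edeg n, \<lambda>\<mu>. \<Sum>i<n. (n - i) * elt \<mu> i]"]])
  case (1 \<mu>)
  show ?case
  proof (cases "\<mu> = 0")
    case True
    then show ?thesis using zero by simp
  next
    case False
    then have ne: "Poly_Mapping.keys \<mu> \<noteq> {}" by simp
    define i where "i = Max (Poly_Mapping.keys \<mu>)"
    have iK: "i \<in> Poly_Mapping.keys \<mu>" using ne by (simp add: i_def)
    have max: "elt \<mu> j = 0" if "j > i" for j
    proof (rule ccontr)
      assume "elt \<mu> j \<noteq> 0"
      then have "j \<le> i" unfolding i_def by (intro Max_ge) (simp_all add: in_keys_iff)
      then show False using that by simp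
    qed
    have i: "i < n" using iK 1 by (auto simp: expos_def)
    have ipos: "elt \<mu> i > 0" using iK by (simp add: in_keys_iff)
    show ?thesis
    proof (cases "i = n - 1")
      case True
      then obtain \<nu> where \<nu>: "\<nu> \<in> expos n" "phi n \<nu> = \<mu>"
        using phi_surj[OF n _ 1(2)] ipos by auto
      have "Q \<nu>" using \<nu> edeg_phi[OF n, of \<nu>] by (intro 1) auto
      then show ?thesis using phi \<nu> by blast
    next
      case False
      then have i': "Suc i < n" using i by simp
      let ?t = "tra i (Suc i)"
      have t: "?t permutes {..<n}" using i' by (intro permutes_swap_id) auto
      let ?\<nu> = "pexp ?t \<mu>"
      have \<nu>: "?\<nu> \<in> expos n" using 1(2) pexp_expos[OF t] by simp
      have "(\<Sum>j<n. (n - j) * elt ?\<nu> j) < (\<Sum>j<n. (n - j) * elt \<mu> j)"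
      proof -
        have "(\<Sum>j<n. (n - j) * elt ?\<nu> j) = (\<Sum>j<n. (n - ?t j) * elt ?\<nu> (?t j))"
          using sum.permute[OF t, of "\<lambda>j. (n - j) * elt ?\<nu> j"] by (simp add: comp_def)
        also have "\<dots> = (\<Sum>j<n. (n - ?t j) * elt \<mu> j)" by (simp add: lookup_pexp_transpose)
        also have "\<dots> < (\<Sum>j<n. (n - j) * elt \<mu> j)"
        proof (rule sum_strict_mono_ex1)
          show "\<forall>j\<in>{..<n}. (n - ?t j) * elt \<mu> j \<le> (n - j) * elt \<mu> j"
            using max by (auto simp: Transposition.transpose_def)
          show "\<exists>j\<in>{..<n}. (n - ?t j) * elt \<mu> j < (n - j) * elt \<mu> j"
            using i' ipos by (intro bexI[of _ i]) (auto simp: Transposition.transpose_def)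
        qed simp
        finally show ?thesis .
      qed
      then have "Q ?\<nu>" using \<nu> by (intro 1) (auto simp: edeg_pexp[OF t])
      moreover have "elt ?\<nu> i < elt ?\<nu> (Suc i)"
        using ipos max by (simp add: lookup_pexp_transpose)
      ultimately have "Q (pexp ?t ?\<nu>)" using swap \<nu> i' by blast
      moreover have "pexp ?t ?\<nu> = \<mu>"
        by (rule poly_mapping_eqI) (simp add: lookup_pexp_transpose)
      ultimately show ?thesis by simp
    qed
  qed
qed

section \<open>Triangularity of the z operators and their diagonal entries\<close>

lemma of_nat_card_eq_sum:
  fixes n :: nat
  shows "of_nat (card {j. j < n \<and> Q j}) = (\<Sum>j<n. of_bool (Q j) :: 'b::semiring_1)"
proof -
  have "{j. j < n \<and> Q j} = {j \<in> {..<n}. Q j}" by auto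
  then have "of_nat (card {j. j < n \<and> Q j}) = (\<Sum>j\<in>{j \<in> {..<n}. Q j}. 1 :: 'b)" by simp
  also have "\<dots> = (\<Sum>j<n. of_bool (Q j))"
    unfolding of_bool_def by (rule sum.inter_filter) simp
  finally show ?thesis .
qed

context chered
begin

definition wt :: "expo \<Rightarrow> nat \<Rightarrow> 'a" where
  "wt \<mu> i = ee (Suc (elt \<mu> i)) - of_nat r * c0par P * of_nat (rk n \<mu> i)"

lemma key_of_sum:
  assumes "\<nu> \<in> Poly_Mapping.keys (\<Sum>A\<in>S. mscale (c A) (mon (X A)) :: 'a mpol)"
  obtains A where "A \<in> S" "c A \<noteq> 0" "\<nu> = X A"
proof -
  have "co (\<Sum>A\<in>S. mscale (c A) (mon (X A))) \<nu> \<noteq> 0" using assms by (simp add: in_keys_iff)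
  then obtain A where "A \<in> S" "c A * co (mon (X A)) \<nu> \<noteq> 0"
    unfolding lookup_sum lookup_mscale by (meson sum.neutral)
  then show ?thesis using that by (auto simp: lookup_single when_def split: if_splits)
qed

text \<open>The coefficient is nonzero only for A from one part to the other. The end points give m
  itself or, if the larger part stands at i, the swapped exponent, which is smaller in Bruhat order;
  interior values give strictly dominated rearrangements.\<close>

lemma keys_bop:
  assumes "i < j" "j < n" "\<nu> \<in> Poly_Mapping.keys (bop i j m)"
  shows "\<nu> = m \<or> expo_less n \<nu> m"
proof -
  obtain A where "(of_bool (A \<le> elt m i) - of_bool (A < elt m j)) * ind (int (elt m i) - int A) \<noteq> 0"
    and \<nu>: "\<nu> = xfer i j A m"
    using assms(3) unfolding bop_def by (rule key_of_sum)
  then have "(A \<le> elt m i) \<noteq> (A < elt m j)" by auto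
  then consider "A = elt m i" | "A = elt m j" "elt m j < elt m i"
    | "min (elt m i) (elt m j) < A" "A < max (elt m i) (elt m j)" by linarith
  then show ?thesis
    using assms \<nu> expo_less_swap[of i j n m] expo_less_xfer[of i j n m A] xfer_same[of i j m] xfer_swap[of i j m]
    by cases auto
qed

lemma keys_cop:
  assumes "j < i" "i < n" "\<nu> \<in> Poly_Mapping.keys (cop i j m)"
  shows "\<nu> = m \<or> expo_less n \<nu> m"
proof -
  obtain A where "(of_bool (A \<le> elt m i) - of_bool (A \<le> elt m j)) * ind (int (elt m i) - int A) \<noteq> 0"
    and \<nu>: "\<nu> = xfer i j A m"
    using assms(3) unfolding cop_def by (rule key_of_sum)
  then have "(A \<le> elt m i) \<noteq> (A \<le> elt m j)" by auto
  then consider "A = elt m i" | "A = elt m j" "elt m i < elt m j"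
    | "min (elt m i) (elt m j) < A" "A < max (elt m i) (elt m j)" by linarith
  then show ?thesis
    using assms \<nu> expo_less_swap[of j i n m] expo_less_xfer[of i j n m A] xfer_same[of i j m] xfer_swap[of i j m]
    by cases (auto simp: transpose_commute)
qed

lemma xfer_eq_same: "i \<noteq> j \<Longrightarrow> A \<le> elt m i + elt m j \<Longrightarrow> xfer i j A m = m \<longleftrightarrow> A = elt m i"
  using lookup_xfer[of i j A m i] xfer_same[of i j m] by auto

lemma co_bop_same: "i \<noteq> j \<Longrightarrow> co (bop i j m) m = of_nat r * of_bool (elt m j \<le> elt m i)"
proof -
  assume ij: "i \<noteq> j"
  have "co (bop i j m) m = (\<Sum>A\<le>elt m i + elt m j. if A = elt m i then
      (1 - of_bool (elt m i < elt m j)) * of_nat r else 0)"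
    unfolding bop_def lookup_sum lookup_mscale
    by (intro sum.cong refl) (auto simp: lookup_single when_def xfer_eq_same[OF ij] ind_def)
  then show ?thesis by (auto simp: sum.delta)
qed

lemma co_cop_same: "i \<noteq> j \<Longrightarrow> co (cop i j m) m = of_nat r * of_bool (elt m j < elt m i)"
proof -
  assume ij: "i \<noteq> j"
  have "co (cop i j m) m = (\<Sum>A\<le>elt m i + elt m j. if A = elt m i then
      (1 - of_bool (elt m i \<le> elt m j)) * of_nat r else 0)"
    unfolding cop_def lookup_sum lookup_mscale
    by (intro sum.cong refl) (auto simp: lookup_single when_def xfer_eq_same[OF ij] ind_def)
  then show ?thesis by (auto simp: sum.delta)
qed

lemma keys_zmon:
  assumes i: "i < n" and \<nu>: "\<nu> \<in> Poly_Mapping.keys (zmon i m)"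
  shows "\<nu> = m \<or> expo_less n \<nu> m"
proof (rule ccontr)
  assume neg: "\<not> ?thesis"
  then have "m \<noteq> \<nu>" by auto
  have b: "co (bop i j m) \<nu> = 0" if "j \<in> {i<..<n}" for j
    using keys_bop[of i j \<nu> m] neg that by (auto simp: in_keys_iff)
  have c: "co (cop i j m) \<nu> = 0" if "j < i" for j
    using keys_cop[of j i \<nu> m] neg that i by (auto simp: in_keys_iff)
  have "co (zmon i m) \<nu> = 0"
    using \<open>m \<noteq> \<nu>\<close> unfolding zmon_def lookup_minus lookup_mscale lookup_add lookup_sum
    by (simp add: b c lookup_single when_def)
  then show False using \<nu> by (simp add: in_keys_iff)
qed

text \<open>The diagonal terms of \<open>cop\<close> count the strictly smaller parts to the left,
  those of \<open>bop\<close> the smaller or equal parts to the right. Together this is the rank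
  with its tie-breaking.\<close>

lemma co_zmon_same:
  assumes i: "i < n"
  shows "co (zmon i m) m = wt m i"
proof -
  have "(of_nat (rk n m i) :: 'a) = (\<Sum>j<n. of_bool (expo_before m j i))"
    unfolding rk_def by (rule of_nat_card_eq_sum)
  also have "\<dots> = (\<Sum>j\<in>{..<n} - {i}. of_bool (expo_before m j i))"
    by (rule sum.mono_neutral_right) (auto simp: expo_before_irrefl)
  also have "\<dots> = (\<Sum>j<i. of_bool (elt m j < elt m i)) + (\<Sum>j\<in>{i<..<n}. of_bool (elt m j \<le> elt m i))"
    unfolding sum_split_at[OF i]
    by (intro arg_cong2[of _ _ _ _ "(+)"] sum.cong) (auto simp: expo_before_def)
  finally have rk: "(of_nat (rk n m i) :: 'a) = \<dots>" .
  show ?thesis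
    unfolding zmon_def wt_def lookup_minus lookup_mscale lookup_add lookup_sum rk
    by (simp add: co_bop_same co_cop_same sum_distrib_left[symmetric] distrib_left[symmetric])
qed

definition zeig :: "expo \<Rightarrow> 'a mpol \<Rightarrow> bool" where
  "zeig \<mu> f \<longleftrightarrow> (\<forall>i<n. zop i f = mscale (wt \<mu> i) f)"

text \<open>No other key of f contributes to the coefficient at a maximal one, so only the diagonal
  entry is seen there.\<close>

lemma eigenvalue_at_maximal:
  assumes z: "zop i f = mscale e f" and i: "i < n" and \<nu>: "\<nu> \<in> Poly_Mapping.keys f"
    and max: "\<And>\<rho>. \<rho> \<in> Poly_Mapping.keys f \<Longrightarrow> \<not> expo_less n \<nu> \<rho>"
  shows "e = wt \<nu> i"
proof -
  have "co (zop i f) \<nu> = (\<Sum>m\<in>Poly_Mapping.keys f. co f m * co (zmon i m) \<nu>)"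
    by (simp add: zop_def lin_def lookup_sum)
  also have "\<dots> = (\<Sum>m\<in>Poly_Mapping.keys f. if m = \<nu> then co f \<nu> * wt \<nu> i else 0)"
  proof (intro sum.cong refl)
    fix m assume "m \<in> Poly_Mapping.keys f"
    then show "co f m * co (zmon i m) \<nu> = (if m = \<nu> then co f \<nu> * wt \<nu> i else 0)"
      using max[of m] keys_zmon[OF i, of \<nu> m] co_zmon_same[OF i] by (auto simp: in_keys_iff)
  qed
  finally have "e * co f \<nu> = co f \<nu> * wt \<nu> i" using \<nu> by (simp add: z sum.delta)
  then show ?thesis using \<nu> by (simp add: in_keys_iff mult.commute)
qed

lemma exists_maximal_key:
  assumes "\<mu> \<in> Poly_Mapping.keys f"
  obtains \<nu> where "\<nu> \<in> Poly_Mapping.keys f" "\<And>\<rho>. \<rho> \<in> Poly_Mapping.keys f \<Longrightarrow> \<not> expo_less n \<nu> \<rho>"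
    "\<nu> = \<mu> \<or> expo_less n \<mu> \<nu>"
proof -
  let ?K = "{\<nu> \<in> Poly_Mapping.keys f. \<nu> = \<mu> \<or> expo_less n \<mu> \<nu>}"
  have fin: "finite (expo_height n ` ?K)" and ne: "expo_height n ` ?K \<noteq> {}" using assms by auto
  obtain \<nu> where \<nu>: "\<nu> \<in> ?K" "expo_height n \<nu> = Max (expo_height n ` ?K)"
    using Max_in[OF fin ne] by (metis (no_types, lifting) imageE)
  have "\<not> expo_less n \<nu> \<rho>" if \<rho>: "\<rho> \<in> Poly_Mapping.keys f" for \<rho>
  proof
    assume less: "expo_less n \<nu> \<rho>"
    then have "expo_less n \<mu> \<rho>" using \<nu> expo_less_trans by blast
    then have "expo_height n \<rho> \<le> expo_height n \<nu>" using \<rho> \<nu>(2) Max_ge[OF fin] by auto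
    then show False using expo_less_height[OF less] by simp
  qed
  then show ?thesis using that \<nu> by blast
qed

text \<open>For polynomials in n variables this says that all diagonal matrices of r-th roots of
  unity act on f by the same character as on the monomial with exponent \<mu>. On such f the
  exponent-dependent scalars of the intertwining relations become constants.\<close>

definition cong_to :: "expo \<Rightarrow> 'a mpol \<Rightarrow> bool" where
  "cong_to \<mu> f \<longleftrightarrow> (\<forall>m\<in>Poly_Mapping.keys f. \<forall>i. int r dvd int (elt m i) - int (elt \<mu> i))"

lemma dpar_cong:
  assumes "int r dvd j - j'"
  shows "dpar P j = dpar P j'"
proof -
  have "zeta P powi (int l * j) = zeta P powi (int l * j')" for l
  proof -
    have "int r dvd int l * j - int l * j'" using assms by (simp flip: right_diff_distrib)
    then have "(int l * j) mod int r = (int l * j') mod int r" by (simp add: mod_eq_dvd_iff)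
    then show ?thesis unfolding zeta_powi_mod by simp
  qed
  then show ?thesis unfolding dpar_def by simp
qed

lemma ee_diff_cong:
  assumes "int r dvd int a - int b"
  shows "ee (Suc a) - ee a = ee (Suc b) - ee b"
proof -
  have "int r dvd int b - int a" using assms by (simp add: dvd_diff_commute)
  then have "dpar P (- int a) = dpar P (- int b)" "dpar P (- int (Suc a)) = dpar P (- int (Suc b))"
    by (auto intro!: dpar_cong)
  then show ?thesis by (simp add: ee_def algebra_simps)
qed

lemma wt_phi: "0 < i \<Longrightarrow> i < n \<Longrightarrow> wt (phi n \<mu>) (i - 1) = wt \<mu> i"
  and wt_phi_last: "wt (phi n \<mu>) (n - 1) = wt \<mu> 0 + (ee (elt \<mu> 0 + 2) - ee (elt \<mu> 0 + 1))"
  using rk_phi[of i n \<mu>] rk_phi[of 0 n \<mu>] lookup_phi_cyc[of i n \<mu>] lookup_phi_cyc[of 0 n \<mu>] n_pos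
  by (auto simp: wt_def cyc_def)

lemma zeig_Phi:
  assumes f: "cong_to \<mu> f" "zeig \<mu> f"
  shows "zeig (phi n \<mu>) (Phi n f)"
  unfolding zeig_def
proof (intro allI impI)
  fix k assume k: "k < n"
  show "zop k (Phi n f) = mscale (wt (phi n \<mu>) k) (Phi n f)"
  proof (cases "k = n - 1")
    case True
    let ?d = "ee (elt \<mu> 0 + 2) - ee (elt \<mu> 0 + 1)"
    have "zop (n - 1) (Phi n f) = Phi n (zop 0 f) + mscale ?d (Phi n f)"
    proof (rule mlin_eqI[OF mlin_compose[OF mlin_zop mlin_Phi]
          mlin_plus[OF mlin_compose[OF mlin_Phi mlin_zop] mlin_mscale[OF mlin_Phi]]])
      fix m assume "m \<in> Poly_Mapping.keys f"
      then have "int r dvd int (Suc (elt m 0)) - int (Suc (elt \<mu> 0))"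
        using f(1) by (simp add: cong_to_def)
      then have "ee (elt m 0 + 2) - ee (elt m 0 + 1) = ?d" using ee_diff_cong by fastforce
      then show "zop (n - 1) (Phi n (mon m)) = Phi n (zop 0 (mon m)) + mscale ?d (Phi n (mon m))"
        by (simp only: Phi_mon zop_mon zmon_phi_last)
    qed
    also have "\<dots> = mscale (wt (phi n \<mu>) (n - 1)) (Phi n f)"
      unfolding wt_phi_last mpol.scale_left_distrib
      using f(2) n_pos by (simp add: zeig_def mlin_scale[OF mlin_Phi])
    finally show ?thesis using True by simp
  next
    case False
    then have k': "Suc k < n" using k by simp
    have "zop k (Phi n f) = Phi n (zop (Suc k) f)"
      by (rule mlin_eqI[OF mlin_compose[OF mlin_zop mlin_Phi] mlin_compose[OF mlin_Phi mlin_zop]])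
        (use zmon_phi[of "Suc k"] k' in \<open>simp add: Phi_mon\<close>)
    also have "\<dots> = mscale (wt (phi n \<mu>) k) (Phi n f)"
      using f(2) k' wt_phi[of "Suc k" \<mu>] by (simp add: zeig_def mlin_scale[OF mlin_Phi])
    finally show ?thesis .
  qed
qed

lemma cong_to_Phi:
  assumes "cong_to \<mu> f"
  shows "cong_to (phi n \<mu>) (Phi n f)"
proof -
  have "int r dvd int (elt (phi n m) i) - int (elt (phi n \<mu>) i)" if "m \<in> Poly_Mapping.keys f" for m i
    using assms that by (simp add: cong_to_def phi_def lookup_add lookup_pexp[OF cyc_permutes])
  then show ?thesis unfolding cong_to_def using keys_Phi[of n f] by blast
qed

lemma ind_cong: "int r dvd k - k' \<Longrightarrow> ind k = ind k'"
  unfolding ind_def using dvd_add_right_iff[of "int r" "k - k'" k'] by simp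

lemma ind_minus: "ind (- k) = ind k"
  by (simp add: ind_def)

definition cind :: "expo \<Rightarrow> nat \<Rightarrow> 'a" where
  "cind \<mu> i = c0par P * ind (int (elt \<mu> i) - int (elt \<mu> (Suc i)))"

lemma ind_cong_to:
  assumes "cong_to \<mu> f" "m \<in> Poly_Mapping.keys f"
  shows "ind (int (elt m i) - int (elt m j)) = ind (int (elt \<mu> i) - int (elt \<mu> j))"
proof (rule ind_cong)
  have "int r dvd (int (elt m i) - int (elt \<mu> i)) - (int (elt m j) - int (elt \<mu> j))"
    using assms unfolding cong_to_def by (meson dvd_diff)
  then show "int r dvd (int (elt m i) - int (elt m j)) - (int (elt \<mu> i) - int (elt \<mu> j))"
    by (simp add: algebra_simps)
qed

lemma zop_transpose_Suc:
  assumes "Suc i < n" "cong_to \<mu> f"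
  shows "zop (Suc i) (pact (tra i (Suc i)) f) = pact (tra i (Suc i)) (zop i f) + mscale (cind \<mu> i) f"
  by (rule mlin_eqI[OF mlin_compose[OF mlin_zop mlin_pact]
        mlin_plus[OF mlin_compose[OF mlin_pact mlin_zop] mlin_mscale[OF mlin_ident]]])
    (simp add: zmon_transpose_Suc[OF assms(1)] ind_cong_to[OF assms(2)] cind_def)

lemma zop_transpose:
  assumes "Suc i < n" "cong_to \<mu> f"
  shows "zop i (pact (tra i (Suc i)) f) = pact (tra i (Suc i)) (zop (Suc i) f) - mscale (cind \<mu> i) f"
  by (rule mlin_eqI[OF mlin_compose[OF mlin_zop mlin_pact]
        mlin_minus[OF mlin_compose[OF mlin_pact mlin_zop] mlin_mscale[OF mlin_ident]]])
    (simp add: zmon_transpose[OF assms(1)] ind_cong_to[OF assms(2)] cind_def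
      ind_minus[of "int (elt \<mu> i) - int (elt \<mu> (Suc i))", simplified])

lemma zop_transpose_other:
  assumes "Suc i < n" "k \<noteq> i" "k \<noteq> Suc i" "k < n"
  shows "zop k (pact (tra i (Suc i)) f) = pact (tra i (Suc i)) (zop k f)"
  by (rule mlin_eqI[OF mlin_compose[OF mlin_zop mlin_pact] mlin_compose[OF mlin_pact mlin_zop]])
    (simp add: zmon_transpose_other[OF assms])

lemma wt_transpose:
  assumes "Suc i < n" "elt \<mu> i \<noteq> elt \<mu> (Suc i)"
  shows "wt (pexp (tra i (Suc i)) \<mu>) (tra i (Suc i) k) = wt \<mu> k"
  using rk_pexp_transpose[of i "Suc i" n \<mu> k] assms
  by (simp add: wt_def lookup_pexp_transpose)

text \<open>Chosen so that its product with the difference of the weights cancels the constant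
  \<open>cind \<mu> i\<close> in \<open>zop_transpose\<close> and \<open>zop_transpose_Suc\<close>.
  For parts incongruent modulo r the numerator is 0 and the bare swap already intertwines.\<close>

definition tcoef :: "expo \<Rightarrow> nat \<Rightarrow> 'a" where
  "tcoef \<mu> i = cind \<mu> i / (wt \<mu> i - wt \<mu> (Suc i))"

lemma zeig_swap:
  assumes i: "Suc i < n" "elt \<mu> i \<noteq> elt \<mu> (Suc i)" and f: "cong_to \<mu> f" "zeig \<mu> f"
    and ne: "int r dvd int (elt \<mu> i) - int (elt \<mu> (Suc i)) \<Longrightarrow> wt \<mu> i \<noteq> wt \<mu> (Suc i)"
  shows "zeig (pexp (tra i (Suc i)) \<mu>) (pact (tra i (Suc i)) f + mscale (tcoef \<mu> i) f)"
  unfolding zeig_def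
proof (intro allI impI)
  fix k assume k: "k < n"
  let ?t = "tra i (Suc i)" and ?c = "tcoef \<mu> i"
  \<comment> \<open>If the weights coincide, \<open>ne\<close> makes the parts incongruent modulo r,
    so \<open>cind\<close> is 0, and \<open>tcoef\<close> is 0 / 0 = 0.\<close>
  have c: "?c * wt \<mu> i = ?c * wt \<mu> (Suc i) + cind \<mu> i"
    using ne by (cases "wt \<mu> i = wt \<mu> (Suc i)")
      (auto simp: tcoef_def cind_def ind_def field_simps)
  have z: "zop j f = mscale (wt \<mu> j) f" if "j < n" for j using f that by (simp add: zeig_def)
  consider "k = i" | "k = Suc i" | "k \<noteq> i" "k \<noteq> Suc i" by blast
  then show "zop k (pact ?t f + mscale ?c f) = mscale (wt (pexp ?t \<mu>) k) (pact ?t f + mscale ?c f)"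
  proof cases
    case 1
    have "mscale (?c * wt \<mu> i) f = mscale (?c * wt \<mu> (Suc i)) f + mscale (cind \<mu> i) f"
      by (simp only: c mpol.scale_left_distrib)
    then show ?thesis
      using 1 i k wt_transpose[OF i, of "Suc i"]
      by (simp add: mlin_add[OF mlin_zop] mlin_scale[OF mlin_zop] zop_transpose[OF i(1) f(1)] z
          mlin_scale[OF mlin_pact] mpol.scale_right_distrib mult.commute)
  next
    case 2
    have "mscale (?c * wt \<mu> i) f = mscale (?c * wt \<mu> (Suc i)) f + mscale (cind \<mu> i) f"
      by (simp only: c mpol.scale_left_distrib)
    then show ?thesis
      using 2 i k wt_transpose[OF i, of i]
      by (simp add: mlin_add[OF mlin_zop] mlin_scale[OF mlin_zop] zop_transpose_Suc[OF i(1) f(1)] z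
          mlin_scale[OF mlin_pact] mpol.scale_right_distrib mult.commute)
  next
    case 3
    then show ?thesis
      using i k wt_transpose[OF i, of k]
      by (simp add: mlin_add[OF mlin_zop] mlin_scale[OF mlin_zop] zop_transpose_other z
          mlin_scale[OF mlin_pact] mpol.scale_right_distrib mult.commute transpose_apply_other)
  qed
qed

lemma cong_to_swap:
  assumes "cong_to \<mu> f"
  shows "cong_to (pexp (tra i (Suc i)) \<mu>) (pact (tra i (Suc i)) f + mscale (tcoef \<mu> i) f)"
  unfolding cong_to_def
proof (intro ballI allI)
  fix m k assume m: "m \<in> Poly_Mapping.keys (pact (tra i (Suc i)) f + mscale (tcoef \<mu> i) f)"
  let ?t = "tra i (Suc i)"
  have t: "?t permutes UNIV" by (rule permutes_swap_id) auto
  have "m \<in> Poly_Mapping.keys (pact ?t f) \<or> m \<in> Poly_Mapping.keys (mscale (tcoef \<mu> i) f)"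
    using m keys_add[of "pact ?t f" "mscale (tcoef \<mu> i) f"] by blast
  then consider m' where "m = pexp ?t m'" "m' \<in> Poly_Mapping.keys f"
    | "m \<in> Poly_Mapping.keys f" "tcoef \<mu> i \<noteq> 0"
    unfolding keys_pact[OF t] by (auto simp: in_keys_iff)
  then show "int r dvd int (elt m k) - int (elt (pexp ?t \<mu>) k)"
  proof cases
    case 1
    then show ?thesis using assms by (simp add: cong_to_def lookup_pexp_transpose)
  next
    case 2
    then have d: "int r dvd int (elt \<mu> i) - int (elt \<mu> (Suc i))"
      by (auto simp: tcoef_def cind_def ind_def split: if_splits)
    have "int r dvd int (elt \<mu> k) - int (elt \<mu> (?t k))"
      using d by (auto simp: Transposition.transpose_def dvd_diff_commute)
    moreover have "int r dvd int (elt m k) - int (elt \<mu> k)" using assms 2 by (simp add: cong_to_def)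
    ultimately have "int r dvd (int (elt m k) - int (elt \<mu> k)) + (int (elt \<mu> k) - int (elt \<mu> (?t k)))"
      by (rule dvd_add[rotated])
    then show ?thesis by (simp add: lookup_pexp_transpose)
  qed
qed

text \<open>A relation rather than a function: different paths may lead to the same exponent, and
  the last rule applies only where no pole is met. Being formulated over any field, it serves for
  the generic and the complex parameters alike.\<close>

inductive isE :: "expo \<Rightarrow> 'a mpol \<Rightarrow> bool" where
  isE_zero: "isE 0 1"
| isE_Phi: "isE \<mu> f \<Longrightarrow> isE (phi n \<mu>) (Phi n f)"
| isE_swap: "isE \<mu> f \<Longrightarrow> Suc i < n \<Longrightarrow> elt \<mu> i < elt \<mu> (Suc i) \<Longrightarrow>
    (int r dvd int (elt \<mu> i) - int (elt \<mu> (Suc i)) \<Longrightarrow> wt \<mu> i \<noteq> wt \<mu> (Suc i)) \<Longrightarrow>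
    isE (pexp (tra i (Suc i)) \<mu>) (pact (tra i (Suc i)) f + mscale (tcoef \<mu> i) f)"

lemma zeig_one: "zeig 0 1"
  unfolding zeig_def
proof (intro allI impI)
  fix i assume i: "i < n"
  have x: "xfer i j 0 0 = 0" for j by (rule poly_mapping_eqI) (simp add: lookup_xfer)
  define e where "e = ee (Suc 0) - c0par P * (\<Sum>j\<in>{i<..<n}. ind 0)"
  have z: "zmon i 0 = mscale e (mon 0)"
    unfolding zmon_def bop_def cop_def e_def
    by (simp add: x mpol.scale_left_diff_distrib mpol.scale_sum_left del: sum_constant flip: mpol.scale_scale)
  \<comment> \<open>The scalar is identified with the weight by comparison with the diagonal entry
    that is already known.\<close>
  have "e = wt 0 i" using co_zmon_same[OF i, of 0] unfolding z by simp
  then have "zmon i 0 = mscale (wt 0 i) (mon 0)" using z by simp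
  then show "zop i 1 = mscale (wt 0 i) 1" using zop_mon[of i 0] by simp
qed

lemma isE_props:
  assumes "isE \<mu> f"
  shows "\<mu> \<in> expos n" "f \<in> polys n" "cong_to \<mu> f" "zeig \<mu> f"
proof -
  have "\<mu> \<in> expos n \<and> f \<in> polys n \<and> cong_to \<mu> f \<and> zeig \<mu> f"
    using assms
  proof induction
    case isE_zero
    have "(1 :: 'a mpol) \<in> polys n" by (auto simp: polys_def expos_iff)
    moreover have "cong_to 0 1" by (simp add: cong_to_def)
    ultimately show ?case by (simp add: expos_iff zeig_one)
  next
    case (isE_Phi \<mu> f)
    have "Phi n f \<in> polys n"
      using isE_Phi n_pos keys_Phi[of n f] expos_phi[OF n_pos] unfolding polys_def by blast
    then show ?case using isE_Phi by (simp add: expos_phi[OF n_pos] zeig_Phi cong_to_Phi)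
  next
    case (isE_swap \<mu> f i)
    then show ?case
      by (auto intro!: zeig_swap cong_to_swap polys_add polys_scale pact_polys tra_permutes
          simp: pexp_expos tra_permutes)
  qed
  then show "\<mu> \<in> expos n" "f \<in> polys n" "cong_to \<mu> f" "zeig \<mu> f" by auto
qed

end

section \<open>The action of the Cherednik algebra\<close>

lemma free_act_superset:
  assumes "finite K" "Poly_Mapping.keys a \<subseteq> K"
  shows "free_act P a f = (\<Sum>u\<in>K. mscale (Poly_Mapping.lookup a u) (foldr (gen_act P) (letters u) f))"
  unfolding free_act_def using assms by (intro sum.mono_neutral_left) (auto simp: in_keys_iff)

lemma free_act_add: "free_act P (a + b) f = free_act P a f + free_act P b f"
proof -
  let ?K = "Poly_Mapping.keys a \<union> Poly_Mapping.keys b"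
  have "Poly_Mapping.keys (a + b) \<subseteq> ?K" by (rule keys_add)
  then show ?thesis
    by (simp add: free_act_superset[of ?K] lookup_add mpol.scale_left_distrib sum.distrib)
qed

lemma free_act_zero: "free_act P 0 f = 0"
  by (simp add: free_act_def)

lemma free_act_sum: "free_act P (\<Sum>i\<in>A. a i) f = (\<Sum>i\<in>A. free_act P (a i) f)"
  by (induction A rule: infinite_finite_induct) (simp_all add: free_act_add free_act_zero)

lemma free_act_single:
  "free_act P (Poly_Mapping.single u c) f = mscale c (foldr (gen_act P) (letters u) f)"
  by (simp add: free_act_def)

lemma free_act_fgen: "free_act P (fgen g) f = gen_act P g f"
  and free_act_fscal: "free_act P (fscal c) f = mscale c f"
  by (simp_all add: fgen_def fscal_def free_act_single zero_gword_def)

lemma freealg_expand: "a = (\<Sum>u\<in>Poly_Mapping.keys a. Poly_Mapping.single u (Poly_Mapping.lookup a u))"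
  by (rule poly_mapping_eqI) (simp add: lookup_sum lookup_single when_def in_keys_iff sum.delta')

lemma fgen_carrier: "fgen g \<in> free_carrier P \<longleftrightarrow> g \<in> cgens P"
  and fscal_carrier: "fscal c \<in> free_carrier P"
  by (auto simp: free_carrier_def fgen_def fscal_def zero_gword_def)

lemma add_carrier: "a \<in> free_carrier P \<Longrightarrow> b \<in> free_carrier P \<Longrightarrow> a + b \<in> free_carrier P"
  using keys_add[of a b] unfolding free_carrier_def by blast

lemma zero_carrier: "0 \<in> free_carrier P"
  by (simp add: free_carrier_def)

lemma sum_carrier: "(\<And>i. i \<in> A \<Longrightarrow> a i \<in> free_carrier P) \<Longrightarrow> (\<Sum>i\<in>A. a i) \<in> free_carrier P"
  by (induction A rule: infinite_finite_induct) (auto intro: add_carrier simp: zero_carrier)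

lemma mult_carrier:
  assumes "a \<in> free_carrier P" "b \<in> free_carrier P"
  shows "a * b \<in> free_carrier P"
  unfolding free_carrier_def
proof (intro CollectI ballI)
  fix w assume "w \<in> Poly_Mapping.keys (a * b)"
  then obtain u v where "w = u + v" "u \<in> Poly_Mapping.keys a" "v \<in> Poly_Mapping.keys b"
    using keys_mult[of a b] by blast
  then show "set (letters w) \<subseteq> cgens P"
    using assms by (auto simp: free_carrier_def plus_gword_def)
qed

lemma GrpnI:
  assumes \<sigma>: "\<sigma> permutes {..<dimn P}" and w: "w \<in> carrier_mat (dimn P) (dimn P)"
    and entries: "\<And>a b. a < dimn P \<Longrightarrow> b < dimn P \<Longrightarrow> w $$ (a, b) = (if a = \<sigma> b then u b else 0)"
    and u: "\<And>b. b < dimn P \<Longrightarrow> u b \<noteq> 0" "\<And>b. b < dimn P \<Longrightarrow> u b ^ ordr P = 1"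
    and prod: "(\<Prod>b<dimn P. u b) ^ (ordr P div divp P) = 1"
  shows "w \<in> Grpn P"
proof -
  let ?S = "{ab \<in> {..<dimn P} \<times> {..<dimn P}. w $$ ab \<noteq> 0}"
  have in\<sigma>: "\<sigma> b < dimn P \<longleftrightarrow> b < dimn P" for b using permutes_in_image[OF \<sigma>, of b] by simp
  have "(\<Prod>ab\<in>?S. w $$ ab) = (\<Prod>b<dimn P. u b)"
    by (rule prod.reindex_bij_witness[where i = "\<lambda>b. (\<sigma> b, b)" and j = snd])
      (auto simp: entries u in\<sigma> split: if_splits)
  moreover have "monomial_mat (dimn P) w"
    unfolding monomial_mat_def using \<sigma> w entries u(1) by (intro conjI exI[of _ \<sigma>]) auto
  ultimately show ?thesis
    unfolding Grpn_def using entries u prod by (auto split: if_splits)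
qed

lemma GrpnE:
  assumes "w \<in> Grpn P"
  obtains \<sigma> u where "\<sigma> permutes {..<dimn P}" "w \<in> carrier_mat (dimn P) (dimn P)"
    "\<And>a b. a < dimn P \<Longrightarrow> b < dimn P \<Longrightarrow> w $$ (a, b) = (if a = \<sigma> b then u b else 0)"
    "\<And>b. b < dimn P \<Longrightarrow> u b ^ ordr P = 1"
proof -
  obtain \<sigma> where \<sigma>: "\<sigma> permutes {..<dimn P}" and w: "w \<in> carrier_mat (dimn P) (dimn P)"
    and nz: "\<And>a b. a < dimn P \<Longrightarrow> b < dimn P \<Longrightarrow> w $$ (a, b) \<noteq> 0 \<longleftrightarrow> a = \<sigma> b"
    and r: "\<And>a b. a < dimn P \<Longrightarrow> b < dimn P \<Longrightarrow> w $$ (a, b) \<noteq> 0 \<Longrightarrow> (w $$ (a, b)) ^ ordr P = 1"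
    using assms unfolding Grpn_def monomial_mat_def by blast
  have in\<sigma>: "\<sigma> b < dimn P \<longleftrightarrow> b < dimn P" for b using permutes_in_image[OF \<sigma>, of b] by simp
  show ?thesis
    by (rule that[OF \<sigma> w, of "\<lambda>b. w $$ (\<sigma> b, b)"]) (use nz r in\<sigma> in auto)
qed

definition pmat :: "nat \<Rightarrow> (nat \<Rightarrow> nat) \<Rightarrow> 'a::field mat" where
  "pmat n \<sigma> = mat n n (\<lambda>(a, b). if a = \<sigma> b then 1 else 0)"

lemma dg_dg_carrier: "dg n i x * dg n j y \<in> carrier_mat n n"
  by (metis dg_carrier mult_carrier_mat)

lemma dg_dg_entry: "a < n \<Longrightarrow> b < n \<Longrightarrow> (dg n i x * dg n j y) $$ (a, b) =
    (if a = b then (if a = i then x else 1) * (if a = j then y else 1) else 0)"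
  by (subst dg_mult_left) (simp_all add: dg_def)

context chered
begin

lemma pmat_Grpn: "\<sigma> permutes {..<n} \<Longrightarrow> pmat n \<sigma> \<in> Grpn P"
  by (rule GrpnI[where \<sigma> = \<sigma> and u = "\<lambda>_. 1"]) (auto simp: pmat_def)

lemma mat_act_pmat: "\<sigma> permutes {..<n} \<Longrightarrow> f \<in> polys n \<Longrightarrow> mat_act (pmat n \<sigma>) f = pact \<sigma> f"
  by (rule polys_eqI[OF mlin_mat_act mlin_pact], subst mat_act_mon[where u = "\<lambda>_. 1"])
    (auto simp: pmat_def)

lemma r_div_p: "r div p * p = r"
  using p_dvd by simp

lemma refl_mat_Grpn:
  assumes "i < n" "j < n" "i \<noteq> j"
  shows "refl_mat P i j l \<in> Grpn P"
proof (rule GrpnI[where \<sigma> = "tra i j" and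
      u = "\<lambda>b. if b = j then zeta P ^ l else if b = i then inverse (zeta P) ^ l else 1"])
  have "(\<Prod>b<n. if b = j then zeta P ^ l else if b = i then inverse (zeta P) ^ l else 1) =
    (\<Prod>b\<in>{i, j}. if b = j then zeta P ^ l else if b = i then inverse (zeta P) ^ l else 1)"
    using assms by (intro prod.mono_neutral_right) auto
  also have "\<dots> = 1" using assms by (simp add: power_mult_distrib[symmetric])
  finally show "(\<Prod>b<dimn P. if b = j then zeta P ^ l else if b = i then inverse (zeta P) ^ l else 1) ^
      (ordr P div divp P) = 1" by simp
  fix b
  have "(zeta P ^ l) ^ r = 1" by (metis power_mult mult.commute zeta_r power_one)
  then show "(if b = j then zeta P ^ l else if b = i then inverse (zeta P) ^ l else 1) ^ ordr P = 1"
    by (simp add: power_inverse)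
qed (use assms refl_mat_carrier[of P i j l] in \<open>auto simp: refl_mat_entry permutes_swap_id Transposition.transpose_def split: if_splits\<close>)

lemma dg_dg_Grpn:
  assumes "Suc i < n"
  shows "dg n i (zeta P) * dg n (Suc i) (inverse (zeta P)) \<in> Grpn P"
proof (rule GrpnI[where \<sigma> = "\<lambda>x. x" and
      u = "\<lambda>b. if b = i then zeta P else if b = Suc i then inverse (zeta P) else 1"])
  have "(\<Prod>b<n. if b = i then zeta P else if b = Suc i then inverse (zeta P) else 1) =
    (\<Prod>b\<in>{i, Suc i}. if b = i then zeta P else if b = Suc i then inverse (zeta P) else 1)"
    using assms by (intro prod.mono_neutral_right) auto
  then show "(\<Prod>b<dimn P. if b = i then zeta P else if b = Suc i then inverse (zeta P) else 1) ^
      (ordr P div divp P) = 1" by simp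
qed (use assms zeta_r in \<open>auto simp: dg_dg_entry dg_dg_carrier permutes_id[unfolded id_def] power_inverse\<close>)

lemma dg_power_Grpn:
  assumes "i < n"
  shows "dg n i (zeta P ^ p) \<in> Grpn P"
proof (rule GrpnI[where \<sigma> = "\<lambda>x. x" and u = "\<lambda>b. if b = i then zeta P ^ p else 1"])
  have "(\<Prod>b<n. if b = i then zeta P ^ p else 1) = zeta P ^ p"
    using assms by (simp add: prod.delta)
  then show "(\<Prod>b<dimn P. if b = i then zeta P ^ p else 1) ^ (ordr P div divp P) = 1"
    using zeta_r r_div_p by (simp add: power_mult[symmetric] mult.commute)
  fix b
  have "(zeta P ^ p) ^ r = 1" by (metis power_mult mult.commute zeta_r power_one)
  then show "(if b = i then zeta P ^ p else 1) ^ ordr P = 1" by simp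
qed (use assms in \<open>auto simp: dg_def permutes_id[unfolded id_def] split: if_splits\<close>)

lemma root_power_cong:
  assumes u: "u ^ r = (1 :: 'a)" and d: "int r dvd int a - int b"
  shows "u ^ a = u ^ b"
proof -
  have "u ^ k = u ^ (k mod r)" for k
    by (metis u div_mult_mod_eq mult.commute mult_1 power_add power_mult power_one)
  moreover have "a mod r = b mod r" using d by (metis mod_eq_dvd_iff of_nat_eq_iff zmod_int)
  ultimately show ?thesis by metis
qed

text \<open>Powers of r-th roots of unity depend on the exponents modulo r, so the scalar is the
  same for all monomials of f.\<close>

lemma mat_act_cong_to:
  assumes \<sigma>: "\<sigma> permutes {..<n}" and w: "w \<in> carrier_mat n n"
    and entries: "\<And>a b. a < n \<Longrightarrow> b < n \<Longrightarrow> w $$ (a, b) = (if a = \<sigma> b then u b else 0)"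
    and u: "\<And>b. b < n \<Longrightarrow> u b ^ r = 1"
    and f: "f \<in> polys n" "cong_to \<mu> f"
  shows "mat_act w f = mscale (\<Prod>i<n. inverse (u i) ^ elt \<mu> i) (pact \<sigma> f)"
proof (rule mlin_eqI[OF mlin_mat_act mlin_mscale[OF mlin_pact]])
  fix m assume m: "m \<in> Poly_Mapping.keys f"
  then have "mat_act w (mon m) = mscale (\<Prod>i<n. inverse (u i) ^ elt m i) (mon (pexp \<sigma> m))"
    using f(1) by (intro mat_act_mon[OF \<sigma> w entries]) (auto simp: polys_def)
  also have "(\<Prod>i<n. inverse (u i) ^ elt m i) = (\<Prod>i<n. inverse (u i) ^ elt \<mu> i)"
    using m f(2) u by (intro prod.cong refl root_power_cong) (auto simp: cong_to_def power_inverse)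
  finally show "mat_act w (mon m) = mscale (\<Prod>i<n. inverse (u i) ^ elt \<mu> i) (pact \<sigma> (mon m))" by simp
qed

lemma mat_act_Grpn_cong_to:
  assumes "w \<in> Grpn P" "f \<in> polys n" "cong_to \<mu> f"
  obtains \<sigma> c where "\<sigma> permutes {..<n}" "mat_act w f = mscale c (pact \<sigma> f)"
  using assms(1)
proof (rule GrpnE)
  fix \<sigma> u
  assume *: "\<sigma> permutes {..<dimn P}" "w \<in> carrier_mat (dimn P) (dimn P)"
    "\<And>a b. a < dimn P \<Longrightarrow> b < dimn P \<Longrightarrow> w $$ (a, b) = (if a = \<sigma> b then u b else 0)"
    "\<And>b. b < dimn P \<Longrightarrow> u b ^ ordr P = 1"
  show thesis
    by (rule that[OF *(1)[unfolded dimn] mat_act_cong_to[OF _ _ _ _ assms(2,3)]]) (use * in auto)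
qed

lemma mat_act_zz:
  assumes "Suc i < n" "f \<in> polys n" "cong_to \<mu> f"
  shows "mat_act (dg n i (zeta P) * dg n (Suc i) (inverse (zeta P))) f =
    mscale (zeta P powi (int (elt \<mu> (Suc i)) - int (elt \<mu> i))) f"
proof -
  let ?u = "\<lambda>b. if b = i then zeta P else if b = Suc i then inverse (zeta P) else 1"
  let ?g = "\<lambda>k. inverse (?u k) ^ elt \<mu> k"
  have "mat_act (dg n i (zeta P) * dg n (Suc i) (inverse (zeta P))) f = mscale (\<Prod>k<n. ?g k) (pact (\<lambda>x. x) f)"
    by (rule mat_act_cong_to)
      (use assms zeta_r in \<open>auto simp: dg_dg_entry dg_dg_carrier permutes_id[unfolded id_def] power_inverse\<close>)
  also have "(\<Prod>k<n. ?g k) = (\<Prod>k\<in>{i, Suc i}. ?g k)"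
    using assms by (intro prod.mono_neutral_right) auto
  also have "\<dots> = zeta P powi (int (elt \<mu> (Suc i)) - int (elt \<mu> i))"
    by (simp add: power_int_diff power_inverse divide_inverse mult.commute)
  finally show ?thesis by (simp add: pact_id)
qed

lemma mat_act_zp:
  assumes "i < n" "f \<in> polys n" "cong_to \<mu> f"
  shows "mat_act (dg n i (zeta P ^ p)) f = mscale (zeta P powi (- (int p * int (elt \<mu> i)))) f"
proof -
  let ?u = "\<lambda>b. if b = i then zeta P ^ p else 1"
  have zp: "(zeta P ^ p) ^ r = 1" by (metis power_mult mult.commute zeta_r power_one)
  have "mat_act (dg n i (zeta P ^ p)) f = mscale (\<Prod>k<n. inverse (?u k) ^ elt \<mu> k) (pact (\<lambda>x. x) f)"
    by (rule mat_act_cong_to)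
      (use assms zp in \<open>auto simp: dg_def permutes_id[unfolded id_def] split: if_splits\<close>)
  also have "(\<Prod>k<n. inverse (?u k) ^ elt \<mu> k) = (\<Prod>k<n. if k = i then inverse (zeta P ^ p) ^ elt \<mu> i else 1)"
    by (intro prod.cong) auto
  also have "\<dots> = zeta P powi (- (int p * int (elt \<mu> i)))"
    using assms by (simp add: prod.delta power_int_minus power_int_mult power_inverse)
  finally show ?thesis by (simp add: pact_id)
qed

lemma ymon_polys: "i < n \<Longrightarrow> m \<in> expos n \<Longrightarrow> ymon i m \<in> polys n"
  unfolding ymon_def qop_def
  by (intro polys_diff polys_scale polys_sum)
    (auto simp: expos_iff lookup_minus yexp_def lookup_update)

lemma y_act_polys: "i < n \<Longrightarrow> f \<in> polys n \<Longrightarrow> y_act P i f \<in> polys n"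
  by (simp add: y_act_eq) (rule mlin_polys[OF mlin_lin], auto simp: ymon_polys)

lemma mat_act_polys:
  assumes "w \<in> Grpn P" "f \<in> polys n"
  shows "mat_act w f \<in> polys n"
  using assms(1)
proof (rule GrpnE)
  fix \<sigma> u
  assume *: "\<sigma> permutes {..<dimn P}" "w \<in> carrier_mat (dimn P) (dimn P)"
    "\<And>a b. a < dimn P \<Longrightarrow> b < dimn P \<Longrightarrow> w $$ (a, b) = (if a = \<sigma> b then u b else 0)"
  show ?thesis
  proof (rule mlin_polys[OF mlin_mat_act _ assms(2)])
    fix m assume "m \<in> expos n"
    then show "mat_act w (mon m) \<in> polys n"
      using * by (subst mat_act_mon[of \<sigma> n w u]) (auto intro!: polys_scale simp: pexp_expos)
  qed
qed

text \<open>Outside \<open>polys n\<close> the quotients in \<open>y_act\<close> are not known to be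
  exact. Linearity is therefore expressed by a globally linear map that agrees on
  \<open>polys n\<close>, a form that passes to words and to sums of words.\<close>

lemma gen_act_linear:
  assumes "g \<in> cgens P"
  shows "\<exists>L. mlin L \<and> (\<forall>f\<in>polys n. gen_act P g f = L f \<and> L f \<in> polys n)"
proof -
  consider i where "g = GX i" "i < n" | i where "g = GY i" "i < n" | w where "g = GT w" "w \<in> Grpn P"
    using assms by (auto simp: cgens_def)
  then show ?thesis
  proof cases
    case 1
    then show ?thesis
      by (intro exI[of _ "\<lambda>f. mvar i * f"]) (auto simp: mvar_polys)
  next
    case 2
    then show ?thesis
      using y_act_polys[of i] by (intro exI[of _ "lin (ymon i)"]) (auto simp: y_act_eq)
  next
    case 3
    then show ?thesis
      by (intro exI[of _ "mat_act w"]) (auto simp: mat_act_polys)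
  qed
qed

lemma word_act_linear:
  assumes "set gs \<subseteq> cgens P"
  shows "\<exists>L. mlin L \<and> (\<forall>f\<in>polys n. foldr (gen_act P) gs f = L f \<and> L f \<in> polys n)"
  using assms
proof (induction gs)
  case Nil
  show ?case by (rule exI[of _ "\<lambda>f. f"]) auto
next
  case (Cons g gs)
  then obtain L where L: "mlin L" "\<And>f. f \<in> polys n \<Longrightarrow> foldr (gen_act P) gs f = L f \<and> L f \<in> polys n"
    by auto
  obtain M where M: "mlin M" "\<And>f. f \<in> polys n \<Longrightarrow> gen_act P g f = M f \<and> M f \<in> polys n"
    using gen_act_linear[of g] Cons.prems by auto
  show ?case
    using L M by (intro exI[of _ "\<lambda>f. M (L f)"]) auto
qed

lemma free_act_linear:
  assumes a: "a \<in> free_carrier P"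
  shows "\<exists>L. mlin L \<and> (\<forall>f\<in>polys n. free_act P a f = L f \<and> L f \<in> polys n)"
proof -
  have "\<forall>u\<in>Poly_Mapping.keys a. \<exists>L. mlin L \<and> (\<forall>f\<in>polys n. foldr (gen_act P) (letters u) f = L f \<and> L f \<in> polys n)"
    using a word_act_linear by (auto simp: free_carrier_def)
  then obtain L where L: "\<And>u. u \<in> Poly_Mapping.keys a \<Longrightarrow> mlin (L u)"
    "\<And>u f. u \<in> Poly_Mapping.keys a \<Longrightarrow> f \<in> polys n \<Longrightarrow> foldr (gen_act P) (letters u) f = L u f \<and> L u f \<in> polys n"
    by metis
  show ?thesis
    by (rule exI[of _ "\<lambda>f. \<Sum>u\<in>Poly_Mapping.keys a. mscale (Poly_Mapping.lookup a u) (L u f)"])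
      (auto intro!: mlin_summation mlin_mscale polys_sum polys_scale sum.cong simp: L free_act_def)
qed

lemma free_act_scale: "a \<in> free_carrier P \<Longrightarrow> f \<in> polys n \<Longrightarrow> free_act P a (mscale c f) = mscale c (free_act P a f)"
  using free_act_linear[of a] polys_scale[of f n c] by (metis mlin_scale)

lemma free_act_mult:
  assumes a: "a \<in> free_carrier P" and b: "b \<in> free_carrier P" and f: "f \<in> polys n"
  shows "free_act P (a * b) f = free_act P a (free_act P b f)"
proof -
  let ?a = "Poly_Mapping.lookup a" and ?b = "Poly_Mapping.lookup b"
  let ?w = "\<lambda>u. foldr (gen_act P) (letters u)"
  have "a * b = (\<Sum>u\<in>Poly_Mapping.keys a. \<Sum>v\<in>Poly_Mapping.keys b. Poly_Mapping.single (u + v) (?a u * ?b v))"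
    by (subst freealg_expand[of a], subst freealg_expand[of b]) (simp add: sum_product mult_single)
  then have "free_act P (a * b) f =
    (\<Sum>u\<in>Poly_Mapping.keys a. \<Sum>v\<in>Poly_Mapping.keys b. mscale (?a u * ?b v) (?w u (?w v f)))"
    by (simp add: free_act_sum free_act_single plus_gword_def)
  also have "\<dots> = (\<Sum>u\<in>Poly_Mapping.keys a. mscale (?a u) (?w u (free_act P b f)))"
  proof (intro sum.cong refl)
    fix u assume "u \<in> Poly_Mapping.keys a"
    then obtain L where L: "mlin L" "\<And>f. f \<in> polys n \<Longrightarrow> ?w u f = L f"
      using word_act_linear[of "letters u"] a by (auto simp: free_carrier_def)
    have v: "?w v f \<in> polys n" if "v \<in> Poly_Mapping.keys b" for v
      using word_act_linear[of "letters v"] b f that by (auto simp: free_carrier_def)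
    have "?w u (free_act P b f) = L (free_act P b f)"
      unfolding free_act_def using v by (intro L(2) polys_sum polys_scale)
    also have "\<dots> = (\<Sum>v\<in>Poly_Mapping.keys b. mscale (?b v) (?w u (?w v f)))"
      unfolding free_act_def by (simp add: mlin_sum[OF L(1)] mlin_scale[OF L(1)] L(2) v)
    finally show "(\<Sum>v\<in>Poly_Mapping.keys b. mscale (?a u * ?b v) (?w u (?w v f))) =
      mscale (?a u) (?w u (free_act P b f))"
      by (simp add: mpol.scale_sum_right)
  qed
  finally show ?thesis by (simp add: free_act_def)
qed

lemma cgens_simps [simp]: "GX i \<in> cgens P \<longleftrightarrow> i < n" "GY i \<in> cgens P \<longleftrightarrow> i < n"
  "GT w \<in> cgens P \<longleftrightarrow> w \<in> Grpn P"
  by (auto simp: cgens_def)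

lemma z_elt_carrier: "i < n \<Longrightarrow> z_elt P i \<in> free_carrier P"
  unfolding z_elt_def
  by (intro add_carrier mult_carrier sum_carrier fscal_carrier) (auto simp: fgen_carrier refl_mat_Grpn)

lemma free_act_z_elt:
  assumes "i < n" "f \<in> polys n"
  shows "free_act P (z_elt P i) f = zop i f"
proof -
  have c: "(\<Sum>j<i. \<Sum>l<ordr P. FT (refl_mat P i j l)) \<in> free_carrier P"
    using assms by (intro sum_carrier) (auto simp: fgen_carrier refl_mat_Grpn)
  show ?thesis
    using z_elt_act[OF assms] assms c
    by (simp add: z_elt_def free_act_add free_act_mult fgen_carrier fscal_carrier free_act_fgen
        free_act_fscal free_act_sum)
qed

lemma t_alg_carrier: "a \<in> t_alg P \<Longrightarrow> a \<in> free_carrier P"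
proof (induction rule: t_alg.induct)
  case (zz i)
  then show ?case using dg_dg_Grpn[of i] by (simp add: fgen_carrier)
next
  case (zp i)
  then show ?case using dg_power_Grpn[of i] by (simp add: fgen_carrier)
qed (auto simp: fscal_carrier z_elt_carrier intro: add_carrier mult_carrier)

lemma t_eigenvectorI:
  assumes f: "f \<in> polys n" "f \<noteq> 0" "cong_to \<mu> f" "zeig \<mu> f"
  shows "t_eigenvector P f"
proof -
  have "\<exists>e. free_act P a f = mscale e f" if "a \<in> t_alg P" for a
    using that
  proof induction
    case (scal a)
    show ?case by (auto simp: free_act_fscal)
  next
    case (z i)
    then show ?case using f by (auto simp: free_act_z_elt zeig_def)
  next
    case (zz i)
    then show ?case using mat_act_zz[of i f \<mu>] f by (auto simp: free_act_fgen)
  next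
    case (zp i)
    then show ?case using mat_act_zp[of i f \<mu>] f by (auto simp: free_act_fgen)
  next
    case (add a b)
    then show ?case by (metis free_act_add mpol.scale_left_distrib)
  next
    case (mult a b)
    then obtain d e where "free_act P a f = mscale d f" "free_act P b f = mscale e f" by blast
    then have "free_act P (a * b) f = mscale (e * d) f"
      using mult f by (simp add: free_act_mult t_alg_carrier free_act_scale)
    then show ?case by blast
  qed
  then show ?thesis using f by (simp add: t_eigenvector_def)
qed

lemma t_eigenvector_zop: "t_eigenvector P f \<Longrightarrow> i < n \<Longrightarrow> \<exists>e. zop i f = mscale e f"
  unfolding t_eigenvector_def dimn by (metis free_act_z_elt t_alg.z dimn)

text \<open>The classes in \<open>cherednik_algebra\<close> exhaust \<open>free_carrier\<close>, so
  invariance under all representatives is invariance under the free algebra, and this reduces to the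
  generators.\<close>

lemma cherednik_submodule_iff:
  "cherednik_submodule P N \<longleftrightarrow> mpol.subspace N \<and> N \<subseteq> polys n \<and>
     (\<forall>i<n. \<forall>f\<in>N. mvar i * f \<in> N \<and> y_act P i f \<in> N) \<and> (\<forall>w\<in>Grpn P. \<forall>f\<in>N. mat_act w f \<in> N)"
proof -
  let ?R = "{(a, b). a \<in> free_carrier P \<and> b \<in> free_carrier P \<and> a - b \<in> cherednik_ideal P}"
  have 1: "\<exists>h\<in>cherednik_algebra P. a \<in> h" if "a \<in> free_carrier P" for a
    unfolding cherednik_algebra_def using that
    by (intro bexI[of _ "?R `` {a}"] quotientI) (auto intro: cherednik_ideal.zero)
  have 2: "a \<in> free_carrier P" if "h \<in> cherednik_algebra P" "a \<in> h" for a h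
    using that by (auto simp: cherednik_algebra_def quotient_def)
  have "cherednik_submodule P N \<longleftrightarrow> mpol.subspace N \<and> N \<subseteq> polys n \<and>
      (\<forall>a\<in>free_carrier P. \<forall>f\<in>N. free_act P a f \<in> N)"
  proof -
    have "\<Union> (cherednik_algebra P) = free_carrier P" using 1 2 by (intro equalityI subsetI) auto
    then have "(\<forall>a\<in>free_carrier P. \<forall>f\<in>N. free_act P a f \<in> N) \<longleftrightarrow>
        (\<forall>h\<in>cherednik_algebra P. \<forall>a\<in>h. \<forall>f\<in>N. free_act P a f \<in> N)"
      by (metis Union_iff)
    then show ?thesis unfolding cherednik_submodule_def dimn by simp
  qed
  also have "\<dots> \<longleftrightarrow> mpol.subspace N \<and> N \<subseteq> polys n \<and> (\<forall>g\<in>cgens P. \<forall>f\<in>N. gen_act P g f \<in> N)"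
  proof -
    have "free_act P a f \<in> N" if N: "mpol.subspace N" "\<forall>g\<in>cgens P. \<forall>f\<in>N. gen_act P g f \<in> N"
      and a: "a \<in> free_carrier P" "f \<in> N" for a f
    proof -
      have w: "foldr (gen_act P) gs f \<in> N" if "set gs \<subseteq> cgens P" for gs
        using that by (induction gs) (use N a in auto)
      show ?thesis
        unfolding free_act_def
        using w a by (intro mpol.subspace_sum[OF N(1)] mpol.subspace_scale[OF N(1)])
          (auto simp: free_carrier_def)
    qed
    moreover have "gen_act P g f \<in> N" if "\<forall>a\<in>free_carrier P. \<forall>f\<in>N. free_act P a f \<in> N" "g \<in> cgens P" "f \<in> N" for g f
      using that by (metis fgen_carrier free_act_fgen)
    ultimately show ?thesis by blast
  qed
  also have "(\<forall>g\<in>cgens P. \<forall>f\<in>N. gen_act P g f \<in> N) \<longleftrightarrow>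
      (\<forall>i<n. \<forall>f\<in>N. mvar i * f \<in> N \<and> y_act P i f \<in> N) \<and> (\<forall>w\<in>Grpn P. \<forall>f\<in>N. mat_act w f \<in> N)"
    unfolding cgens_def dimn by (simp add: ball_Un) blast
  finally show ?thesis .
qed

end

section \<open>The generic eigenvectors\<close>

lemma inj_phi: "phi n m = phi n m' \<Longrightarrow> m = m'"
  unfolding phi_def using pexp_inv(1)[OF cyc_permutes] by (metis add_left_cancel)

lemma co_Phi: "co (Phi n f) (phi n m) = co f m"
proof -
  have "Phi n f = lin (\<lambda>m. mon (phi n m)) f"
    by (rule mlin_eqI[OF mlin_Phi mlin_lin]) (simp add: Phi_mon)
  then have "co (Phi n f) (phi n m) = (\<Sum>k\<in>Poly_Mapping.keys f. co f k * co (mon (phi n k)) (phi n m))"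
    by (simp add: lin_def lookup_sum)
  also have "\<dots> = (\<Sum>k\<in>Poly_Mapping.keys f. if k = m then co f m else 0)"
    by (intro sum.cong) (auto simp: lookup_single when_def dest: inj_phi)
  also have "\<dots> = co f m" by (simp add: sum.delta in_keys_iff)
  finally show ?thesis .
qed

lemma rk_adjacent_eq:
  assumes "Suc i < n" "elt \<mu> i = elt \<mu> (Suc i)"
  shows "rk n \<mu> i = Suc (rk n \<mu> (Suc i))"
proof -
  have "{j. j < n \<and> expo_before \<mu> j i} = insert (Suc i) {j. j < n \<and> expo_before \<mu> j (Suc i)}"
    using assms by (auto simp: expo_before_def)
  then show ?thesis
    unfolding rk_def by (simp add: expo_before_irrefl)
qed

definition keys_below :: "nat \<Rightarrow> expo \<Rightarrow> 'a::zero mpol \<Rightarrow> bool" where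
  "keys_below n \<mu> f \<longleftrightarrow> (\<forall>\<nu>\<in>Poly_Mapping.keys f. \<nu> = \<mu> \<or> expo_less n \<nu> \<mu>)"

text \<open>Genericity in the form in which it is used: one weight on its own determines its part.
  The second assumption separates the weights of two equal adjacent parts, whose ranks differ by
  one.\<close>

locale chered_generic = chered +
  assumes wt_elt: "\<And>\<mu> \<nu> i j. i < n \<Longrightarrow> j < n \<Longrightarrow> wt \<mu> i = wt \<nu> j \<Longrightarrow> elt \<mu> i = elt \<nu> j"
    and r_c0_nonzero: "of_nat r * c0par P \<noteq> 0"
begin

lemma expo_eqI:
  assumes "\<mu> \<in> expos n" "\<nu> \<in> expos n" "\<And>i. i < n \<Longrightarrow> elt \<mu> i = elt \<nu> i"
  shows "\<mu> = \<nu>"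
  using assms by (intro poly_mapping_eqI) (metis expos_iff not_le)

lemma key_eigenvalues:
  assumes f: "f \<in> polys n" "\<And>i. i < n \<Longrightarrow> zop i f = mscale (e i) f" and "\<rho> \<in> Poly_Mapping.keys f"
  obtains \<nu> where "\<nu> \<in> Poly_Mapping.keys f" "\<nu> \<in> expos n" "\<And>i. i < n \<Longrightarrow> e i = wt \<nu> i"
    "\<nu> = \<rho> \<or> expo_less n \<rho> \<nu>"
proof -
  obtain \<nu> where \<nu>: "\<nu> \<in> Poly_Mapping.keys f" "\<And>\<rho>. \<rho> \<in> Poly_Mapping.keys f \<Longrightarrow> \<not> expo_less n \<nu> \<rho>"
    "\<nu> = \<rho> \<or> expo_less n \<rho> \<nu>"
    using exists_maximal_key[OF assms(3)] by metis
  moreover have "\<nu> \<in> expos n" using \<nu>(1) f(1) by (auto simp: polys_def)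
  moreover have "e i = wt \<nu> i" if "i < n" for i
    using eigenvalue_at_maximal[OF f(2)[OF that] that \<nu>(1,2)] .
  ultimately show ?thesis using that by blast
qed

text \<open>The support is read off from the eigenvalues instead of being followed through the
  recursion: every key lies below a maximal one, whose weights must be those of \<mu>, so it is
  \<mu>.\<close>

lemma zeig_keys_below:
  assumes "f \<in> polys n" "zeig \<mu> f" "\<mu> \<in> expos n"
  shows "keys_below n \<mu> f"
  unfolding keys_below_def
proof
  fix \<rho> assume "\<rho> \<in> Poly_Mapping.keys f"
  then obtain \<nu> where \<nu>: "\<nu> \<in> expos n" "\<And>i. i < n \<Longrightarrow> wt \<mu> i = wt \<nu> i" "\<nu> = \<rho> \<or> expo_less n \<rho> \<nu>"
    using key_eigenvalues[OF assms(1), of "wt \<mu>"] assms(2) unfolding zeig_def by metis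
  have "\<nu> = \<mu>" using \<nu> assms(3) wt_elt by (intro expo_eqI) metis+
  then show "\<rho> = \<mu> \<or> expo_less n \<rho> \<mu>" using \<nu> by auto
qed

lemma isE_keys_below: "isE \<mu> f \<Longrightarrow> keys_below n \<mu> f"
  using isE_props zeig_keys_below by blast

lemma isE_coeff: "isE \<mu> f \<Longrightarrow> co f \<mu> = 1"
proof (induction rule: isE.induct)
  case (isE_swap \<mu> f i)
  let ?t = "tra i (Suc i)"
  have t: "?t permutes {..<n}" using isE_swap by (intro tra_permutes)
  have tt: "pexp ?t (pexp ?t \<mu>) = \<mu>" by (rule pexp_tra_tra)
  have less: "expo_less n \<mu> (pexp ?t \<mu>)"
    using expo_less_swap[of i "Suc i" n "pexp ?t \<mu>"] isE_swap by (simp add: tt lookup_pexp_transpose)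
  \<comment> \<open>The swapped exponent lies above \<mu> and cannot occur in f, so the leading
    coefficient comes from the permuted summand alone.\<close>
  have "co f (pexp ?t \<mu>) = 0"
  proof (rule ccontr)
    assume "co f (pexp ?t \<mu>) \<noteq> 0"
    then have "pexp ?t \<mu> = \<mu> \<or> expo_less n (pexp ?t \<mu>) \<mu>"
      using isE_keys_below[OF isE_swap(1)] by (simp add: keys_below_def in_keys_iff)
    then show False using less expo_less_trans expo_less_irrefl by metis
  qed
  moreover have "co (pact ?t f) (pexp ?t \<mu>) = 1"
    using isE_swap by (simp add: lookup_pact[OF t] tt)
  ultimately show ?case by (simp add: lookup_add)
qed (simp_all add: co_Phi)

text \<open>At the maximal key \<mu> the eigenvalues of f are forced to be those of F. The
  difference would be an eigenvector with these eigenvalues, so a maximal key of it would be \<mu>,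
  where its coefficient is 0.\<close>

lemma eigenvector_unique:
  assumes F: "isE \<mu> F"
    and f: "f \<in> polys n" "\<And>i. i < n \<Longrightarrow> \<exists>e. zop i f = mscale e f" "co f \<mu> = 1" "keys_below n \<mu> f"
  shows "f = F"
proof (rule ccontr)
  assume "f \<noteq> F"
  note P = isE_props[OF F]
  have \<mu>: "\<mu> \<in> Poly_Mapping.keys f" using f(3) by (simp add: in_keys_iff)
  have max: "\<not> expo_less n \<mu> \<rho>" if "\<rho> \<in> Poly_Mapping.keys f" for \<rho>
    using f(4) that expo_less_trans expo_less_irrefl unfolding keys_below_def by metis
  have "zop i f = mscale (wt \<mu> i) f" if "i < n" for i
    using f(2)[OF that] eigenvalue_at_maximal[OF _ that \<mu> max] by metis
  then have g: "zop i (f - F) = mscale (wt \<mu> i) (f - F)" if "i < n" for i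
    using P(4) that by (simp add: zeig_def mlin_diff[OF mlin_zop] mpol.scale_right_diff_distrib)
  obtain \<rho> where \<rho>: "\<rho> \<in> Poly_Mapping.keys (f - F)" using \<open>f \<noteq> F\<close> by fastforce
  obtain \<nu> where \<nu>: "\<nu> \<in> Poly_Mapping.keys (f - F)" "\<nu> \<in> expos n" "\<And>i. i < n \<Longrightarrow> wt \<mu> i = wt \<nu> i"
    using key_eigenvalues[OF polys_diff[OF f(1) P(2)] g \<rho>] by metis
  have "\<nu> = \<mu>" using \<nu> P(1) wt_elt by (intro expo_eqI) metis+
  then show False using \<nu>(1) f(3) isE_coeff[OF F] by (simp add: in_keys_iff lookup_minus)
qed

lemma isE_swapI:
  assumes "isE \<mu> f" "Suc i < n" "elt \<mu> i < elt \<mu> (Suc i)"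
  shows "isE (pexp (tra i (Suc i)) \<mu>) (pact (tra i (Suc i)) f + mscale (tcoef \<mu> i) f)"
  using wt_elt[of i "Suc i" \<mu> \<mu>] assms by (intro isE_swap) auto

text \<open>Otherwise sf - f, with s the swap, is an eigenvector with the weights at i and i + 1
  exchanged. Since weights determine parts, a maximal key of it is \<mu> again, so the two weights
  agree, although their ranks differ by one.\<close>

lemma isE_adjacent_eq:
  assumes F: "isE \<mu> f" and i: "Suc i < n" and eq: "elt \<mu> i = elt \<mu> (Suc i)"
  shows "pact (tra i (Suc i)) f = f"
proof (rule ccontr)
  let ?t = "tra i (Suc i)"
  assume ne: "pact ?t f \<noteq> f"
  note P = isE_props[OF F]
  have t: "?t permutes {..<n}" by (rule tra_permutes[OF i])
  have z: "zop k f = mscale (wt \<mu> k) f" if "k < n" for k using P(4) that by (simp add: zeig_def)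
  have c: "cind \<mu> i = wt \<mu> (Suc i) - wt \<mu> i"
    using rk_adjacent_eq[OF i eq] eq by (simp add: cind_def ind_def wt_def algebra_simps)
  have g: "zop k (pact ?t f - f) = mscale (wt \<mu> (?t k)) (pact ?t f - f)" if k: "k < n" for k
  proof -
    consider "k = i" | "k = Suc i" | "k \<noteq> i" "k \<noteq> Suc i" by blast
    then show ?thesis
    proof cases
      case 1
      then show ?thesis
        using i by (simp add: mlin_diff[OF mlin_zop] zop_transpose[OF i P(3)] z c
            mlin_scale[OF mlin_pact] mpol.scale_right_diff_distrib mpol.scale_left_diff_distrib)
    next
      case 2
      then show ?thesis
        using i by (simp add: mlin_diff[OF mlin_zop] zop_transpose_Suc[OF i P(3)] z c
            mlin_scale[OF mlin_pact] mpol.scale_right_diff_distrib mpol.scale_left_diff_distrib)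
    next
      case 3
      then show ?thesis
        using i k by (simp add: mlin_diff[OF mlin_zop] zop_transpose_other z
            mlin_scale[OF mlin_pact] mpol.scale_right_diff_distrib transpose_apply_other)
    qed
  qed
  obtain \<rho> where \<rho>: "\<rho> \<in> Poly_Mapping.keys (pact ?t f - f)" using ne by fastforce
  obtain \<nu> where \<nu>: "\<nu> \<in> expos n" "\<And>k. k < n \<Longrightarrow> wt \<mu> (?t k) = wt \<nu> k"
    using key_eigenvalues[OF polys_diff[OF pact_polys[OF t P(2)] P(2)] g \<rho>] by metis
  have tk: "?t k < n" if "k < n" for k using that permutes_in_image[OF t, of k] by simp
  have "\<nu> = \<mu>"
  proof (rule expo_eqI[OF \<nu>(1) P(1)])
    fix k assume k: "k < n"
    have "elt \<mu> (?t k) = elt \<nu> k" by (rule wt_elt[OF tk[OF k] k \<nu>(2)[OF k]])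
    then show "elt \<nu> k = elt \<mu> k" using eq by (auto simp: Transposition.transpose_def split: if_splits)
  qed
  then have "wt \<mu> (Suc i) = wt \<mu> i" using \<nu>(2)[of i] i by simp
  then have "cind \<mu> i = 0" using c by simp
  then show False using r_c0_nonzero eq by (simp add: cind_def ind_def mult.commute)
qed

lemma t_eigenvector_the:
  assumes F: "isE \<mu> F"
  shows "(THE f. t_eigenvector P f \<and> co f \<mu> = 1 \<and>
    (\<forall>\<nu>\<in>Poly_Mapping.keys f. \<nu> = \<mu> \<or> expo_less n \<nu> \<mu>)) = F"
proof (rule the_equality)
  have "F \<noteq> 0" using isE_coeff[OF F] by auto
  then show "t_eigenvector P F \<and> co F \<mu> = 1 \<and>
    (\<forall>\<nu>\<in>Poly_Mapping.keys F. \<nu> = \<mu> \<or> expo_less n \<nu> \<mu>)"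
    using isE_coeff[OF F] isE_keys_below[OF F] isE_props[OF F] t_eigenvectorI
    unfolding keys_below_def by blast
next
  fix f assume f: "t_eigenvector P f \<and> co f \<mu> = 1 \<and>
    (\<forall>\<nu>\<in>Poly_Mapping.keys f. \<nu> = \<mu> \<or> expo_less n \<nu> \<mu>)"
  then have "f \<in> polys n" by (simp add: t_eigenvector_def)
  then show "f = F"
    using f t_eigenvector_zop[of f] by (intro eigenvector_unique[OF F]) (auto simp: keys_below_def)
qed

end

section \<open>Specialisation of the parameters\<close>

definition mval :: "(nat \<Rightarrow> 'a::comm_ring_1) \<Rightarrow> expo \<Rightarrow> 'a" where
  "mval v m = (\<Prod>i\<in>Poly_Mapping.keys m. v i ^ elt m i)"

lemma mval_superset:
  "finite K \<Longrightarrow> Poly_Mapping.keys m \<subseteq> K \<Longrightarrow> mval v m = (\<Prod>i\<in>K. v i ^ elt m i)"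
  unfolding mval_def by (intro prod.mono_neutral_left) (auto simp: in_keys_iff)

lemma mval_add: "mval v (m + m') = mval v m * mval v m'"
proof -
  let ?K = "Poly_Mapping.keys m \<union> Poly_Mapping.keys m'"
  have "Poly_Mapping.keys (m + m') \<subseteq> ?K" by (rule keys_add)
  then show ?thesis
    by (simp add: mval_superset[of ?K] lookup_add power_add prod.distrib)
qed

lemma meval_superset:
  "finite K \<Longrightarrow> Poly_Mapping.keys f \<subseteq> K \<Longrightarrow> meval v f = (\<Sum>m\<in>K. Poly_Mapping.lookup f m * mval v m)"
  unfolding meval_def mval_def by (intro sum.mono_neutral_left) (auto simp: in_keys_iff)

lemma meval_add: "meval v (f + g) = meval v f + meval v g"
proof -
  let ?K = "Poly_Mapping.keys f \<union> Poly_Mapping.keys g"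
  have "Poly_Mapping.keys (f + g) \<subseteq> ?K" by (rule keys_add)
  then show ?thesis
    by (simp add: meval_superset[of ?K] lookup_add distrib_right sum.distrib)
qed

lemma meval_zero [simp]: "meval v 0 = 0" by (simp add: meval_def)

lemma meval_minus: "meval v (- f) = - meval v f"
  using meval_add[of v f "- f"] by (simp add: add_eq_0_iff)

lemma meval_sum: "meval v (\<Sum>i\<in>A. f i) = (\<Sum>i\<in>A. meval v (f i))"
  by (induction A rule: infinite_finite_induct) (simp_all add: meval_add)

lemma meval_single: "meval v (Poly_Mapping.single m a) = a * mval v m"
  by (simp add: meval_def mval_def)

lemma single_expand: "f = (\<Sum>m\<in>Poly_Mapping.keys f. Poly_Mapping.single m (Poly_Mapping.lookup f m))"
  by (rule poly_mapping_eqI) (simp add: lookup_sum lookup_single when_def in_keys_iff sum.delta')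

lemma meval_mult: "meval v (f * g) = meval v f * meval v g"
proof -
  have "f * g = (\<Sum>m\<in>Poly_Mapping.keys f. \<Sum>k\<in>Poly_Mapping.keys g.
      Poly_Mapping.single (m + k) (Poly_Mapping.lookup f m * Poly_Mapping.lookup g k))"
    by (subst single_expand[of f], subst single_expand[of g]) (simp add: sum_product mult_single)
  then have "meval v (f * g) = (\<Sum>m\<in>Poly_Mapping.keys f. \<Sum>k\<in>Poly_Mapping.keys g.
      (Poly_Mapping.lookup f m * mval v m) * (Poly_Mapping.lookup g k * mval v k))"
    by (simp add: meval_sum meval_single mval_add mult_ac)
  also have "\<dots> = meval v f * meval v g"
    by (simp add: meval_def mval_def[symmetric] sum_product)
  finally show ?thesis .
qed

lemma meval_mconst: "meval v (mconst a) = a"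
  and meval_mvar: "meval v (mvar i) = v i"
  by (simp_all add: mconst_def mvar_def meval_single mval_def)

lemma meval_one [simp]: "meval v 1 = 1"
  using meval_mconst[of v 1] by (simp add: mconst_def)

text \<open>Two representations of the same fraction are cross-multiplied before evaluation.\<close>

lemma specializes_unique:
  assumes "specializes v q z" "specializes v q z'"
  shows "z = z'"
proof -
  obtain a b where 1: "q = Fraction_Field.Fract a b" "meval v b \<noteq> 0" "z = meval v a / meval v b"
    using assms(1) unfolding specializes_def by blast
  obtain a' b' where 2: "q = Fraction_Field.Fract a' b'" "meval v b' \<noteq> 0" "z' = meval v a' / meval v b'"
    using assms(2) unfolding specializes_def by blast
  have "b \<noteq> 0" "b' \<noteq> 0" using 1 2 by auto
  then have "a * b' = a' * b" using 1(1) 2(1) by (simp add: eq_fract)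
  then have "meval v a * meval v b' = meval v a' * meval v b" by (metis meval_mult)
  then have "meval v a / meval v b = meval v a' / meval v b'" using 1(2) 2(2) by (simp add: frac_eq_eq)
  then show ?thesis using 1(3) 2(3) by simp
qed

lemma specializes_const: "specializes v (gconst a) a"
  and specializes_var: "specializes v (gvar i) (v i)"
  unfolding specializes_def gconst_def gvar_def
  by (rule exI[of _ "mconst a"], rule exI[of _ 1], simp add: meval_mconst)
    (rule exI[of _ "mvar i"], rule exI[of _ 1], simp add: meval_mvar)

lemma specializes_add:
  assumes "specializes v q z" "specializes v q' z'"
  shows "specializes v (q + q') (z + z')"
proof -
  obtain a b where 1: "q = Fraction_Field.Fract a b" "meval v b \<noteq> 0" "z = meval v a / meval v b"
    using assms(1) unfolding specializes_def by blast
  obtain a' b' where 2: "q' = Fraction_Field.Fract a' b'" "meval v b' \<noteq> 0" "z' = meval v a' / meval v b'"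
    using assms(2) unfolding specializes_def by blast
  have "b \<noteq> 0" "b' \<noteq> 0" using 1 2 by auto
  then show ?thesis
    unfolding specializes_def using 1 2
    by (intro exI[of _ "a * b' + a' * b"] exI[of _ "b * b'"]) (simp add: meval_mult meval_add field_simps)
qed

lemma specializes_mult:
  assumes "specializes v q z" "specializes v q' z'"
  shows "specializes v (q * q') (z * z')"
proof -
  obtain a b where 1: "q = Fraction_Field.Fract a b" "meval v b \<noteq> 0" "z = meval v a / meval v b"
    using assms(1) unfolding specializes_def by blast
  obtain a' b' where 2: "q' = Fraction_Field.Fract a' b'" "meval v b' \<noteq> 0" "z' = meval v a' / meval v b'"
    using assms(2) unfolding specializes_def by blast
  show ?thesis
    unfolding specializes_def using 1 2
    by (intro exI[of _ "a * a'"] exI[of _ "b * b'"]) (simp add: meval_mult)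
qed

lemma specializes_inverse:
  assumes "specializes v q z" "z \<noteq> 0"
  shows "specializes v (inverse q) (inverse z)"
proof -
  obtain a b where 1: "q = Fraction_Field.Fract a b" "meval v b \<noteq> 0" "z = meval v a / meval v b"
    using assms(1) unfolding specializes_def by blast
  then show ?thesis
    unfolding specializes_def using assms(2)
    by (intro exI[of _ b] exI[of _ a]) (auto simp: inverse_fract)
qed

lemma specializes_minus: "specializes v q z \<Longrightarrow> specializes v (- q) (- z)"
  unfolding specializes_def by (metis meval_minus minus_fract minus_divide_left)

lemma specializes_diff: "specializes v q z \<Longrightarrow> specializes v q' z' \<Longrightarrow> specializes v (q - q') (z - z')"
  using specializes_add[of v q z "- q'" "- z'"] specializes_minus by simp

lemma specializes_divide:
  "specializes v q z \<Longrightarrow> specializes v q' z' \<Longrightarrow> z' \<noteq> 0 \<Longrightarrow> specializes v (q / q') (z / z')"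
  using specializes_mult[of v q z "inverse q'" "inverse z'"] specializes_inverse
  by (simp add: divide_inverse)

lemma gconst_zero: "gconst 0 = 0" and gconst_one: "gconst 1 = 1"
  by (simp_all add: gconst_def mconst_def Zero_fract_def[symmetric] One_fract_def[symmetric] eq_fract)

lemma gconst_mult: "gconst (a * b) = gconst a * gconst b"
  by (simp add: gconst_def mconst_mult)

lemma specializes_zero: "specializes v 0 0" and specializes_one: "specializes v 1 1"
  using specializes_const[of v 0] specializes_const[of v 1] by (simp_all add: gconst_zero gconst_one)

lemma gconst_inject: "gconst a = gconst b \<Longrightarrow> a = b"
  using specializes_const specializes_unique by metis

lemma gconst_power: "gconst (a ^ k) = gconst a ^ k"
  by (induction k) (simp_all add: gconst_one gconst_mult)

lemma specializes_power: "specializes v q z \<Longrightarrow> specializes v (q ^ k) (z ^ k)"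
  by (induction k) (simp_all add: specializes_one specializes_mult)

lemma specializes_powi: "specializes v q z \<Longrightarrow> z \<noteq> 0 \<Longrightarrow> specializes v (q powi k) (z powi k)"
  by (simp add: power_int_def specializes_power specializes_inverse)

lemma specializes_sum: "(\<And>i. i \<in> A \<Longrightarrow> specializes v (q i) (z i)) \<Longrightarrow> specializes v (\<Sum>i\<in>A. q i) (\<Sum>i\<in>A. z i)"
  by (induction A rule: infinite_finite_induct) (simp_all add: specializes_zero specializes_add)

lemma specializes_of_nat: "specializes v (of_nat k) (of_nat k)"
  by (induction k) (simp_all add: specializes_zero specializes_one specializes_add)

lemma root_r_power: "r > 0 \<Longrightarrow> root_r r ^ r = 1"
proof -
  assume "r > 0"
  then have "root_r r ^ r = exp (of_nat r * (2 * of_real pi * \<i> / of_nat r))"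
    by (simp only: root_r_def exp_of_nat_mult)
  also have "of_nat r * (2 * of_real pi * \<i> / of_nat r) = 2 * of_real pi * \<i>"
    using \<open>r > 0\<close> by simp
  finally show ?thesis by (simp add: exp_two_pi_i)
qed

lemma root_r_primitive:
  assumes "0 < l" "l < r"
  shows "root_r r ^ l \<noteq> 1"
proof
  assume "root_r r ^ l = 1"
  moreover have "root_r r = cis (2 * pi / real r)"
    by (simp add: root_r_def cis_conv_exp mult_ac)
  ultimately have "cis (real l * (2 * pi / real r)) = 1" by (simp add: DeMoivre)
  then have "cos (real l * (2 * pi / real r)) = 1" by (metis cis.sel(1) one_complex.sel(1))
  then obtain k :: int where "real l * (2 * pi / real r) = real_of_int k * 2 * pi"
    unfolding cos_one_2pi_int by blast
  then have "real l = real_of_int k * real r"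
    using assms by (simp add: field_simps)
  then have k: "int l = k * int r" by (metis of_int_eq_iff of_int_mult of_int_of_nat_eq)
  have "k > 0"
  proof (rule ccontr)
    assume "\<not> k > 0"
    then have "k * int r \<le> 0" by (intro mult_nonpos_nonneg) auto
    then show False using k assms by simp
  qed
  then have "int r \<le> k * int r" using mult_right_mono[of 1 k "int r"] by simp
  then show False unfolding k[symmetric] using assms by simp
qed

lemma chered_generic_params:
  assumes "r > 1" "n \<ge> 1" "p > 0" "p dvd r"
  shows "chered (generic_params n r p) n r p"
proof
  show "zeta (generic_params n r p) ^ r = 1"
    using assms by (simp add: generic_params_def gconst_one root_r_power flip: gconst_power)
  fix l assume "0 < l" "l < r"
  then show "zeta (generic_params n r p) ^ l \<noteq> 1"
    using root_r_primitive[of l r] gconst_inject[of "root_r r ^ l" 1]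
    by (auto simp: generic_params_def gconst_one gconst_power)
qed (use assms in \<open>auto simp: generic_params_def c_from_d_def\<close>)

definition specF :: "(nat \<Rightarrow> complex) \<Rightarrow> genfield mpol \<Rightarrow> complex mpol \<Rightarrow> bool" where
  "specF v F f \<longleftrightarrow> (\<forall>\<nu>. specializes v (co F \<nu>) (co f \<nu>))"

lemma specF_unique: "specF v F f \<Longrightarrow> specF v F g \<Longrightarrow> f = g"
  unfolding specF_def using specializes_unique by (metis poly_mapping_eqI)

lemma specF_zero_coeff: "specF v F f \<Longrightarrow> co F \<nu> = 0 \<Longrightarrow> co f \<nu> = 0"
  unfolding specF_def using specializes_unique specializes_zero by metis

lemma specF_one: "specF v 1 1"
  by (simp add: specF_def lookup_one when_def specializes_zero specializes_one)

lemma specF_add: "specF v F f \<Longrightarrow> specF v G g \<Longrightarrow> specF v (F + G) (f + g)"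
  by (simp add: specF_def lookup_add specializes_add)

lemma specF_scale: "specializes v q z \<Longrightarrow> specF v F f \<Longrightarrow> specF v (mscale q F) (mscale z f)"
  by (simp add: specF_def specializes_mult)

lemma specF_pact: "\<sigma> permutes S \<Longrightarrow> specF v F f \<Longrightarrow> specF v (pact \<sigma> F) (pact \<sigma> f)"
  by (simp add: specF_def lookup_pact)

lemma specF_Phi:
  assumes "specF v F f"
  shows "specF v (Phi n F) (Phi n f)"
  unfolding specF_def
proof
  fix \<nu>
  show "specializes v (co (Phi n F) \<nu>) (co (Phi n f) \<nu>)"
  proof (cases "\<exists>m. \<nu> = phi n m")
    case True
    then show ?thesis using assms by (auto simp: co_Phi specF_def)
  next
    case False
    then have "\<nu> \<notin> phi n ` Poly_Mapping.keys F" "\<nu> \<notin> phi n ` Poly_Mapping.keys f" by auto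
    then have "co (Phi n F) \<nu> = 0" "co (Phi n f) \<nu> = 0"
      using keys_Phi[of n F] keys_Phi[of n f] unfolding in_keys_iff[symmetric] by (auto simp: in_keys_iff)
    then show ?thesis by (simp add: specializes_zero)
  qed
qed

section \<open>Fourier inversion of the parameters\<close>

context chered
begin

lemma sum_zeta_multiples:
  assumes "int p dvd k"
  shows "(\<Sum>j<r div p. zeta P powi (k * int j)) = (if int r dvd k then of_nat (r div p) else 0)"
proof -
  have eq: "zeta P powi (k * int j) = (zeta P powi k) ^ j" for j
    unfolding power_int_mult power_int_of_nat ..
  show ?thesis
  proof (cases "int r dvd k")
    case True
    then show ?thesis using zeta_powi_eq_1[of k] by (simp add: eq)
  next
    case False
    obtain k' where k': "k = int p * k'" using assms by (rule dvdE)
    have "k * int (r div p) = int r * k'"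
      unfolding k' using r_div_p by (metis mult.commute mult.left_commute of_nat_mult)
    then have "(zeta P powi k) ^ (r div p) = 1"
      unfolding eq[symmetric] using zeta_powi_eq_1[of "int r * k'"] by simp
    then show ?thesis
      using False zeta_powi_eq_1[of k] by (simp add: eq geometric_sum)
  qed
qed

lemma dpar_fourier:
  assumes "int p dvd l"
  shows "(\<Sum>j<r div p. zeta P powi (- l * int j) * dpar P (int j)) =
    (\<Sum>l' = 1..r - 1. if int r dvd int l' - l then of_nat (r div p) * cpar P l' else 0)"
proof -
  have "(\<Sum>j<r div p. zeta P powi (- l * int j) * dpar P (int j)) =
    (\<Sum>j<r div p. \<Sum>l' = 1..r - 1. zeta P powi ((int l' - l) * int j) * cpar P l')"
    unfolding dpar_def ordr sum_distrib_left
  proof (intro sum.cong refl)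
    fix j l'
    have "zeta P powi ((int l' - l) * int j) = zeta P powi (- l * int j) * zeta P powi (int l' * int j)"
      by (subst power_int_add[symmetric]) (simp_all add: left_diff_distrib)
    then show "zeta P powi (- l * int j) * (zeta P powi (int l' * int j) * cpar P l') =
        zeta P powi ((int l' - l) * int j) * cpar P l'"
      by (simp only: mult.assoc)
  qed
  also have "\<dots> = (\<Sum>l' = 1..r - 1. (\<Sum>j<r div p. zeta P powi ((int l' - l) * int j)) * cpar P l')"
    by (subst sum.swap) (simp add: sum_distrib_right)
  also have "\<dots> = (\<Sum>l' = 1..r - 1. if int r dvd int l' - l then of_nat (r div p) * cpar P l' else 0)"
  proof (intro sum.cong refl)
    fix l' assume l': "l' \<in> {1..r - 1}"
    show "(\<Sum>j<r div p. zeta P powi ((int l' - l) * int j)) * cpar P l' =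
      (if int r dvd int l' - l then of_nat (r div p) * cpar P l' else 0)"
    proof (cases "p dvd l'")
      case True
      then have "int p dvd int l' - l" using assms by (intro dvd_diff) auto
      then show ?thesis by (simp add: sum_zeta_multiples)
    next
      case False
      then show ?thesis using l' cpar_0 by simp
    qed
  qed
  finally show ?thesis .
qed

end

text \<open>The value d_0, absent from the formula, is recovered from the vanishing of the sum of
  all d_j, which is the Fourier coefficient at 0. As a result, evaluating the generic parameters at
  \<open>param_point P\<close> returns the given c_l.\<close>

lemma c_from_d_dpar:
  assumes "chered P n r p" and l: "1 \<le> l" "l \<le> r - 1" and d: "\<And>j. 1 \<le> j \<Longrightarrow> d j = dpar P (int j)"
  shows "c_from_d r p (zeta P) d l = (cpar P l :: complex)"
proof -
  interpret chered P n r p by fact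
  let ?q = "r div p"
  have q: "0 < ?q" using r_div_p r_gt_1 by (cases "?q = 0") auto
  have split: "(\<Sum>j<?q. f j) = f 0 + (\<Sum>j = 1..?q - 1. f j)" for f :: "nat \<Rightarrow> complex"
  proof -
    have "{..<?q} = insert 0 {1..?q - 1}" using q by auto
    then show ?thesis by simp
  qed
  have small: "int r dvd int l' - int l \<longleftrightarrow> l' = l" if "l' \<in> {1..r - 1}" for l'
  proof
    assume "int r dvd int l' - int l"
    then have "l' mod r = l mod r" by (metis mod_eq_dvd_iff of_nat_eq_iff zmod_int)
    moreover have "l' < r" "l < r" using that l r_gt_1 by auto
    ultimately show "l' = l" by simp
  qed simp
  show ?thesis
  proof (cases "p dvd l")
    case False
    then show ?thesis using l cpar_0 by (simp add: c_from_d_def)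
  next
    case True
    have "(\<Sum>j<?q. dpar P (int j)) = (\<Sum>l' = 1..r - 1. if int r dvd int l' then of_nat ?q * cpar P l' else 0)"
      using dpar_fourier[of 0] by simp
    also have "\<dots> = 0"
    proof (intro sum.neutral ballI)
      fix l' assume "l' \<in> {1..r - 1}"
      then have "0 < l'" "l' < r" using r_gt_1 unfolding atLeastAtMost_iff by linarith+
      then have "\<not> r dvd l'" by (rule nat_dvd_not_less)
      then show "(if int r dvd int l' then of_nat ?q * cpar P l' else 0) = 0" by simp
    qed
    finally have 1: "dpar P 0 = - (\<Sum>j = 1..?q - 1. dpar P (int j))"
      unfolding split by (simp add: add_eq_0_iff)
    have "(\<Sum>j<?q. zeta P powi (- int l * int j) * dpar P (int j)) =
        (\<Sum>l' = 1..r - 1. if l' = l then of_nat ?q * cpar P l' else 0)"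
    proof -
      have dvd: "int p dvd int l" using True by simp
      show ?thesis unfolding dpar_fourier[OF dvd] using small by (intro sum.cong) auto
    qed
    also have "\<dots> = of_nat ?q * cpar P l" using l by (simp add: sum.delta)
    finally have 2: "dpar P 0 + (\<Sum>j = 1..?q - 1. inverse (zeta P) ^ (l * j) * dpar P (int j)) = of_nat ?q * cpar P l"
      unfolding split by (simp add: power_int_minus power_inverse flip: of_nat_mult)
    have "c_from_d r p (zeta P) d l = of_nat p / of_nat r *
      (- (\<Sum>j = 1..?q - 1. dpar P (int j)) + (\<Sum>j = 1..?q - 1. inverse (zeta P) ^ (l * j) * dpar P (int j)))"
      using True by (simp add: c_from_d_def d)
    also have "\<dots> = of_nat p / of_nat r * (of_nat ?q * cpar P l)"
      unfolding 1[symmetric] 2 ..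
    also have "\<dots> = of_nat (?q * p) / of_nat r * cpar P l" by simp
    also have "\<dots> = cpar P l" using r_gt_1 by (simp only: r_div_p) simp
    finally show ?thesis .
  qed
qed

section \<open>The eigenvectors at complex parameters\<close>

context chered
begin

lemma dpar_mod_div: "int (r div p) dvd j - j' \<Longrightarrow> dpar P j = dpar P j'"
proof -
  assume d: "int (r div p) dvd j - j'"
  have "zeta P powi (int l * j) * cpar P l = zeta P powi (int l * j') * cpar P l" if "l \<in> {1..r - 1}" for l
  proof (cases "p dvd l")
    case True
    then have "int p * int (r div p) dvd int l * (j - j')" using d by (intro mult_dvd_mono) auto
    then have "int r dvd int l * j - int l * j'"
      using r_div_p by (metis mult.commute of_nat_mult right_diff_distrib)
    then show ?thesis unfolding zeta_powi_mod by (metis mod_eq_dvd_iff)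
  next
    case False
    then show ?thesis using that cpar_0 by simp
  qed
  then show ?thesis unfolding dpar_def ordr by (intro sum.cong refl)
qed

text \<open>The c_l live on multiples of p, so d_j has period r/p and cancels between congruent
  parts.\<close>

lemma wt_diff_cong:
  assumes "int (r div p) dvd int (elt \<mu> i) - int (elt \<nu> j)"
  shows "wt \<mu> i - wt \<nu> j = kappa P * of_int (int (elt \<mu> i) - int (elt \<nu> j)) -
    of_nat r * c0par P * of_int (int (rk n \<mu> i) - int (rk n \<nu> j))"
proof -
  have "int (r div p) dvd int (elt \<nu> j) - int (elt \<mu> i)" using assms by (simp add: dvd_diff_commute)
  then have "dpar P (- int (Suc (elt \<mu> i))) = dpar P (- int (Suc (elt \<nu> j)))"
    by (intro dpar_mod_div) simp
  then show ?thesis by (simp add: wt_def ee_def algebra_simps)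
qed

lemma dvd_r_dvd_div: "int r dvd k \<Longrightarrow> int (r div p) dvd k"
  using r_div_p by (metis dvd_trans dvd_triv_left of_nat_dvd_iff)

end

text \<open>The assumption \<open>cpar_v\<close> says that the c_l arise from the coordinates v by
  the formula used for the generic parameters, so that evaluation at v sends each generic quantity
  to its complex counterpart.\<close>

locale chered_point = chered P n r p for P :: "complex cparams" and n r p :: nat +
  fixes v :: "nat \<Rightarrow> complex"
  assumes zeta_root: "zeta P = root_r r" and kappa_v: "kappa P = v 0" and c0_v: "c0par P = v 1"
    and cpar_v: "\<And>l. 1 \<le> l \<Longrightarrow> l \<le> r - 1 \<Longrightarrow> cpar P l = c_from_d r p (root_r r) (\<lambda>j. v (Suc j)) l"
begin

sublocale G: chered "generic_params n r p" n r p
  by (rule chered_generic_params[OF r_gt_1 n_pos p_pos p_dvd])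

lemma specializes_zeta_powi: "specializes v (gconst (root_r r) powi k) (root_r r powi k)"
  using zeta_nonzero by (intro specializes_powi specializes_const) (simp add: zeta_root)

lemma specializes_zeta_power: "specializes v (inverse (gconst (root_r r)) ^ k) (inverse (root_r r) ^ k)"
  using zeta_nonzero by (intro specializes_power specializes_inverse specializes_const) (simp add: zeta_root)

lemma specializes_c_from_d: "specializes v (c_from_d r p (gconst (root_r r)) (\<lambda>j. gvar (Suc j)) l)
    (c_from_d r p (root_r r) (\<lambda>j. v (Suc j)) l)"
proof (cases "p dvd l")
  case True
  have "(of_nat r :: complex) \<noteq> 0" using r_gt_1 by simp
  then show ?thesis
    unfolding c_from_d_def if_P[OF True]
    by (intro specializes_mult specializes_divide specializes_add specializes_minus
      specializes_sum specializes_of_nat specializes_zeta_power specializes_var)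
next
  case False
  then show ?thesis by (simp add: c_from_d_def specializes_zero)
qed

lemma specializes_dpar: "specializes v (dpar (generic_params n r p) j) (dpar P j)"
  unfolding dpar_def G.ordr ordr
proof (intro specializes_sum specializes_mult)
  fix l assume l: "l \<in> {1..r - 1}"
  show "specializes v (zeta (generic_params n r p) powi (int l * j)) (zeta P powi (int l * j))"
    using specializes_zeta_powi[of "int l * j"] by (simp add: generic_params_def zeta_root)
  show "specializes v (cpar (generic_params n r p) l) (cpar P l)"
    using specializes_c_from_d[of l] cpar_v l by (simp add: generic_params_def)
qed

lemma specializes_c0: "specializes v (c0par (generic_params n r p)) (c0par P)"
  using specializes_var[of v 1] by (simp add: generic_params_def c0_v)

lemma specializes_kappa: "specializes v (kappa (generic_params n r p)) (kappa P)"
  using specializes_var[of v 0] by (simp add: generic_params_def kappa_v)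

lemma specializes_ee: "specializes v (G.ee a) (ee a)"
  unfolding G.ee_def ee_def
  by (intro specializes_diff specializes_mult specializes_dpar specializes_of_nat specializes_kappa)

lemma specializes_wt: "specializes v (G.wt \<mu> i) (wt \<mu> i)"
  unfolding G.wt_def wt_def
  by (intro specializes_diff specializes_mult specializes_ee specializes_of_nat specializes_c0)

lemma specializes_cind: "specializes v (G.cind \<mu> i) (cind \<mu> i)"
  unfolding G.cind_def cind_def G.ind_def ind_def
  by (auto intro!: specializes_mult specializes_c0 specializes_of_nat specializes_zero)

lemma specializes_tcoef:
  assumes "int r dvd int (elt \<mu> i) - int (elt \<mu> (Suc i)) \<Longrightarrow> wt \<mu> i \<noteq> wt \<mu> (Suc i)"
  shows "specializes v (G.tcoef \<mu> i) (tcoef \<mu> i)"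
proof (cases "int r dvd int (elt \<mu> i) - int (elt \<mu> (Suc i))")
  case True
  then show ?thesis
    unfolding G.tcoef_def tcoef_def using assms
    by (intro specializes_divide specializes_cind specializes_diff specializes_wt) simp
next
  case False
  then show ?thesis
    by (simp add: G.tcoef_def tcoef_def G.cind_def cind_def G.ind_def ind_def specializes_zero)
qed

end

text \<open>Genericity is tested by evaluation at two points. For \<kappa> = 1 with c_0 and all c_l
  equal to 0 the weight is the part plus one, so generically equal weights have equal parts; for c_0
  = 1 the generic c_0 is seen to be nonzero.\<close>

lemma chered_generic_generic_params:
  assumes "r > 1" "n \<ge> 1" "p > 0" "p dvd r"
  shows "chered_generic (generic_params n r p) n r p"
proof -
  define Q where "Q a b = complex_params n r p a b (\<lambda>_. 0)" for a b :: complex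
  have point: "chered_point (Q a b) n r p (\<lambda>i. if i = 0 then a else if i = 1 then b else 0)" for a b
  proof
    show "zeta (Q a b) ^ r = 1" using assms root_r_power[of r] by (simp add: Q_def complex_params_def)
    fix l assume "0 < l" "l < r"
    then show "zeta (Q a b) ^ l \<noteq> 1" using root_r_primitive by (simp add: Q_def complex_params_def)
  qed (use assms in \<open>auto simp: Q_def complex_params_def c_from_d_def\<close>)
  interpret A: chered_point "Q 1 0" n r p "\<lambda>i. if i = 0 then 1 else if i = 1 then 0 else 0"
    by (rule point)
  interpret B: chered_point "Q 0 1" n r p "\<lambda>i. if i = 0 then 0 else if i = 1 then 1 else 0"
    by (rule point)
  show ?thesis
  proof
    fix \<mu> \<nu> i j
    assume eq: "A.G.wt \<mu> i = A.G.wt \<nu> j"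
    have "A.wt \<mu> i = A.wt \<nu> j"
      using A.specializes_wt[of \<mu> i] A.specializes_wt[of \<nu> j] unfolding eq by (rule specializes_unique)
    moreover have "A.wt \<rho> k = of_nat (Suc (elt \<rho> k))" for \<rho> k
    proof -
      have "kappa (Q 1 0) = 1" "c0par (Q 1 0) = 0" "dpar (Q 1 0) j = 0" for j
        by (simp_all add: dpar_def Q_def complex_params_def)
      then show ?thesis by (simp add: A.wt_def A.ee_def)
    qed
    ultimately have "(of_nat (Suc (elt \<mu> i)) :: complex) = of_nat (Suc (elt \<nu> j))" by simp
    then show "elt \<mu> i = elt \<nu> j" by (simp only: of_nat_eq_iff)
  next
    show "of_nat r * c0par (generic_params n r p) \<noteq> 0"
    proof
      assume z: "of_nat r * c0par (generic_params n r p) = 0"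
      have "of_nat r * c0par (Q 0 1) = 0"
        by (rule specializes_unique[OF specializes_mult[OF specializes_of_nat B.specializes_c0]])
          (simp only: z specializes_zero)
      then show False using assms by (simp add: Q_def complex_params_def)
    qed
  qed
qed

context chered_point
begin

sublocale G: chered_generic "generic_params n r p" n r p
  by (rule chered_generic_generic_params[OF r_gt_1 n_pos p_pos p_dvd])

lemma generic_exists:
  assumes "\<mu> \<in> expos n"
  shows "\<exists>F. G.isE \<mu> F"
  using assms n_pos
proof (induction rule: expo_induct)
  case zero
  show ?case using G.isE_zero by blast
next
  case (phi \<mu>)
  then show ?case using G.isE_Phi by blast
next
  case (swap \<mu> i)
  then show ?case using G.isE_swapI by blast
qed

lemma f_generic_eq: "G.isE \<mu> F \<Longrightarrow> f_generic n r p \<mu> = F"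
  unfolding f_generic_def by (rule G.t_eigenvector_the)

end

lemma chered_point_complex_params:
  assumes "r > 1" "n \<ge> 1" "p > 0" "p dvd r"
    and "\<And>l. 1 \<le> l \<Longrightarrow> l \<le> r - 1 \<Longrightarrow> \<not> p dvd l \<Longrightarrow> c l = 0"
  shows "chered_point (complex_params n r p \<kappa> c0 c) n r p (param_point (complex_params n r p \<kappa> c0 c))"
proof -
  let ?P = "complex_params n r p \<kappa> c0 c"
  interpret chered ?P n r p
  proof
    show "zeta ?P ^ r = 1" using assms root_r_power[of r] by (simp add: complex_params_def)
    fix l assume "0 < l" "l < r"
    then show "zeta ?P ^ l \<noteq> 1" using root_r_primitive by (simp add: complex_params_def)
  qed (use assms in \<open>auto simp: complex_params_def\<close>)
  show ?thesis
  proof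
    fix l assume l: "1 \<le> l" "l \<le> r - 1"
    have "c_from_d r p (zeta ?P) (\<lambda>j. param_point ?P (Suc j)) l = cpar ?P l"
      by (rule c_from_d_dpar[OF chered_axioms l]) (simp add: param_point_def)
    then show "cpar ?P l = c_from_d r p (root_r r) (\<lambda>j. param_point ?P (Suc j)) l"
      by (simp add: complex_params_def)
  qed (simp_all add: complex_params_def param_point_def)
qed

text \<open>\<open>nondegenerate\<close> says that the recursion producing the eigenvectors meets no pole.\<close>

locale chered_special = chered_point +
  assumes v_eq: "v = param_point P"
    and kappa_1: "kappa P = 1"
    and nondegenerate: "\<And>a m :: nat. 0 < a \<Longrightarrow> 1 \<le> m \<Longrightarrow> m \<le> n \<Longrightarrow> c0par P \<noteq> of_nat a / of_nat m"
begin

lemma c0_multiple_nonint: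
  assumes "c0par P * of_int m = of_int a" "0 < m" "m \<le> int n"
  shows "a \<le> 0"
proof (rule ccontr)
  assume "\<not> a \<le> 0"
  then have "c0par P = of_nat (nat a) / of_nat (nat m)"
    using assms by (simp add: field_simps)
  moreover have "0 < nat a" "1 \<le> nat m" "nat m \<le> n" using assms \<open>\<not> a \<le> 0\<close> by auto
  ultimately show False using nondegenerate by blast
qed

text \<open>Here m is the difference of the ranks and r a that of the parts; both are positive
  because the smaller part has the smaller rank.\<close>

lemma wt_adjacent:
  assumes i: "Suc i < n" and less: "elt \<mu> i < elt \<mu> (Suc i)"
    and d: "int r dvd int (elt \<mu> i) - int (elt \<mu> (Suc i))"
  obtains a m :: int where "0 < a" "0 < m" "m < int n"
    "wt \<mu> i - wt \<mu> (Suc i) = of_nat r * (c0par P * of_int m - of_int a)"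
proof -
  obtain b where b: "int (elt \<mu> i) - int (elt \<mu> (Suc i)) = int r * b" using d by (rule dvdE)
  have "b < 0"
  proof (rule ccontr)
    assume "\<not> b < 0"
    then have "int r * b \<ge> 0" by simp
    then show False using b less by simp
  qed
  have rk: "rk n \<mu> i < rk n \<mu> (Suc i)" using i less by (simp add: rk_less_iff expo_before_def)
  have "wt \<mu> i - wt \<mu> (Suc i) = of_nat r * (c0par P * of_int (int (rk n \<mu> (Suc i)) - int (rk n \<mu> i)) - of_int (- b))"
    using wt_diff_cong[OF dvd_r_dvd_div[OF d]] unfolding b kappa_1 by (simp add: algebra_simps)
  then show ?thesis
    using that[of "- b" "int (rk n \<mu> (Suc i)) - int (rk n \<mu> i)"] \<open>b < 0\<close> rk rk_less_n[OF i, of \<mu>] by simp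
qed

lemma wt_adjacent_neq:
  assumes "Suc i < n" "elt \<mu> i < elt \<mu> (Suc i)" "int r dvd int (elt \<mu> i) - int (elt \<mu> (Suc i))"
  shows "wt \<mu> i \<noteq> wt \<mu> (Suc i)"
proof
  assume eq: "wt \<mu> i = wt \<mu> (Suc i)"
  obtain a m :: int where am: "0 < a" "0 < m" "m < int n"
    "wt \<mu> i - wt \<mu> (Suc i) = of_nat r * (c0par P * of_int m - of_int a)"
    using wt_adjacent[OF assms] by blast
  then have "c0par P * of_int m = of_int a" using eq r_gt_1 by simp
  then show False using c0_multiple_nonint am by fastforce
qed

definition sf :: "expo \<Rightarrow> complex mpol" where
  "sf \<mu> = f_at P \<mu>"

text \<open>The generic and the complex recursion run in parallel along one path. Each step commutes
  with evaluation because the denominator, where the numerator is nonzero, does not vanish at the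
  point.\<close>

lemma specialised_exists:
  assumes "\<mu> \<in> expos n"
  shows "\<exists>F f. G.isE \<mu> F \<and> isE \<mu> f \<and> specF v F f"
  using assms n_pos
proof (induction rule: expo_induct)
  case zero
  show ?case using G.isE_zero isE_zero specF_one by blast
next
  case (phi \<mu>)
  then show ?case using G.isE_Phi isE_Phi specF_Phi by blast
next
  case (swap \<mu> i)
  then obtain F f where "G.isE \<mu> F" "isE \<mu> f" "specF v F f" by blast
  moreover have "specializes v (G.tcoef \<mu> i) (tcoef \<mu> i)"
    using swap wt_adjacent_neq by (intro specializes_tcoef) auto
  ultimately show ?case
    using swap wt_adjacent_neq G.isE_swapI isE_swap tra_permutes specF_add specF_scale specF_pact
    by (metis (no_types, lifting))
qed

lemma sf_eqI:
  assumes "G.isE \<mu> F" "specF v F f"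
  shows "sf \<mu> = f"
  unfolding sf_def f_at_def dimn ordr divp f_generic_eq[OF assms(1)] v_eq[symmetric] specF_def[symmetric]
  using assms(2) specF_unique by (intro the_equality)

lemma sf_spec:
  assumes "\<mu> \<in> expos n"
  obtains F where "G.isE \<mu> F" "specF v F (sf \<mu>)" "isE \<mu> (sf \<mu>)"
  using specialised_exists[OF assms] sf_eqI by metis

lemma sf_polys: "\<mu> \<in> expos n \<Longrightarrow> sf \<mu> \<in> polys n"
  and sf_cong: "\<mu> \<in> expos n \<Longrightarrow> cong_to \<mu> (sf \<mu>)"
  and sf_zeig: "\<mu> \<in> expos n \<Longrightarrow> zeig \<mu> (sf \<mu>)"
  using sf_spec isE_props by metis+

lemma sf_phi: "\<mu> \<in> expos n \<Longrightarrow> sf (phi n \<mu>) = Phi n (sf \<mu>)"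
  using sf_spec sf_eqI G.isE_Phi specF_Phi by metis

lemma sf_swap:
  assumes "\<mu> \<in> expos n" "Suc i < n" "elt \<mu> i < elt \<mu> (Suc i)"
  shows "sf (pexp (tra i (Suc i)) \<mu>) = pact (tra i (Suc i)) (sf \<mu>) + mscale (tcoef \<mu> i) (sf \<mu>)"
proof -
  obtain F where F: "G.isE \<mu> F" "specF v F (sf \<mu>)" using sf_spec[OF assms(1)] by metis
  have "specializes v (G.tcoef \<mu> i) (tcoef \<mu> i)"
    using assms wt_adjacent_neq by (intro specializes_tcoef) auto
  then show ?thesis
    using F assms by (intro sf_eqI[OF G.isE_swapI] specF_add specF_scale specF_pact[OF tra_permutes])
qed

text \<open>Inherited from the generic vector: at the given point a single weight need no longer
  determine its part.\<close>

lemma sf_adjacent_eq: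
  assumes "\<mu> \<in> expos n" "Suc i < n" "elt \<mu> i = elt \<mu> (Suc i)"
  shows "pact (tra i (Suc i)) (sf \<mu>) = sf \<mu>"
proof -
  obtain F where F: "G.isE \<mu> F" "specF v F (sf \<mu>)" using sf_spec[OF assms(1)] by metis
  have "specF v (pact (tra i (Suc i)) F) (pact (tra i (Suc i)) (sf \<mu>))"
    by (rule specF_pact[OF tra_permutes[OF assms(2)] F(2)])
  then show ?thesis using F specF_unique G.isE_adjacent_eq[OF F(1) assms(2,3)] by metis
qed

lemma sf_coeff: "\<mu> \<in> expos n \<Longrightarrow> co (sf \<mu>) \<mu> = 1"
proof -
  assume "\<mu> \<in> expos n"
  then obtain F where F: "G.isE \<mu> F" "specF v F (sf \<mu>)" using sf_spec by metis
  then have "specializes v 1 (co (sf \<mu>) \<mu>)" using G.isE_coeff[OF F(1)] unfolding specF_def by metis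
  then show ?thesis using specializes_one specializes_unique by metis
qed

lemma sf_keys_below: "\<mu> \<in> expos n \<Longrightarrow> keys_below n \<mu> (sf \<mu>)"
  unfolding keys_below_def
proof
  fix \<nu> assume "\<mu> \<in> expos n" and \<nu>: "\<nu> \<in> Poly_Mapping.keys (sf \<mu>)"
  then obtain F where F: "G.isE \<mu> F" "specF v F (sf \<mu>)" using sf_spec by metis
  have "\<nu> \<in> Poly_Mapping.keys F" using specF_zero_coeff[OF F(2), of \<nu>] \<nu> by (auto simp: in_keys_iff)
  then show "\<nu> = \<mu> \<or> expo_less n \<nu> \<mu>" using G.isE_keys_below[OF F(1)] by (simp add: keys_below_def)
qed

end

section \<open>Combinatorics of permutations and exponents\<close>

lemma permutes_adjacent_closure:
  assumes \<sigma>: "\<sigma> permutes {..<n}" and one: "R id"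
    and comp: "\<And>\<sigma> \<tau>. \<sigma> permutes {..<n} \<Longrightarrow> \<tau> permutes {..<n} \<Longrightarrow> R \<sigma> \<Longrightarrow> R \<tau> \<Longrightarrow> R (\<sigma> \<circ> \<tau>)"
    and adj: "\<And>i. Suc i < n \<Longrightarrow> R (tra i (Suc i))"
  shows "R \<sigma>"
proof -
  have t: "tra a b permutes {..<n}" if "a < n" "b < n" for a b
    using that by (intro permutes_swap_id) auto
  have less: "R (tra a b)" if "a < b" "b < n" for a b
    using that
  proof (induction b)
    case (Suc b)
    show ?case
    proof (cases "a = b")
      case True
      then show ?thesis using Suc.prems adj by simp
    next
      case False
      then have "a < b" using Suc.prems by simp
      \<comment> \<open>A transposition of distant positions is conjugate to a shorter one by an
        adjacent one.\<close>
      have "tra a (Suc b) = tra b (Suc b) \<circ> (tra a b \<circ> tra b (Suc b))"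
        using \<open>a < b\<close> by (auto simp: fun_eq_iff Transposition.transpose_def)
      then show ?thesis
        using Suc \<open>a < b\<close> adj[of b] by (simp only:) (intro comp t permutes_compose; simp)
    qed
  qed simp
  have tra: "R (tra a b)" if "a \<noteq> b" "a < n" "b < n" for a b
    using less[of a b] less[of b a] that transpose_commute[of a b] by (metis nat_neq_iff)
  show ?thesis
    using \<sigma> finite_lessThan
  proof (induction rule: permutes_induct)
    case id
    show ?case by (rule one)
  next
    case (swap a b \<tau>)
    then show ?case by (intro comp t tra) auto
  qed
qed

text \<open>Take i with the least displacement in A and j with the least one in B. Then \<sigma>
  maps A injectively to values from \<sigma> i - \<tau> i on, and \<tau> maps B to values from
  \<tau> j - \<sigma> j on. Since A and B together have n elements, the two displacements add up to
  at most n. This bound keeps denominators of c_0 within the excluded range.\<close>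

lemma permutes_close_displacements:
  fixes \<sigma> \<tau> :: "nat \<Rightarrow> nat"
  assumes \<sigma>: "\<sigma> permutes {..<n}" and \<tau>: "\<tau> permutes {..<n}" and ne: "i0 < n" "\<sigma> i0 \<noteq> \<tau> i0"
  obtains i j where "i < n" "j < n" "\<tau> i < \<sigma> i" "\<sigma> j \<le> \<tau> j" "\<sigma> i - \<tau> i + (\<tau> j - \<sigma> j) \<le> n"
proof -
  define A where "A = {i \<in> {..<n}. \<tau> i < \<sigma> i}"
  define B where "B = {i \<in> {..<n}. \<sigma> i \<le> \<tau> i}"
  have sum: "(\<Sum>i<n. \<sigma> i) = (\<Sum>i<n. \<tau> i)"
    using sum.permute[OF \<sigma>, of "\<lambda>i. i"] sum.permute[OF \<tau>, of "\<lambda>i. i"] by (simp add: comp_def)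
  have "A \<noteq> {}"
  proof
    assume "A = {}"
    then have le: "\<sigma> i \<le> \<tau> i" if "i < n" for i
      using that unfolding A_def by (metis (mono_tags, lifting) empty_iff lessThan_iff mem_Collect_eq not_less)
    then have "(\<Sum>i<n. \<sigma> i) < (\<Sum>i<n. \<tau> i)"
      using ne by (intro sum_strict_mono_ex1) (auto intro!: bexI[of _ i0] simp: order.strict_iff_order)
    then show False using sum by simp
  qed
  moreover have "B \<noteq> {}"
  proof
    assume "B = {}"
    then have "\<tau> i < \<sigma> i" if "i < n" for i
      using that unfolding B_def by (metis (mono_tags, lifting) empty_iff lessThan_iff mem_Collect_eq not_le)
    then have "(\<Sum>i<n. \<tau> i) < (\<Sum>i<n. \<sigma> i)"
      using ne by (intro sum_strict_mono) auto
    then show False using sum by simp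
  qed
  ultimately have ne': "(\<lambda>i. \<sigma> i - \<tau> i) ` A \<noteq> {}" "(\<lambda>i. \<tau> i - \<sigma> i) ` B \<noteq> {}" by auto
  have fin: "finite A" "finite B" by (auto simp: A_def B_def)
  obtain i where i: "i \<in> A" "\<And>i'. i' \<in> A \<Longrightarrow> \<sigma> i - \<tau> i \<le> \<sigma> i' - \<tau> i'"
    using Min_in[OF finite_imageI[OF fin(1)] ne'(1)] Min_le[OF finite_imageI[OF fin(1), of "\<lambda>i. \<sigma> i - \<tau> i"]]
    by (metis (no_types, lifting) image_iff)
  obtain j where j: "j \<in> B" "\<And>j'. j' \<in> B \<Longrightarrow> \<tau> j - \<sigma> j \<le> \<tau> j' - \<sigma> j'"
    using Min_in[OF finite_imageI[OF fin(2)] ne'(2)] Min_le[OF finite_imageI[OF fin(2), of "\<lambda>i. \<tau> i - \<sigma> i"]]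
    by (metis (no_types, lifting) image_iff)
  have lt: "\<sigma> i < n" "\<tau> i < n" if "i < n" for i
    using that permutes_in_image[OF \<sigma>, of i] permutes_in_image[OF \<tau>, of i] by auto
  have "\<sigma> i - \<tau> i \<le> \<sigma> x \<and> x < n" if "x \<in> A" for x
    using i(2)[OF that] that by (auto simp: A_def)
  then have "card A \<le> card {\<sigma> i - \<tau> i..<n}"
    using permutes_inj_on[OF \<sigma>] lt by (intro card_inj_on_le[where f = \<sigma>]) auto
  moreover have "\<tau> j - \<sigma> j \<le> \<tau> x \<and> x < n" if "x \<in> B" for x
    using j(2)[OF that] that by (auto simp: B_def)
  then have "card B \<le> card {\<tau> j - \<sigma> j..<n}"
    using permutes_inj_on[OF \<tau>] lt by (intro card_inj_on_le[where f = \<tau>]) auto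
  moreover have "card A + card B = n"
  proof -
    have "card A + card B = card (A \<union> B)"
      using fin by (intro card_Un_disjoint[symmetric]) (auto simp: A_def B_def)
    also have "A \<union> B = {..<n}" by (auto simp: A_def B_def)
    finally show ?thesis by simp
  qed
  moreover have "\<sigma> i < n" "\<tau> j < n" using i(1) j(1) lt by (auto simp: A_def B_def)
  ultimately have "\<sigma> i - \<tau> i + (\<tau> j - \<sigma> j) \<le> n" by simp
  then show ?thesis using that[of i j] i(1) j(1) by (auto simp: A_def B_def)
qed

section \<open>Exponents with a large part\<close>

definition big :: "nat \<Rightarrow> nat \<Rightarrow> expo set" where
  "big n k = {\<mu> \<in> expos n. \<exists>i<n. k \<le> elt \<mu> i}"

lemma big_phi_iff:
  assumes "n \<ge> 1"
  shows "phi n \<nu> \<in> big n k \<longleftrightarrow> \<nu> \<in> big n k \<or> (\<nu> \<in> expos n \<and> Suc (elt \<nu> 0) = k)"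
proof -
  have "(\<exists>i<n. k \<le> elt (phi n \<nu>) i) \<longleftrightarrow> (\<exists>i<n. k \<le> elt (phi n \<nu>) (cyc n i))"
    using permutes_in_image[OF cyc_permutes, of n] permutes_in_image[OF permutes_inv[OF cyc_permutes], of n]
      permutes_inverses(1)[OF cyc_permutes, of n] by (metis lessThan_iff)
  also have "\<dots> \<longleftrightarrow> (\<exists>i<n. k \<le> elt \<nu> i) \<or> Suc (elt \<nu> 0) = k"
    using assms by (auto simp: lookup_phi_cyc le_Suc_eq split: if_splits intro: exI[of _ 0])
  finally show ?thesis by (auto simp: big_def expos_phi[OF assms])
qed

lemma big_pexp:
  assumes "\<sigma> permutes {..<n}"
  shows "pexp \<sigma> \<mu> \<in> big n k \<longleftrightarrow> \<mu> \<in> big n k"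
proof -
  have "(\<exists>i<n. k \<le> elt (pexp \<sigma> \<mu>) i) \<longleftrightarrow> (\<exists>i<n. k \<le> elt (pexp \<sigma> \<mu>) (\<sigma> i))"
    using permutes_in_image[OF assms] permutes_in_image[OF permutes_inv[OF assms]]
      permutes_inverses(1)[OF assms] by (metis lessThan_iff)
  then show ?thesis by (simp add: big_def pexp_expos[OF assms] lookup_pexp_image[OF assms])
qed

text \<open>A unit whose removal still leaves a part of size k is removed within \<open>big\<close>
  by permuting its position to the end and undoing \<open>phi\<close>. What cannot be reduced in
  this way is k in one position and zeros elsewhere.\<close>

lemma big_mem_iff:
  assumes perm: "\<And>\<sigma> \<mu>. \<sigma> permutes {..<n} \<Longrightarrow> \<mu> \<in> big n k \<Longrightarrow> pexp \<sigma> \<mu> \<in> S \<longleftrightarrow> \<mu> \<in> S"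
    and phi: "\<And>\<nu>. \<nu> \<in> big n k \<Longrightarrow> phi n \<nu> \<in> S \<longleftrightarrow> \<nu> \<in> S"
    and n: "n \<ge> 1" and \<mu>: "\<mu> \<in> big n k"
  shows "\<mu> \<in> S \<longleftrightarrow> Poly_Mapping.single (n - 1) k \<in> S"
  using \<mu>
proof (induction "edeg n \<mu>" arbitrary: \<mu> rule: less_induct)
  case less
  show ?case
  proof (cases "\<exists>i<n. elt \<mu> i > 0 \<and> (\<exists>j<n. k \<le> elt \<mu> j - (if j = i then 1 else 0))")
    case True
    then obtain i j where i: "i < n" "elt \<mu> i > 0" and j: "j < n" "k \<le> elt \<mu> j - (if j = i then 1 else 0)"
      by blast
    let ?s = "tra i (n - 1)"
    have s: "?s permutes {..<n}" using i n by (intro permutes_swap_id) auto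
    have "pexp ?s \<mu> \<in> expos n" using less(2) unfolding pexp_expos[OF s] big_def by blast
    moreover have "elt (pexp ?s \<mu>) (n - 1) > 0" using i by (simp add: lookup_pexp_transpose)
    ultimately obtain \<nu> where \<nu>: "\<nu> \<in> expos n" "phi n \<nu> = pexp ?s \<mu>" using phi_surj[OF n] by metis
    let ?m = "pinv (cyc n) (?s j)"
    have m: "?m < n" "cyc n ?m = ?s j"
      using permutes_in_image[OF permutes_inv[OF cyc_permutes], of n "?s j"] permutes_in_image[OF s, of j] j
      by (auto simp: permutes_inverses[OF cyc_permutes])
    have "elt \<nu> ?m + (if ?m = 0 then 1 else 0) = elt \<mu> j"
      using lookup_phi_cyc[OF m(1), of \<nu>] unfolding m(2) \<nu>(2) lookup_pexp_image[OF s] by simp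
    moreover have "j = i" if "?m = 0"
    proof -
      have "?s j = n - 1" using m that n by (simp add: cyc_def)
      then show ?thesis by (metis transpose_apply_second transpose_eq_iff)
    qed
    ultimately have "k \<le> elt \<nu> ?m" using j by (auto split: if_splits)
    then have big: "\<nu> \<in> big n k" using \<nu>(1) m(1) by (auto simp: big_def)
    have "Suc (edeg n \<nu>) = edeg n \<mu>" using edeg_phi[OF n, of \<nu>] unfolding \<nu>(2) edeg_pexp[OF s] by simp
    then have "\<nu> \<in> S \<longleftrightarrow> Poly_Mapping.single (n - 1) k \<in> S" using less(1)[of \<nu>] big by simp
    then show ?thesis using phi[OF big] perm[OF s less(2)] \<nu>(2) by simp
  next
    case False
    obtain j where j: "j < n" "k \<le> elt \<mu> j" using less(2) by (auto simp: big_def)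
    have 0: "elt \<mu> i = 0" if "i \<noteq> j" for i
    proof (cases "i < n")
      case True
      then show ?thesis using False j that by (metis diff_zero gr0I)
    next
      case False
      then show ?thesis using less(2) by (simp add: big_def expos_iff)
    qed
    have "elt \<mu> j = k"
    proof (rule ccontr)
      assume "elt \<mu> j \<noteq> k"
      then have "elt \<mu> j > 0" "k \<le> elt \<mu> j - (if j = j then 1 else 0)" using j by auto
      then show False using False j by blast
    qed
    then have single: "\<mu> = Poly_Mapping.single j k"
      using 0 by (intro poly_mapping_eqI) (auto simp: lookup_single when_def)
    have s: "tra j (n - 1) permutes {..<n}" using j n by (intro permutes_swap_id) auto
    have "pexp (tra j (n - 1)) \<mu> = Poly_Mapping.single (n - 1) k"
      unfolding single pexp_single[OF s] by simp
    then show ?thesis using perm[OF s less(2)] by simp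
  qed
qed

section \<open>Submodules are spanned by eigenvectors\<close>

context chered
begin

lemma zeta_powi_eq_iff: "zeta P powi a = zeta P powi b \<longleftrightarrow> int r dvd a - b"
  using zeta_powi_eq_1[of "a - b"] by (simp add: power_int_diff)

lemma mvar_y_act_last:
  assumes f: "f \<in> polys n" "cong_to \<mu> f" "zeig \<mu> f"
  shows "mvar (n - 1) * y_act P (n - 1) f =
    mscale (wt \<mu> (n - 1) + (ee (elt \<mu> (n - 1)) - ee (Suc (elt \<mu> (n - 1))))) f"
proof -
  have n: "n - 1 < n" using n_pos by simp
  let ?d = "ee (elt \<mu> (n - 1)) - ee (Suc (elt \<mu> (n - 1)))"
  have "mvar (n - 1) * lin (ymon (n - 1)) f = zop (n - 1) f + mscale ?d f"
  proof (rule mlin_eqI[OF mlin_mult[OF mlin_lin] mlin_plus[OF mlin_zop mlin_mscale[OF mlin_ident]]])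
    fix m assume "m \<in> Poly_Mapping.keys f"
    then have "int r dvd int (elt m (n - 1)) - int (elt \<mu> (n - 1))"
      using f(2) by (simp add: cong_to_def)
    then have "ee (elt m (n - 1)) - ee (Suc (elt m (n - 1))) = ?d"
      using ee_diff_cong by (metis minus_diff_eq)
    then show "mvar (n - 1) * lin (ymon (n - 1)) (mon m) = zop (n - 1) (mon m) + mscale ?d (mon m)"
      by (simp only: lin_mon zop_mon mvar_ymon_last)
  qed
  then show ?thesis
    using f n by (simp add: y_act_eq zeig_def mpol.scale_left_distrib)
qed

lemma
  assumes "cherednik_submodule P N"
  shows submodule_subspace: "mpol.subspace N"
    and submodule_polys: "N \<subseteq> polys n"
    and submodule_mvar: "i < n \<Longrightarrow> f \<in> N \<Longrightarrow> mvar i * f \<in> N"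
    and submodule_y_act: "i < n \<Longrightarrow> f \<in> N \<Longrightarrow> y_act P i f \<in> N"
    and submodule_mat_act: "w \<in> Grpn P \<Longrightarrow> f \<in> N \<Longrightarrow> mat_act w f \<in> N"
  using assms unfolding cherednik_submodule_iff by blast+

lemma submodule_pact:
  assumes N: "cherednik_submodule P N" and "\<sigma> permutes {..<n}" "f \<in> N"
  shows "pact \<sigma> f \<in> N"
  using submodule_mat_act[OF N pmat_Grpn[OF assms(2)] assms(3)] submodule_polys[OF N] assms
  by (metis mat_act_pmat subsetD)

lemma submodule_zop:
  assumes N: "cherednik_submodule P N" and i: "i < n" and f: "f \<in> N"
  shows "zop i f \<in> N"
proof -
  have "f \<in> polys n" using f submodule_polys[OF N] by auto
  then have "zop i f = y_act P i (mvar i * f) + mscale (c0par P) (\<Sum>j<i. \<Sum>l<r. mat_act (refl_mat P i j l) f)"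
    using i by (simp add: z_elt_act)
  also have "\<dots> \<in> N"
    using i f by (intro mpol.subspace_add[OF submodule_subspace[OF N]] mpol.subspace_sum[OF submodule_subspace[OF N]]
        mpol.subspace_scale[OF submodule_subspace[OF N]] submodule_y_act[OF N] submodule_mvar[OF N]
        submodule_mat_act[OF N] refl_mat_Grpn) auto
  finally show ?thesis .
qed

end

lemma complex_eq_of_real_ratio:
  assumes "(c :: complex) * of_int m = of_int b" "m \<noteq> 0"
  shows "c = of_real (of_int b / of_int m)"
  using assms by (simp add: field_simps)

context chered_special
begin

text \<open>The shift e reflects that the diagonal part of G(r,p,n) sees differences of parts modulo
  r, but a single part only modulo r/p. If the ranks differ, some \<Delta>_i - \<Delta>_j between 1
  and n has an integral product with c_0, so c_0 is rational and not positive; c_0 = 0 and c_0 < 0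
  are then treated separately.\<close>

lemma wt_eq_imp_eq:
  assumes \<mu>: "\<mu> \<in> expos n" and \<nu>: "\<nu> \<in> expos n" and wt: "\<And>i. i < n \<Longrightarrow> wt \<mu> i = wt \<nu> i"
    and e: "int (r div p) dvd e"
    and shift: "\<And>i. i < n \<Longrightarrow> int r dvd int (elt \<mu> i) - int (elt \<nu> i) - e"
  shows "\<mu> = \<nu>"
proof -
  define \<delta> where "\<delta> i = int (elt \<mu> i) - int (elt \<nu> i)" for i
  define \<Delta> where "\<Delta> i = int (rk n \<mu> i) - int (rk n \<nu> i)" for i
  have \<delta>: "of_int (\<delta> i) = of_nat r * c0par P * of_int (\<Delta> i)" if "i < n" for i
  proof -
    have "int (r div p) dvd \<delta> i"
      using dvd_r_dvd_div[OF shift[OF that]] e dvd_diff_right_iff[of "int (r div p)" e "\<delta> i"]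
      by (metis \<delta>_def diff_add_cancel dvd_add)
    then show ?thesis
      using wt_diff_cong[of \<mu> i \<nu> i] wt[OF that] kappa_1 by (simp add: \<delta>_def \<Delta>_def)
  qed
  have eqI: "\<mu> = \<nu>" if z: "\<And>i. i < n \<Longrightarrow> of_nat r * c0par P * of_int (\<Delta> i) = 0"
  proof (rule G.expo_eqI[OF \<mu> \<nu>])
    fix i assume "i < n"
    then have "(of_int (\<delta> i) :: complex) = 0" using \<delta> z by metis
    then have "\<delta> i = 0" by simp
    then show "elt \<mu> i = elt \<nu> i" by (simp add: \<delta>_def)
  qed
  show ?thesis
  proof (cases "\<forall>i<n. rk n \<mu> i = rk n \<nu> i")
    case True
    then show ?thesis by (intro eqI) (simp add: \<Delta>_def)
  next
    case False
    then obtain i0 where "i0 < n" "rkf n \<mu> i0 \<noteq> rkf n \<nu> i0" by (auto simp: rkf_def)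
    then obtain i j where ij: "i < n" "j < n" "rkf n \<nu> i < rkf n \<mu> i" "rkf n \<mu> j \<le> rkf n \<nu> j"
      "rkf n \<mu> i - rkf n \<nu> i + (rkf n \<nu> j - rkf n \<mu> j) \<le> n"
      using permutes_close_displacements[OF rkf_permutes rkf_permutes] by metis
    have "int r dvd (\<delta> i - e) - (\<delta> j - e)"
      unfolding \<delta>_def by (rule dvd_diff[OF shift[OF ij(1)] shift[OF ij(2)]])
    then have "int r dvd \<delta> i - \<delta> j" by simp
    then obtain b where b: "\<delta> i - \<delta> j = int r * b" by (rule dvdE)
    have m: "0 < \<Delta> i - \<Delta> j" "\<Delta> i - \<Delta> j \<le> int n" using ij by (auto simp: \<Delta>_def rkf_def)
    have c: "c0par P * of_int (\<Delta> i - \<Delta> j) = of_int b"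
    proof -
      have "of_nat r * (c0par P * of_int (\<Delta> i - \<Delta> j)) = of_int (\<delta> i) - of_int (\<delta> j)"
        using \<delta>[OF ij(1)] \<delta>[OF ij(2)] by (simp add: algebra_simps)
      also have "\<dots> = of_nat r * of_int b"
        using arg_cong[OF b, of "of_int :: int \<Rightarrow> complex"] by simp
      finally show ?thesis using r_gt_1 by simp
    qed
    then have "b \<le> 0" using c0_multiple_nonint m by blast
    define q :: real where "q = - of_int b / of_int (\<Delta> i - \<Delta> j)"
    have "q \<ge> 0" using \<open>b \<le> 0\<close> m by (simp add: q_def divide_nonpos_pos)
    have cq: "c0par P = of_real (- q)"
      using complex_eq_of_real_ratio[OF c] m by (simp add: q_def)
    have \<delta>': "of_int (\<delta> x) = - (real r * q * of_int (\<Delta> x))" if "x < n" for x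
    proof -
      have "complex_of_real (of_int (\<delta> x)) = of_real (- (real r * q * of_int (\<Delta> x)))"
        using \<delta>[OF that] by (simp add: cq)
      then show ?thesis by (simp only: of_real_eq_iff)
    qed
    show ?thesis
    proof (cases "q = 0")
      case True
      then show ?thesis using cq by (intro eqI) simp
    next
      case False
      then have rq: "real r * q > 0" using \<open>q \<ge> 0\<close> r_gt_1 by simp
      \<comment> \<open>For \<open>c\<^sub>0 < 0\<close> the eigenvalues are strictly monotone along the ranks, so they determine them.\<close>
      have before: "expo_before \<nu> x y" if xy: "x < n" "y < n" "expo_before \<mu> x y" for x y
      proof (rule ccontr)
        assume "\<not> expo_before \<nu> x y"
        then have yx: "expo_before \<nu> y x"
          using expo_before_linear[of x y \<nu>] xy(3) expo_before_irrefl by metis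
        have "\<Delta> x - \<Delta> y < 0"
          using rk_strict_mono[OF xy(1,3)] rk_strict_mono[OF xy(2) yx] by (simp add: \<Delta>_def)
        then have "real r * q * of_int (\<Delta> x - \<Delta> y) < 0" by (intro mult_pos_neg rq) simp
        then have "real_of_int (\<delta> x) - of_int (\<delta> y) > 0"
          using \<delta>'[OF xy(1)] \<delta>'[OF xy(2)] by (simp add: algebra_simps)
        moreover have "\<delta> x \<le> \<delta> y"
          using xy(3) yx by (auto simp: \<delta>_def expo_before_def)
        ultimately show False by simp
      qed
      \<comment> \<open>This contradicts the choice of i, whose rank in \<mu> exceeds its rank in
        \<nu>.\<close>
      have "rk n \<mu> i \<le> rk n \<nu> i"
        unfolding rk_def using before[OF _ ij(1)] by (intro card_mono) auto
      then show ?thesis using ij by (simp add: rkf_def)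
    qed
  qed
qed

text \<open>If no generator of the commutative subalgebra separates the labels, all weights agree,
  adjacent differences agree modulo r and each part agrees modulo r/p, which is the situation of
  \<open>wt_eq_imp_eq\<close>.\<close>

lemma separating_operator:
  assumes N: "cherednik_submodule P N" and \<mu>: "\<mu> \<in> expos n" and \<nu>: "\<nu> \<in> expos n" and ne: "\<mu> \<noteq> \<nu>"
  obtains T t where "mlin T" "\<And>f. f \<in> N \<Longrightarrow> T f \<in> N"
    "\<And>\<rho>. \<rho> \<in> expos n \<Longrightarrow> T (sf \<rho>) = mscale (t \<rho>) (sf \<rho>)" "t \<mu> \<noteq> t \<nu>"
proof -
  note result = that
  have 1: thesis if "i < n" "wt \<mu> i \<noteq> wt \<nu> i" for i
    using that submodule_zop[OF N] sf_zeig by (intro result[of "zop i" "\<lambda>\<rho>. wt \<rho> i"]) (auto simp: zeig_def)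
  have 2: thesis if "Suc i < n" "zeta P powi (int (elt \<mu> (Suc i)) - int (elt \<mu> i)) \<noteq>
      zeta P powi (int (elt \<nu> (Suc i)) - int (elt \<nu> i))" for i
    by (rule result[of "mat_act (dg n i (zeta P) * dg n (Suc i) (inverse (zeta P)))"
          "\<lambda>\<rho>. zeta P powi (int (elt \<rho> (Suc i)) - int (elt \<rho> i))"])
      (use that dg_dg_Grpn[of i] submodule_mat_act[OF N] mat_act_zz sf_polys sf_cong in auto)
  have 3: thesis if "i < n" "zeta P powi (- (int p * int (elt \<mu> i))) \<noteq> zeta P powi (- (int p * int (elt \<nu> i)))" for i
    by (rule result[of "mat_act (dg n i (zeta P ^ p))" "\<lambda>\<rho>. zeta P powi (- (int p * int (elt \<rho> i)))"])
      (use that dg_power_Grpn[of i] submodule_mat_act[OF N] mat_act_zp sf_polys sf_cong in auto)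
  show thesis
  proof (rule ccontr)
    assume no: "\<not> thesis"
    let ?\<delta> = "\<lambda>i. int (elt \<mu> i) - int (elt \<nu> i)"
    have wt: "wt \<mu> i = wt \<nu> i" if "i < n" for i using 1 no that by blast
    have step: "int r dvd ?\<delta> (Suc i) - ?\<delta> i" if "Suc i < n" for i
    proof -
      have "int r dvd (int (elt \<mu> (Suc i)) - int (elt \<mu> i)) - (int (elt \<nu> (Suc i)) - int (elt \<nu> i))"
        using 2[OF that] no zeta_powi_eq_iff by blast
      then show ?thesis by (simp add: algebra_simps)
    qed
    have shift: "int r dvd ?\<delta> i - ?\<delta> 0" if "i < n" for i
      using that
    proof (induction i)
      case (Suc i)
      then have "int r dvd (?\<delta> (Suc i) - ?\<delta> i) + (?\<delta> i - ?\<delta> 0)"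
        using step[of i] by (intro dvd_add) auto
      moreover have "(?\<delta> (Suc i) - ?\<delta> i) + (?\<delta> i - ?\<delta> 0) = ?\<delta> (Suc i) - ?\<delta> 0" by simp
      ultimately show ?case by (simp only:)
    qed simp
    have "int r dvd - (int p * int (elt \<mu> 0)) - - (int p * int (elt \<nu> 0))"
      using 3[of 0] no zeta_powi_eq_iff n_pos by auto
    then have "int p * int (r div p) dvd int p * (int (elt \<nu> 0) - int (elt \<mu> 0))"
      using r_div_p by (metis (no_types, opaque_lifting) diff_minus_eq_add minus_mult_right mult.commute
          of_nat_mult right_diff_distrib uminus_add_conv_diff)
    then have "int (r div p) dvd int (elt \<nu> 0) - int (elt \<mu> 0)" using p_pos by simp
    then have "int (r div p) dvd ?\<delta> 0" by (simp add: dvd_diff_commute)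
    then show False using wt_eq_imp_eq[OF \<mu> \<nu> wt _ shift] ne by blast
  qed
qed

text \<open>Subtracting \<open>t \<nu>\<close> from T kills the component at \<nu> and keeps the one
  at \<mu>, so the support shrinks until only \<mu> is left.\<close>

lemma eigen_components:
  assumes N: "cherednik_submodule P N" and K: "finite K" "K \<subseteq> expos n"
    and c: "\<And>\<mu>. \<mu> \<in> K \<Longrightarrow> c \<mu> \<noteq> 0" and sum: "(\<Sum>\<mu>\<in>K. mscale (c \<mu>) (sf \<mu>)) \<in> N" and \<mu>: "\<mu> \<in> K"
  shows "sf \<mu> \<in> N"
  using assms(2-6)
proof (induction "card K" arbitrary: K c rule: less_induct)
  case less
  note sub = submodule_subspace[OF N]
  show ?case
  proof (cases "K = {\<mu>}")
    case True
    then have "mscale (c \<mu>) (sf \<mu>) \<in> N" using less by simp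
    then have "mscale (inverse (c \<mu>)) (mscale (c \<mu>) (sf \<mu>)) \<in> N"
      by (rule mpol.subspace_scale[OF sub])
    moreover have "mscale (inverse (c \<mu>)) (mscale (c \<mu>) (sf \<mu>)) = sf \<mu>" using less by simp
    ultimately show ?thesis by (simp only:)
  next
    case False
    then obtain \<nu> where \<nu>: "\<nu> \<in> K" "\<nu> \<noteq> \<mu>" using less by blast
    then obtain T t where T: "mlin T" "\<And>f. f \<in> N \<Longrightarrow> T f \<in> N"
      "\<And>\<rho>. \<rho> \<in> expos n \<Longrightarrow> T (sf \<rho>) = mscale (t \<rho>) (sf \<rho>)" "t \<mu> \<noteq> t \<nu>"
      using separating_operator[OF N, of \<mu> \<nu>] less by blast
    let ?f = "\<Sum>\<rho>\<in>K. mscale (c \<rho>) (sf \<rho>)"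
    let ?K = "{\<rho> \<in> K. t \<rho> \<noteq> t \<nu>}"
    have "T ?f - mscale (t \<nu>) ?f \<in> N"
      using T(2) less by (intro mpol.subspace_diff[OF sub] mpol.subspace_scale[OF sub]) auto
    also have "T ?f - mscale (t \<nu>) ?f = (\<Sum>\<rho>\<in>K. mscale (c \<rho> * (t \<rho> - t \<nu>)) (sf \<rho>))"
    proof -
      have "T ?f = (\<Sum>\<rho>\<in>K. mscale (c \<rho> * t \<rho>) (sf \<rho>))"
        unfolding mlin_sum[OF T(1)] using less T(3)
        by (intro sum.cong refl) (auto simp: mlin_scale[OF T(1)])
      then show ?thesis
        by (simp add: mpol.scale_sum_right sum_subtractf[symmetric] right_diff_distrib
            mpol.scale_left_diff_distrib mult.commute)
    qed
    also have "\<dots> = (\<Sum>\<rho>\<in>?K. mscale (c \<rho> * (t \<rho> - t \<nu>)) (sf \<rho>))"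
      using less by (intro sum.mono_neutral_right) auto
    finally have "(\<Sum>\<rho>\<in>?K. mscale (c \<rho> * (t \<rho> - t \<nu>)) (sf \<rho>)) \<in> N" .
    moreover have "card ?K < card K" using \<nu> less by (intro psubset_card_mono) auto
    ultimately show ?thesis
      using less T(4) by (intro less(1)[of ?K "\<lambda>\<rho>. c \<rho> * (t \<rho> - t \<nu>)"]) auto
  qed
qed

text \<open>The transition between monomials and eigenvectors is unitriangular and is inverted by
  induction on the height.\<close>

lemma mon_in_span_sf: "m \<in> expos n \<Longrightarrow> mon m \<in> mpol.span (sf ` expos n)"
proof (induction "expo_height n m" arbitrary: m rule: less_induct)
  case less
  let ?L = "Poly_Mapping.keys (sf m) - {m}"
  have m: "m \<in> Poly_Mapping.keys (sf m)" using sf_coeff[OF less(2)] by (simp add: in_keys_iff)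
  have "sf m = (\<Sum>\<nu>\<in>Poly_Mapping.keys (sf m). mscale (co (sf m) \<nu>) (mon \<nu>))" by (rule mpol_expand)
  also have "\<dots> = mon m + (\<Sum>\<nu>\<in>?L. mscale (co (sf m) \<nu>) (mon \<nu>))"
    using m sf_coeff[OF less(2)] by (simp add: sum.remove)
  finally have "mon m = sf m - (\<Sum>\<nu>\<in>?L. mscale (co (sf m) \<nu>) (mon \<nu>))"
    by (simp only: eq_diff_eq)
  moreover have "mon \<nu> \<in> mpol.span (sf ` expos n)" if "\<nu> \<in> ?L" for \<nu>
  proof (rule less(1))
    show "\<nu> \<in> expos n" using that sf_polys[OF less(2)] by (auto simp: polys_def)
    have "expo_less n \<nu> m" using that sf_keys_below[OF less(2)] by (auto simp: keys_below_def)
    then show "expo_height n \<nu> < expo_height n m" by (rule expo_less_height)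
  qed
  ultimately show ?case
    using less(2) by (metis (no_types, lifting) image_eqI mpol.span_base mpol.span_diff mpol.span_scale mpol.span_sum)
qed

lemma polys_eq_span_sf: "polys n = mpol.span (sf ` expos n)"
proof
  show "polys n \<subseteq> mpol.span (sf ` expos n)"
  proof
    fix f :: "complex mpol" assume f: "f \<in> polys n"
    show "f \<in> mpol.span (sf ` expos n)"
      by (subst mpol_expand[of f], intro mpol.span_sum mpol.span_scale mon_in_span_sf)
        (use f in \<open>auto simp: polys_def\<close>)
  qed
  show "mpol.span (sf ` expos n) \<subseteq> polys n"
    by (intro mpol.span_minimal subspace_polys) (auto simp: sf_polys)
qed

lemma submodule_eq_span:
  assumes N: "cherednik_submodule P N"
  shows "N = mpol.span (sf ` {\<mu> \<in> expos n. sf \<mu> \<in> N})"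
proof
  show "mpol.span (sf ` {\<mu> \<in> expos n. sf \<mu> \<in> N}) \<subseteq> N"
    by (intro mpol.span_minimal submodule_subspace[OF N]) auto
  show "N \<subseteq> mpol.span (sf ` {\<mu> \<in> expos n. sf \<mu> \<in> N})"
  proof
    fix f assume f: "f \<in> N"
    then have "f \<in> mpol.span (sf ` expos n)" using submodule_polys[OF N] polys_eq_span_sf by auto
    then obtain T a where T: "finite T" "T \<subseteq> sf ` expos n" "f = (\<Sum>g\<in>T. mscale (a g) g)"
      unfolding mpol.span_explicit by blast
    then obtain K where K: "K \<subseteq> expos n" "inj_on sf K" "T = sf ` K" by (meson subset_image_inj)
    let ?K = "{\<mu> \<in> K. a (sf \<mu>) \<noteq> 0}"
    have fin: "finite K" using T(1) K finite_imageD by blast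
    have "f = (\<Sum>\<mu>\<in>K. mscale (a (sf \<mu>)) (sf \<mu>))"
      unfolding T(3) K(3) by (rule sum.reindex[OF K(2), unfolded comp_def])
    also have "\<dots> = (\<Sum>\<mu>\<in>?K. mscale (a (sf \<mu>)) (sf \<mu>))"
      using fin by (intro sum.mono_neutral_right) auto
    finally have eq: "f = \<dots>" .
    have "sf \<mu> \<in> N" if "\<mu> \<in> ?K" for \<mu>
      by (rule eigen_components[OF N, of ?K "\<lambda>\<mu>. a (sf \<mu>)"]) (use fin K f eq that in auto)
    then show "f \<in> mpol.span (sf ` {\<mu> \<in> expos n. sf \<mu> \<in> N})"
      unfolding eq using K by (intro mpol.span_sum mpol.span_scale mpol.span_base) auto
  qed
qed

end

section \<open>Regularity of the eigenvectors excludes values of c_0\<close>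

context chered_point
begin

lemma f_well_defined_specializes:
  assumes "f_well_defined P \<mu>" "v = param_point P" "G.isE \<mu> F"
  shows "\<exists>z. specializes v (co F \<nu>) z"
  using assms f_generic_eq[OF assms(3)] by (auto simp: f_well_defined_def)

text \<open>At equal weights the recursion for \<open>f\<^bsub>s\<mu>\<^esub>\<close> has a pole, so \<open>f\<^sub>\<mu>\<close> and \<open>f\<^bsub>s\<mu>\<^esub>\<close> cannot both be regular.\<close>

lemma wt_neq_if_well_defined:
  assumes \<mu>: "\<mu> \<in> expos n" and i: "Suc i < n" "elt \<mu> i < elt \<mu> (Suc i)"
    and d: "int r dvd int (elt \<mu> i) - int (elt \<mu> (Suc i))" and c0: "c0par P \<noteq> 0"
    and v: "v = param_point P"
    and wd: "f_well_defined P \<mu>" "f_well_defined P (pexp (tra i (Suc i)) \<mu>)"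
  shows "wt \<mu> i \<noteq> wt \<mu> (Suc i)"
proof
  assume eq: "wt \<mu> i = wt \<mu> (Suc i)"
  let ?t = "tra i (Suc i)"
  obtain F where F: "G.isE \<mu> F" using generic_exists[OF \<mu>] by blast
  note F' = G.isE_swapI[OF F i]
  let ?w = "G.wt \<mu> i - G.wt \<mu> (Suc i)"
  have ne: "?w \<noteq> 0" using G.wt_elt[of i "Suc i" \<mu> \<mu>] i by auto
  obtain z where z: "specializes v (co (pact ?t F + mscale (G.tcoef \<mu> i) F) \<mu>) z"
    using f_well_defined_specializes[OF wd(2) v F'] by blast
  obtain z' where z': "specializes v (co (pact ?t F) \<mu>) z'"
    using f_well_defined_specializes[OF wd(1) v F] by (metis lookup_pact[OF tra_permutes[OF i(1)]])
  have "specializes v (?w * (co (pact ?t F + mscale (G.tcoef \<mu> i) F) \<mu> - co (pact ?t F) \<mu>))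
      ((wt \<mu> i - wt \<mu> (Suc i)) * (z - z'))"
    by (intro specializes_mult specializes_diff specializes_wt z z')
  moreover have "?w * (co (pact ?t F + mscale (G.tcoef \<mu> i) F) \<mu> - co (pact ?t F) \<mu>) = G.cind \<mu> i"
    using ne by (simp add: lookup_add G.isE_coeff[OF F] G.tcoef_def)
  ultimately have "cind \<mu> i = (wt \<mu> i - wt \<mu> (Suc i)) * (z - z')"
    using specializes_cind[of \<mu> i] specializes_unique by metis
  then show False using eq c0 d r_gt_1 by (simp add: cind_def ind_def)
qed

lemma c0_not_ratio:
  assumes v: "v = param_point P" and kappa: "kappa P = 1"
    and wd: "\<And>\<mu>. \<mu> \<in> big n k \<Longrightarrow> f_well_defined P \<mu>" and k: "k > 0"
    and a: "0 < a" and m: "1 \<le> m" "m < n"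
  shows "c0par P \<noteq> of_nat a / of_nat m"
proof
  assume c0: "c0par P = of_nat a / of_nat m"
  define b where "b = r * a"
  have "r * 1 \<le> b" unfolding b_def using a by (intro mult_le_mono) auto
  then have b: "2 \<le> b" using r_gt_1 by simp
  \<comment> \<open>The parts are k, k + r a, then m - 1 parts k + 1, then zeros. Position 1 has the
    top rank n - 1 and position 0 has rank n - 1 - m, so c_0 = a/m makes their weights coincide.
    Both this exponent and its swap have parts of size at least k, so both eigenvectors are assumed
    regular.\<close>
  define \<mu> where "\<mu> = Poly_Mapping.single 0 k + Poly_Mapping.single 1 (k + b) +
    (\<Sum>j\<in>{2..m}. Poly_Mapping.single j (k + 1))"
  have \<mu>: "elt \<mu> j = (if j = 0 then k else if j = 1 then k + b else if j \<le> m then k + 1 else 0)" for j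
    by (auto simp: \<mu>_def lookup_add lookup_sum lookup_single when_def sum.delta)
  have exp: "\<mu> \<in> expos n" using m by (auto simp: expos_iff \<mu>)
  have lt: "elt \<mu> 0 < elt \<mu> (Suc 0)" using b by (simp add: \<mu>)
  have "{j. j < n \<and> expo_before \<mu> j 1} = {..<n} - {1}"
  proof (rule Set.set_eqI)
    fix j
    show "j \<in> {j. j < n \<and> expo_before \<mu> j 1} \<longleftrightarrow> j \<in> {..<n} - {1}"
      using b m by (cases "j = 0"; cases "j = 1") (auto simp: expo_before_def \<mu>)
  qed
  then have rk1: "rk n \<mu> 1 = n - 1" using m by (simp add: rk_def)
  have "{j. j < n \<and> expo_before \<mu> j 0} = {m<..<n}"
    using m k b by (auto simp: expo_before_def \<mu>)
  then have rk0: "rk n \<mu> 0 = n - Suc m" by (simp add: rk_def)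
  have d: "int r dvd int (elt \<mu> 0) - int (elt \<mu> (Suc 0))" by (simp add: \<mu> b_def)
  have "wt \<mu> 0 - wt \<mu> 1 = of_int (int (elt \<mu> 0) - int (elt \<mu> 1)) -
      of_nat r * c0par P * of_int (int (rk n \<mu> 0) - int (rk n \<mu> 1))"
    using wt_diff_cong[OF dvd_r_dvd_div, of \<mu> 0 \<mu> 1] d kappa by simp
  also have "int (elt \<mu> 0) - int (elt \<mu> 1) = - int (r * a)" by (simp add: \<mu> b_def)
  also have "int (rk n \<mu> 0) - int (rk n \<mu> 1) = - int m" using m unfolding rk0 rk1 by simp
  also have "of_int (- int (r * a)) - of_nat r * c0par P * of_int (- int m) = 0"
    using m by (simp add: c0)
  finally have "wt \<mu> 0 = wt \<mu> (Suc 0)" by simp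
  moreover have big: "\<mu> \<in> big n k" using exp m by (auto simp: big_def \<mu> intro: exI[of _ 0])
  moreover have "pexp (tra 0 (Suc 0)) \<mu> \<in> big n k"
    using big m by (subst big_pexp) (auto intro: tra_permutes)
  ultimately show False
    using wt_neq_if_well_defined[OF exp _ lt d _ v wd wd] m a by (simp add: c0)
qed

end

section \<open>The submodule at critical parameters\<close>

context chered_special
begin

text \<open>For an increasing pair this is the recursion itself. For a decreasing pair it is solved
  backwards and gives the coefficient 1 - t^2. The values t = 1 and t = -1 would make c_0 (m - 1) or
  c_0 (m + 1) a positive integer with m < n, so the denominator n has to be excluded as
  well.\<close>

lemma pact_sf:
  assumes \<mu>: "\<mu> \<in> expos n" and i: "Suc i < n"
  obtains a b where "pact (tra i (Suc i)) (sf \<mu>) = mscale a (sf (pexp (tra i (Suc i)) \<mu>)) + mscale b (sf \<mu>)"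
    "a \<noteq> 0 \<or> pexp (tra i (Suc i)) \<mu> = \<mu>"
proof -
  note result = that
  let ?t = "tra i (Suc i)"
  note t = tra_permutes[OF i]
  consider "elt \<mu> i < elt \<mu> (Suc i)" | "elt \<mu> i = elt \<mu> (Suc i)" | "elt \<mu> (Suc i) < elt \<mu> i" by linarith
  then show thesis
  proof cases
    case 1
    then show thesis using sf_swap[OF \<mu> i 1] by (intro result[of 1 "- tcoef \<mu> i"]) auto
  next
    case 2
    have "pexp ?t \<mu> = \<mu>"
      using 2 by (intro poly_mapping_eqI) (auto simp: lookup_pexp_transpose Transposition.transpose_def)
    then show thesis using sf_adjacent_eq[OF \<mu> i 2] by (intro result[of 0 1]) auto
  next
    case 3
    let ?\<nu> = "pexp ?t \<mu>" and ?c = "tcoef (pexp ?t \<mu>) i"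
    have \<nu>: "?\<nu> \<in> expos n" "elt ?\<nu> i < elt ?\<nu> (Suc i)" "pexp ?t ?\<nu> = \<mu>"
      using \<mu> 3 pexp_tra_tra by (auto simp: pexp_expos[OF t] lookup_pexp_transpose)
    have \<mu>_eq: "sf \<mu> = pact ?t (sf ?\<nu>) + mscale ?c (sf ?\<nu>)"
      using sf_swap[OF \<nu>(1) i \<nu>(2)] \<nu>(3) by simp
    have tt: "pact ?t (pact ?t f) = f" for f :: "complex mpol"
      using pact_inv(1)[OF t, of f] by (simp add: inv_unique_comp)
    have "pact ?t (sf \<mu>) = sf ?\<nu> + mscale ?c (pact ?t (sf ?\<nu>))"
      by (subst \<mu>_eq) (simp add: mlin_add[OF mlin_pact] mlin_scale[OF mlin_pact] tt)
    also have "pact ?t (sf ?\<nu>) = sf \<mu> - mscale ?c (sf ?\<nu>)" by (subst \<mu>_eq) simp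
    finally have eq: "pact ?t (sf \<mu>) = mscale (1 - ?c * ?c) (sf ?\<nu>) + mscale ?c (sf \<mu>)"
      by (simp add: mpol.scale_right_diff_distrib mpol.scale_left_diff_distrib)
    have "1 - ?c * ?c \<noteq> 0"
    proof
      assume "1 - ?c * ?c = 0"
      then have pm: "?c = 1 \<or> ?c = -1" by (metis right_minus_eq square_eq_1_iff)
      then have d: "int r dvd int (elt ?\<nu> i) - int (elt ?\<nu> (Suc i))"
        by (auto simp: tcoef_def cind_def ind_def split: if_splits)
      obtain a m :: int where am: "0 < a" "0 < m" "m < int n"
        "wt ?\<nu> i - wt ?\<nu> (Suc i) = of_nat r * (c0par P * of_int m - of_int a)"
        using wt_adjacent[OF i \<nu>(2) d] by blast
      have "?c = c0par P / (c0par P * of_int m - of_int a)"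
        using d r_gt_1 unfolding tcoef_def am(4) by (simp add: cind_def ind_def)
      with pm have "c0par P = c0par P * of_int m - of_int a \<or> c0par P = - (c0par P * of_int m - of_int a)"
        by (cases "c0par P * of_int m - of_int a = 0") (auto simp: field_simps)
      then have "c0par P * of_int (m - 1) = of_int a \<or> c0par P * of_int (m + 1) = of_int a"
        by (auto simp: algebra_simps)
      then show False
        using c0_multiple_nonint[of "m - 1" a] c0_multiple_nonint[of "m + 1" a] am by (cases "m = 1") auto
    qed
    then show thesis using eq by (intro result) auto
  qed
qed

lemma sf_pexp_mem:
  assumes N: "cherednik_submodule P N" and \<sigma>: "\<sigma> permutes {..<n}" and \<mu>: "\<mu> \<in> expos n"
  shows "sf (pexp \<sigma> \<mu>) \<in> N \<longleftrightarrow> sf \<mu> \<in> N"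
proof -
  note sub = submodule_subspace[OF N]
  have step: "sf (pexp (tra i (Suc i)) \<mu>) \<in> N" if i: "Suc i < n" and \<mu>: "\<mu> \<in> expos n" "sf \<mu> \<in> N" for i \<mu>
  proof -
    let ?t = "tra i (Suc i)"
    obtain a b where ab: "pact ?t (sf \<mu>) = mscale a (sf (pexp ?t \<mu>)) + mscale b (sf \<mu>)"
      "a \<noteq> 0 \<or> pexp ?t \<mu> = \<mu>"
      using pact_sf[OF \<mu>(1) i] by blast
    show ?thesis
    proof (cases "a = 0")
      case False
      have "mscale a (sf (pexp ?t \<mu>)) = pact ?t (sf \<mu>) - mscale b (sf \<mu>)" using ab(1) by simp
      also have "\<dots> \<in> N"
        using submodule_pact[OF N tra_permutes[OF i] \<mu>(2)] \<mu>(2)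
        by (intro mpol.subspace_diff[OF sub] mpol.subspace_scale[OF sub])
      finally have "mscale (inverse a) (mscale a (sf (pexp ?t \<mu>))) \<in> N"
        by (rule mpol.subspace_scale[OF sub])
      then show ?thesis using False by simp
    next
      case True
      then show ?thesis using ab \<mu> by simp
    qed
  qed
  have "\<forall>\<mu>\<in>expos n. sf (pexp \<sigma> \<mu>) \<in> N \<longleftrightarrow> sf \<mu> \<in> N"
    using \<sigma>
  proof (rule permutes_adjacent_closure)
    show "\<forall>\<mu>\<in>expos n. sf (pexp id \<mu>) \<in> N \<longleftrightarrow> sf \<mu> \<in> N" by (simp add: id_def pexp_id)
  next
    fix i assume i: "Suc i < n"
    show "\<forall>\<mu>\<in>expos n. sf (pexp (tra i (Suc i)) \<mu>) \<in> N \<longleftrightarrow> sf \<mu> \<in> N"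
      using step[OF i] pexp_expos[OF tra_permutes[OF i]] pexp_tra_tra by metis
  next
    fix \<sigma> \<tau> :: "nat \<Rightarrow> nat"
    assume "\<sigma> permutes {..<n}" "\<tau> permutes {..<n}" "\<forall>\<mu>\<in>expos n. sf (pexp \<sigma> \<mu>) \<in> N \<longleftrightarrow> sf \<mu> \<in> N"
      "\<forall>\<mu>\<in>expos n. sf (pexp \<tau> \<mu>) \<in> N \<longleftrightarrow> sf \<mu> \<in> N"
    then show "\<forall>\<mu>\<in>expos n. sf (pexp (\<sigma> \<circ> \<tau>) \<mu>) \<in> N \<longleftrightarrow> sf \<mu> \<in> N"
      unfolding pexp_comp[OF \<open>\<sigma> permutes {..<n}\<close> \<open>\<tau> permutes {..<n}\<close>] using pexp_expos by blast
  qed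
  then show ?thesis using \<mu> by blast
qed

lemma mvar_cancel: "mvar i * f = mvar i * g \<Longrightarrow> f = (g :: complex mpol)"
  using mvar_nonzero[of i, where 'a = complex] by simp

text \<open>The scalar of xy on the shifted vector is its last weight minus one increment of
  \<open>ee\<close>. By \<open>wt_phi_last\<close> this increment is what separates it from the
  first weight of \<nu>; cancelling x leaves the permuted vector.\<close>

lemma y_act_sf_phi:
  assumes "\<nu> \<in> expos n"
  shows "y_act P (n - 1) (sf (phi n \<nu>)) = mscale (wt \<nu> 0) (pact (cyc n) (sf \<nu>))"
proof (rule mvar_cancel)
  have e: "phi n \<nu> \<in> expos n" using assms by (simp add: expos_phi[OF n_pos])
  have "elt (phi n \<nu>) (n - 1) = Suc (elt \<nu> 0)"
    using lookup_phi_cyc[of 0 n \<nu>] n_pos by (simp add: cyc_def)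
  then show "mvar (n - 1) * y_act P (n - 1) (sf (phi n \<nu>)) =
      mvar (n - 1) * mscale (wt \<nu> 0) (pact (cyc n) (sf \<nu>))"
    unfolding mvar_y_act_last[OF sf_polys[OF e] sf_cong[OF e] sf_zeig[OF e]] wt_phi_last
    by (simp add: sf_phi[OF assms] Phi_def mscale_mult_right)
qed

text \<open>A zero part in the last place has rank 0, and \<open>ee 0 = 0\<close>, so the scalar of
  xy vanishes.\<close>

lemma y_act_sf_last_zero:
  assumes \<mu>: "\<mu> \<in> expos n" and z: "elt \<mu> (n - 1) = 0"
  shows "y_act P (n - 1) (sf \<mu>) = 0"
proof (rule mvar_cancel)
  have "{j. j < n \<and> expo_before \<mu> j (n - 1)} = {}" using z by (auto simp: expo_before_def)
  then have "rk n \<mu> (n - 1) = 0" by (simp add: rk_def)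
  then show "mvar (n - 1) * y_act P (n - 1) (sf \<mu>) = mvar (n - 1) * 0"
    unfolding mvar_y_act_last[OF sf_polys[OF \<mu>] sf_cong[OF \<mu>] sf_zeig[OF \<mu>]]
    using z by (simp add: wt_def)
qed

lemma sf_phi_mem:
  assumes N: "cherednik_submodule P N" and \<nu>: "\<nu> \<in> expos n"
  shows "sf \<nu> \<in> N \<Longrightarrow> sf (phi n \<nu>) \<in> N"
    and "wt \<nu> 0 \<noteq> 0 \<Longrightarrow> sf (phi n \<nu>) \<in> N \<Longrightarrow> sf \<nu> \<in> N"
proof -
  assume "sf \<nu> \<in> N"
  then show "sf (phi n \<nu>) \<in> N"
    using n_pos unfolding sf_phi[OF \<nu>] Phi_def
    by (intro submodule_mvar[OF N] submodule_pact[OF N cyc_permutes]) auto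
next
  assume w: "wt \<nu> 0 \<noteq> 0" and "sf (phi n \<nu>) \<in> N"
  then have "mscale (wt \<nu> 0) (pact (cyc n) (sf \<nu>)) \<in> N"
    using submodule_y_act[OF N, of "n - 1" "sf (phi n \<nu>)"] n_pos y_act_sf_phi[OF \<nu>] by simp
  then have "mscale (inverse (wt \<nu> 0)) (mscale (wt \<nu> 0) (pact (cyc n) (sf \<nu>))) \<in> N"
    by (rule mpol.subspace_scale[OF submodule_subspace[OF N]])
  then have "pact (pinv (cyc n)) (mscale (inverse (wt \<nu> 0)) (mscale (wt \<nu> 0) (pact (cyc n) (sf \<nu>)))) \<in> N"
    by (rule submodule_pact[OF N permutes_inv[OF cyc_permutes]])
  then show "sf \<nu> \<in> N" using w by (simp add: pact_inv[OF cyc_permutes])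
qed

lemma submodule_eq_polys_if_one:
  assumes N: "cherednik_submodule P N" and 0: "sf 0 \<in> N"
  shows "N = polys n"
proof
  have "sf \<mu> \<in> N" if "\<mu> \<in> expos n" for \<mu>
    using that n_pos
  proof (induction rule: expo_induct)
    case (phi \<mu>)
    then show ?case using sf_phi_mem(1)[OF N] by blast
  next
    case (swap \<mu> i)
    then show ?case using sf_pexp_mem[OF N tra_permutes] by blast
  qed (rule 0)
  then show "polys n \<subseteq> N"
    unfolding polys_eq_span_sf by (intro mpol.span_minimal submodule_subspace[OF N]) auto
qed (rule submodule_polys[OF N])

text \<open>\<open>Phi\<close> multiplies by a variable, and swaps preserve a vanishing constant
  term. This is what keeps 1 outside the span of the large eigenvectors.\<close>

lemma sf_coeff_zero:
  assumes "\<mu> \<in> expos n" "\<mu> \<noteq> 0"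
  shows "co (sf \<mu>) 0 = 0"
proof -
  have "\<mu> = 0 \<or> co (sf \<mu>) 0 = 0"
    using assms(1) n_pos
  proof (induction rule: expo_induct)
    case (phi \<mu>)
    have "0 \<notin> phi n ` Poly_Mapping.keys (sf \<mu>)"
      using edeg_phi[OF n_pos] by (metis (no_types, lifting) edeg_def imageE lookup_zero nat.distinct(1) sum.neutral)
    then show ?case using keys_Phi[of n "sf \<mu>"] sf_phi[OF phi(1)] by (auto simp: in_keys_iff)
  next
    case (swap \<mu> i)
    then have "\<mu> \<noteq> 0" by auto
    then have "co (sf \<mu>) 0 = 0" using swap by simp
    moreover have "pexp \<sigma> 0 = 0" if "\<sigma> permutes S" for \<sigma> and S :: "nat set"
      by (rule poly_mapping_eqI) (simp add: lookup_pexp[OF that])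
    ultimately show ?case
      using swap permutes_inv[OF tra_permutes[OF swap(2)]]
      by (simp add: sf_swap lookup_add lookup_pact[OF tra_permutes])
  qed simp
  then show ?thesis using assms by simp
qed

end

text \<open>Hypotheses (i) and (ii) in terms of ranks: a part j - 1 of rank l has weight 0 iff
  \<open>ee j\<close> equals r c_0 l. Ranks run from 0 to n - 1 and correspond to n - l in the
  hypotheses.\<close>

locale chered_critical = chered_special +
  fixes k :: nat
  assumes k_pos: "k > 0" and k_r: "\<not> r dvd k"
    and ee_k: "ee k = of_nat r * c0par P * of_nat (n - 1)"
    and ee_neq: "\<And>j l. 0 < j \<Longrightarrow> \<not> r dvd j \<Longrightarrow> l < n \<Longrightarrow> (j, l) \<noteq> (k, n - 1) \<Longrightarrow>
      ee j \<noteq> of_nat r * c0par P * of_nat l"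
begin

text \<open>If r divides the part plus one, (ii) does not apply; there the d_j cancel, and a zero
  weight would make c_0 times a rank a positive integer, which \<open>nondegenerate\<close>
  excludes.\<close>

lemma wt_eq_0_iff:
  assumes i: "i < n"
  shows "wt \<mu> i = 0 \<longleftrightarrow> Suc (elt \<mu> i) = k \<and> rk n \<mu> i = n - 1"
proof (cases "r dvd Suc (elt \<mu> i)")
  case True
  then obtain b where b: "Suc (elt \<mu> i) = r * b" by (rule dvdE)
  then have "b > 0" by (metis gr0I mult_0_right nat.distinct(1))
  have "int r dvd (- int (Suc (elt \<mu> i))) - 0" unfolding b by simp
  then have "dpar P (- int (Suc (elt \<mu> i))) = dpar P 0" by (rule dpar_cong)
  then have ee: "ee (Suc (elt \<mu> i)) = of_nat r * of_nat b" unfolding ee_def kappa_1 b by simp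
  have "wt \<mu> i \<noteq> 0"
  proof
    assume "wt \<mu> i = 0"
    then have eq: "c0par P * of_int (int (rk n \<mu> i)) = of_int (int b)"
      using r_gt_1 unfolding wt_def ee by (simp add: mult.assoc)
    moreover have "rk n \<mu> i \<noteq> 0"
    proof
      assume "rk n \<mu> i = 0"
      then show False using eq \<open>b > 0\<close> by simp
    qed
    ultimately show False
      using c0_multiple_nonint[of "int (rk n \<mu> i)" "int b"] rk_less_n[OF i, of \<mu>] \<open>b > 0\<close> by simp
  qed
  then show ?thesis using True k_r by metis
next
  case False
  then show ?thesis
    using ee_neq[of "Suc (elt \<mu> i)" "rk n \<mu> i"] ee_k rk_less_n[OF i, of \<mu>] by (auto simp: wt_def)
qed

text \<open>Ties are ranked from the right, so position 0 has the top rank as soon as no part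
  exceeds it.\<close>

lemma wt_first_eq_0_iff:
  "wt \<mu> 0 = 0 \<longleftrightarrow> Suc (elt \<mu> 0) = k \<and> (\<forall>i<n. elt \<mu> i < k)"
proof -
  have "rk n \<mu> 0 = n - 1 \<longleftrightarrow> (\<forall>i<n. elt \<mu> i \<le> elt \<mu> 0)"
  proof -
    have eq: "{j. j < n \<and> expo_before \<mu> j 0} = {j \<in> {1..<n}. elt \<mu> j \<le> elt \<mu> 0}"
    proof (rule Collect_cong)
      fix j
      show "j < n \<and> expo_before \<mu> j 0 \<longleftrightarrow> j \<in> {1..<n} \<and> elt \<mu> j \<le> elt \<mu> 0"
        unfolding expo_before_def by (cases "j = 0") auto
    qed
    have "rk n \<mu> 0 = card {1..<n} \<longleftrightarrow> {j \<in> {1..<n}. elt \<mu> j \<le> elt \<mu> 0} = {1..<n}"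
      unfolding rk_def eq using card_subset_eq[of "{1..<n}" "{j \<in> {1..<n}. elt \<mu> j \<le> elt \<mu> 0}"]
      by (metis (no_types, lifting) finite_atLeastLessThan mem_Collect_eq subsetI)
    also have "\<dots> \<longleftrightarrow> (\<forall>j\<in>{1..<n}. elt \<mu> j \<le> elt \<mu> 0)" by blast
    also have "\<dots> \<longleftrightarrow> (\<forall>i<n. elt \<mu> i \<le> elt \<mu> 0)"
    proof
      assume all: "\<forall>j\<in>{1..<n}. elt \<mu> j \<le> elt \<mu> 0"
      show "\<forall>i<n. elt \<mu> i \<le> elt \<mu> 0"
      proof (intro allI impI)
        fix i assume "i < n"
        then show "elt \<mu> i \<le> elt \<mu> 0" using all by (cases "i = 0") auto
      qed
    qed simp
    also have "card {1..<n} = n - 1" by simp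
    finally show ?thesis .
  qed
  then show ?thesis using wt_eq_0_iff[of 0 \<mu>] n_pos by (auto simp: less_Suc_eq_le)
qed

text \<open>On \<open>big\<close> the first weight never vanishes, so \<open>phi\<close> can be
  followed in both directions and all labels are linked to a single one.\<close>

lemma sf_big_mem_iff:
  assumes N: "cherednik_submodule P N" and \<mu>: "\<mu> \<in> big n k"
  shows "sf \<mu> \<in> N \<longleftrightarrow> sf (Poly_Mapping.single (n - 1) k) \<in> N"
proof -
  have "\<mu> \<in> {\<mu>. sf \<mu> \<in> N} \<longleftrightarrow> Poly_Mapping.single (n - 1) k \<in> {\<mu>. sf \<mu> \<in> N}"
  proof (rule big_mem_iff[OF _ _ n_pos \<mu>])
    fix \<nu> assume \<nu>: "\<nu> \<in> big n k"
    then have "wt \<nu> 0 \<noteq> 0" unfolding wt_first_eq_0_iff by (auto simp: big_def not_less)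
    then show "phi n \<nu> \<in> {\<mu>. sf \<mu> \<in> N} \<longleftrightarrow> \<nu> \<in> {\<mu>. sf \<mu> \<in> N}"
      using sf_phi_mem[OF N, of \<nu>] \<nu> by (auto simp: big_def)
  qed (use sf_pexp_mem[OF N] in \<open>auto simp: big_def\<close>)
  then show ?thesis by simp
qed

text \<open>A label outside \<open>big\<close> is reached from 0 without the critical step, so every
  \<open>phi\<close> on the way can be undone inside N.\<close>

lemma small_mem_imp_zero_mem:
  assumes N: "cherednik_submodule P N" and "\<mu> \<in> expos n" "\<mu> \<notin> big n k" "sf \<mu> \<in> N"
  shows "sf 0 \<in> N"
proof -
  have "\<mu> \<notin> big n k \<longrightarrow> sf \<mu> \<in> N \<longrightarrow> sf 0 \<in> N"
    using assms(2) n_pos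
  proof (induction rule: expo_induct)
    case (phi \<mu>)
    show ?case
    proof (intro impI)
      assume b: "phi n \<mu> \<notin> big n k" and "sf (phi n \<mu>) \<in> N"
      moreover have "\<mu> \<notin> big n k" "wt \<mu> 0 \<noteq> 0"
        using b phi(1) unfolding big_phi_iff[OF n_pos] wt_first_eq_0_iff by auto
      ultimately show "sf 0 \<in> N" using phi sf_phi_mem(2)[OF N] by blast
    qed
  next
    case (swap \<mu> i)
    then show ?case using sf_pexp_mem[OF N tra_permutes] big_pexp[OF tra_permutes] by blast
  qed simp
  then show ?thesis using assms by blast
qed

lemma proper_submodule_eq:
  assumes N: "cherednik_submodule P N" and "N \<noteq> {0}" "N \<noteq> polys n"
  shows "N = mpol.span (sf ` big n k)"
proof -
  let ?S = "{\<mu> \<in> expos n. sf \<mu> \<in> N}"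
  have sub: "?S \<subseteq> big n k"
    using small_mem_imp_zero_mem[OF N] submodule_eq_polys_if_one[OF N] assms(3) by blast
  have "?S \<noteq> {}"
  proof
    assume "?S = {}"
    then have "N = mpol.span (sf ` {})" using submodule_eq_span[OF N] by metis
    then show False using assms(2) by simp
  qed
  then obtain \<mu> where "\<mu> \<in> big n k" "sf \<mu> \<in> N" using sub by blast
  then have "sf \<nu> \<in> N" if "\<nu> \<in> big n k" for \<nu>
    using sf_big_mem_iff[OF N] that by blast
  then have "?S = big n k" using sub by (auto simp: big_def)
  then show ?thesis using submodule_eq_span[OF N] by metis
qed

lemma mlin_span_big:
  assumes "mlin L" "\<And>\<mu>. \<mu> \<in> big n k \<Longrightarrow> L (sf \<mu>) \<in> mpol.span (sf ` big n k)"
    and "f \<in> mpol.span (sf ` big n k)"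
  shows "L f \<in> mpol.span (sf ` big n k)"
  using assms(3)
proof (induction rule: mpol.span_induct_alt)
  case base
  then show ?case by (simp add: mlin_zero[OF assms(1)] mpol.span_zero)
next
  case (step c g h)
  then show ?case
    unfolding mlin_add[OF assms(1)] mlin_scale[OF assms(1)] using assms(2)
    by (auto intro!: mpol.span_add mpol.span_scale)
qed

lemma pact_span_big:
  assumes "\<sigma> permutes {..<n}" "f \<in> mpol.span (sf ` big n k)"
  shows "pact \<sigma> f \<in> mpol.span (sf ` big n k)"
proof -
  have "\<forall>f\<in>mpol.span (sf ` big n k). pact \<sigma> f \<in> mpol.span (sf ` big n k)"
    using assms(1)
  proof (rule permutes_adjacent_closure)
    fix i assume i: "Suc i < n"
    have "pact (tra i (Suc i)) (sf \<mu>) \<in> mpol.span (sf ` big n k)" if \<mu>: "\<mu> \<in> big n k" for \<mu>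
    proof -
      have "\<mu> \<in> expos n" using \<mu> by (simp add: big_def)
      then obtain a b where ab: "pact (tra i (Suc i)) (sf \<mu>) =
          mscale a (sf (pexp (tra i (Suc i)) \<mu>)) + mscale b (sf \<mu>)"
        using pact_sf[OF _ i] by blast
      have "sf (pexp (tra i (Suc i)) \<mu>) \<in> mpol.span (sf ` big n k)" "sf \<mu> \<in> mpol.span (sf ` big n k)"
        using \<mu> by (simp_all add: mpol.span_base big_pexp[OF tra_permutes[OF i]])
      then show ?thesis unfolding ab by (intro mpol.span_add mpol.span_scale)
    qed
    then show "\<forall>f\<in>mpol.span (sf ` big n k). pact (tra i (Suc i)) f \<in> mpol.span (sf ` big n k)"
      using mlin_span_big[OF mlin_pact] by blast
  next
    fix \<sigma> \<tau> :: "nat \<Rightarrow> nat"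
    assume "\<sigma> permutes {..<n}" "\<tau> permutes {..<n}"
      "\<forall>f\<in>mpol.span (sf ` big n k). pact \<sigma> f \<in> mpol.span (sf ` big n k)"
      "\<forall>f\<in>mpol.span (sf ` big n k). pact \<tau> f \<in> mpol.span (sf ` big n k)"
    then show "\<forall>f\<in>mpol.span (sf ` big n k). pact (\<sigma> \<circ> \<tau>) f \<in> mpol.span (sf ` big n k)"
      unfolding pact_comp[OF \<open>\<sigma> permutes {..<n}\<close> \<open>\<tau> permutes {..<n}\<close>] by blast
  qed (simp add: id_def pact_id)
  then show ?thesis using assms by blast
qed

lemma span_big_polys: "mpol.span (sf ` big n k) \<subseteq> polys n"
  by (intro mpol.span_minimal subspace_polys) (auto simp: sf_polys big_def)

lemma obtain_permutes_last:
  assumes "i < n"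
  obtains \<sigma> where "\<sigma> permutes {..<n}" "\<sigma> (n - 1) = i"
proof
  show "tra i (n - 1) permutes {..<n}" using assms n_pos by (intro permutes_swap_id) auto
qed simp

text \<open>Conjugation by permutations reduces x_i and y_i to the last index. The operator y could
  leave the span only from \<open>phi n \<nu>\<close> to \<nu> when the last large part is lost, and
  there the factor \<open>wt \<nu> 0\<close> is 0.\<close>

lemma submodule_span_big: "cherednik_submodule P (mpol.span (sf ` big n k))"
proof -
  let ?M = "mpol.span (sf ` big n k)"
  have mvar_last: "mvar (n - 1) * f \<in> ?M" if f: "f \<in> ?M" for f
  proof -
    have Phi: "Phi n g \<in> ?M" if "g \<in> ?M" for g
    proof (rule mlin_span_big[OF mlin_Phi _ that])
      fix \<mu> assume \<mu>: "\<mu> \<in> big n k"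
      then have "phi n \<mu> \<in> big n k" by (simp add: big_phi_iff[OF n_pos])
      then show "Phi n (sf \<mu>) \<in> ?M"
        using \<mu> by (metis (no_types, lifting) big_def imageI mem_Collect_eq mpol.span_base sf_phi)
    qed
    have "Phi n (pact (pinv (cyc n)) f) \<in> ?M"
      by (intro Phi pact_span_big permutes_inv cyc_permutes f)
    then show ?thesis by (simp add: Phi_def pact_inv[OF cyc_permutes])
  qed
  have y_last: "y_act P (n - 1) f \<in> ?M" if f: "f \<in> ?M" for f
  proof -
    have eq: "y_act P (n - 1) g = lin (ymon (n - 1)) g" if "g \<in> ?M" for g
      using that span_big_polys n_pos by (intro y_act_eq) auto
    have "lin (ymon (n - 1)) f \<in> ?M"
    proof (rule mlin_span_big[OF mlin_lin _ f])
      fix \<mu> assume \<mu>: "\<mu> \<in> big n k"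
      then have e: "\<mu> \<in> expos n" by (simp add: big_def)
      have "y_act P (n - 1) (sf \<mu>) \<in> ?M"
      proof (cases "elt \<mu> (n - 1) = 0")
        case True
        then show ?thesis using y_act_sf_last_zero[OF e] by (simp add: mpol.span_zero)
      next
        case False
        then obtain \<nu> where \<nu>: "\<nu> \<in> expos n" "phi n \<nu> = \<mu>" using phi_surj[OF n_pos _ e] by blast
        have y: "y_act P (n - 1) (sf \<mu>) = mscale (wt \<nu> 0) (pact (cyc n) (sf \<nu>))"
          using y_act_sf_phi[OF \<nu>(1)] \<nu>(2) by simp
        show ?thesis
        proof (cases "\<nu> \<in> big n k")
          case True
          then show ?thesis
            unfolding y by (intro mpol.span_scale pact_span_big cyc_permutes mpol.span_base imageI)
        next
          case False
          then have "wt \<nu> 0 = 0"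
            using \<mu> \<nu> big_phi_iff[OF n_pos, of \<nu> k] unfolding wt_first_eq_0_iff
            by (auto simp: big_def not_le)
          then show ?thesis unfolding y by (simp add: mpol.span_zero)
        qed
      qed
      then show "lin (ymon (n - 1)) (sf \<mu>) \<in> ?M"
        using eq[of "sf \<mu>"] \<mu> by (metis imageI mpol.span_base)
    qed
    then show ?thesis using eq[OF f] by simp
  qed
  show ?thesis
    unfolding cherednik_submodule_iff
  proof (intro conjI allI impI ballI)
    show "mpol.subspace ?M" by (rule mpol.subspace_span)
    show "?M \<subseteq> polys n" by (rule span_big_polys)
    fix i f assume i: "i < n" and f: "f \<in> ?M"
    obtain \<sigma> where \<sigma>: "\<sigma> permutes {..<n}" "\<sigma> (n - 1) = i" using obtain_permutes_last[OF i] by blast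
    let ?g = "pact (pinv \<sigma>) f"
    have g: "?g \<in> ?M" "f = pact \<sigma> ?g"
      using pact_span_big[OF permutes_inv[OF \<sigma>(1)] f] pact_inv(2)[OF \<sigma>(1), of f, symmetric] by simp_all
    have "mvar i * f = pact \<sigma> (mvar (n - 1) * ?g)"
      using g(2) \<sigma> by (simp add: pact_mvar[OF \<sigma>(1)])
    then show "mvar i * f \<in> ?M" using pact_span_big[OF \<sigma>(1) mvar_last[OF g(1)]] by simp
    have "y_act P i f = pact \<sigma> (y_act P (n - 1) ?g)"
      using pact_y_act[OF \<sigma>(1), of "n - 1" ?g] g span_big_polys n_pos \<sigma> by auto
    then show "y_act P i f \<in> ?M" using pact_span_big[OF \<sigma>(1) y_last[OF g(1)]] by simp
  next
    fix w f assume w: "w \<in> Grpn P" and f: "f \<in> ?M"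
    show "mat_act w f \<in> ?M"
    proof (rule mlin_span_big[OF mlin_mat_act _ f])
      fix \<mu> assume \<mu>: "\<mu> \<in> big n k"
      then have e: "\<mu> \<in> expos n" by (simp add: big_def)
      obtain \<sigma> c where "\<sigma> permutes {..<n}" "mat_act w (sf \<mu>) = mscale c (pact \<sigma> (sf \<mu>))"
        using mat_act_Grpn_cong_to[OF w sf_polys[OF e] sf_cong[OF e]] by blast
      then show "mat_act w (sf \<mu>) \<in> ?M"
        using \<mu> by (simp add: mpol.span_scale pact_span_big mpol.span_base)
    qed
  qed
qed

lemma span_big_nonzero: "mpol.span (sf ` big n k) \<noteq> {0}"
proof -
  let ?\<mu> = "Poly_Mapping.single (n - 1) k"
  have \<mu>: "?\<mu> \<in> big n k" using n_pos by (auto simp: big_def expos_iff lookup_single when_def intro!: exI[of _ "n - 1"])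
  then have "sf ?\<mu> \<noteq> 0" using sf_coeff[of ?\<mu>] by (auto simp: big_def)
  then show ?thesis using \<mu> by (metis imageI mpol.span_base singletonD)
qed

lemma span_big_proper: "mpol.span (sf ` big n k) \<noteq> polys n"
proof
  assume eq: "mpol.span (sf ` big n k) = polys n"
  have "(1 :: complex mpol) \<in> polys n" by (auto simp: polys_def expos_iff)
  then have "(1 :: complex mpol) \<in> mpol.span (sf ` big n k)" using eq by simp
  moreover have "mpol.span (sf ` big n k) \<subseteq> {f. co f 0 = 0}"
  proof (rule mpol.span_minimal)
    show "mpol.subspace {f. co f 0 = (0 :: complex)}"
      by (rule mpol.subspaceI) (auto simp: lookup_add)
    have "\<mu> \<noteq> 0" if "\<mu> \<in> big n k" for \<mu> using that k_pos by (auto simp: big_def)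
    then show "sf ` big n k \<subseteq> {f. co f 0 = 0}" using sf_coeff_zero by (auto simp: big_def)
  qed
  ultimately show False by (auto simp: lookup_one)
qed

theorem proper_nonzero_submodules:
  "{N. cherednik_submodule P N \<and> N \<noteq> {0} \<and> N \<noteq> polys n} = {mpol.span (sf ` big n k)}"
  using proper_submodule_eq submodule_span_big span_big_nonzero span_big_proper by blast

end

theorem theorem7p1:
  fixes n r p k :: nat and c0 :: complex and c :: "nat \<Rightarrow> complex" and P :: "complex cparams"
  defines "P \<equiv> complex_params n r p 1 c0 c"
  assumes "r > 1" and "n \<ge> 1" and "p > 0" and "p dvd r"
    and "\<And>l. 1 \<le> l \<Longrightarrow> l \<le> r - 1 \<Longrightarrow> \<not> p dvd l \<Longrightarrow> c l = 0"
    and "k > 0" and "\<not> r dvd k"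
    and "dpar P 0 - dpar P (- int k) + of_nat r * c0 * (of_nat n - 1) = of_nat k"
    and "\<And>j l :: nat. j > 0 \<Longrightarrow> \<not> r dvd j \<Longrightarrow> 1 \<le> l \<Longrightarrow> l \<le> n \<Longrightarrow> (j, l) \<noteq> (k, 1) \<Longrightarrow>
      dpar P 0 - dpar P (- int j) + of_nat r * c0 * (of_nat n - of_nat l) \<noteq> of_nat j"
    and "\<And>m :: nat. m > 0 \<Longrightarrow> c0 \<noteq> of_nat m / of_nat n"
    and "\<And>\<mu>. \<mu> \<in> expos n \<Longrightarrow> \<exists>i<n. Poly_Mapping.lookup \<mu> i \<ge> k \<Longrightarrow> f_well_defined P \<mu>"
  shows "{N. cherednik_submodule P N \<and> N \<noteq> {0} \<and> N \<noteq> polys n} =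
    {mpol.span {f_at P \<mu> | \<mu>. \<mu> \<in> expos n \<and> (\<exists>i<n. Poly_Mapping.lookup \<mu> i \<ge> k)}}"
proof -
  have P: "kappa P = 1" "c0par P = c0" by (simp_all add: P_def complex_params_def)
  interpret chered_point P n r p "param_point P"
    unfolding P_def by (rule chered_point_complex_params) (use assms in auto)
  interpret chered_special P n r p "param_point P"
  proof
    fix a m :: nat assume am: "0 < a" "1 \<le> m" "m \<le> n"
    have wd: "f_well_defined P \<mu>" if "\<mu> \<in> big n k" for \<mu>
      using that assms(12) by (auto simp: big_def)
    show "c0par P \<noteq> of_nat a / of_nat m"
    proof (cases "m = n")
      case True
      then show ?thesis using assms(11) am P by simp
    next
      case False
      then show ?thesis using c0_not_ratio[OF refl P(1) wd \<open>k > 0\<close>] am by simp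
    qed
  qed (simp_all add: P)
  interpret chered_critical P n r p "param_point P" k
  proof
    show "ee k = of_nat r * c0par P * of_nat (n - 1)"
      using assms(9) \<open>n \<ge> 1\<close> unfolding ee_def P by (simp add: algebra_simps)
    fix j l assume jl: "0 < j" "\<not> r dvd j" "l < n" "(j, l) \<noteq> (k, n - 1)"
    then have "(j, n - l) \<noteq> (k, 1)" by auto
    then have "dpar P 0 - dpar P (- int j) + of_nat r * c0 * (of_nat n - of_nat (n - l)) \<noteq> of_nat j"
      using jl by (intro assms(10)) auto
    moreover have "(of_nat n - of_nat (n - l) :: complex) = of_nat l" using jl(3) by (simp add: of_nat_diff)
    ultimately show "ee j \<noteq> of_nat r * c0par P * of_nat l"
      unfolding ee_def P by (simp add: algebra_simps)
  qed (use assms in auto)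
  have "sf ` big n k = {f_at P \<mu> | \<mu>. \<mu> \<in> expos n \<and> (\<exists>i<n. Poly_Mapping.lookup \<mu> i \<ge> k)}"
    by (auto simp: sf_def big_def)
  then show ?thesis using proper_nonzero_submodules by simp
qed

end
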